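(* Let $R$ be a ring and $S$ be a multiplicative subset of $R$ which is generated by normal elements of $R$. Let $\mathfrak{a}=\{r\in R\mid srt=0\text{ for some } s,t\in S\}$ and suppose that $|\min(\mathfrak{a})|<\infty$ (e.g. $R$ is a one-sided Noetherian ring). For each $\mathfrak{p}\in\min(\mathfrak{a})$, let $\pi_{\mathfrak{p}}:R\to R/\mathfrak{p}$, $r\mapsto r+\mathfrak{p}$. Then: 1. The map $\min(\mathfrak{a})\to\mathrm{Spec}(R\langle S^{-1}\rangle)=\mathrm{Spec}(\overline{S}^{-1}\overline{R})$, $\mathfrak{p}\mapsto\overline{S}^{-1}\overline{\mathfrak{p}}$ is an injection, and $\mathfrak{n}_{\overline{S}^{-1}\overline{R}}\subseteq\overline{S}^{-1}\mathfrak{n}_{\overline{R}}$. 2. $\widetilde{\overline{S}}\in\mathrm{Den}(\widetilde{R},0)$, $\overline{S}^{-1}\overline{R}/\overline{S}^{-1}\mathfrak{n}_{\overline{R}}\simeq\widetilde{\overline{S}}^{-1}\widetilde{R}$, and the map $\min(\mathfrak{a})\to\min(\widetilde{\overline{S}}^{-1}\widetilde{R})$, $\mathfrak{p}\mapsto\widetilde{\overline{S}}^{-1}\widetilde{\overline{\mathfrak{p}}}$ is a bijection. 3. For each $\mathfrak{p}\in\min(\mathfrak{a})$, $\pi_{\mathfrak{p}}(S)\in\mathrm{Den}(R/\mathfrak{p},0)$ and $$\pi_{\mathfrak{p}}(S)^{-1}(R/\mathfrak{p})\simeq\widetilde{\overline{S}}^{-1}\widetilde{R}/\widetilde{\overline{S}}^{-1}\widetilde{\overline{\mathfrak{p}}}\simeq\overline{S}^{-1}\overline{R}/\overline{S}^{-1}\overline{\mathfrak{p}},$$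 and there is a commutative diagram formed by the following natural ring homomorphisms: $\pi_{\mathfrak{p}}$ factors as $R\xrightarrow{\pi}\overline{R}\xrightarrow{\widetilde{\pi}}\widetilde{R}\xrightarrow{\widetilde{\pi}_{\mathfrak{p}}}R/\mathfrak{p}$; the localization maps $\overline{R}\to\overline{S}^{-1}\overline{R}$, $\widetilde{R}\to\widetilde{\overline{S}}^{-1}\widetilde{R}$, $R/\mathfrak{p}\to\pi_{\mathfrak{p}}(S)^{-1}(R/\mathfrak{p})$; the maps $\overline{S}^{-1}\overline{R}\to\widetilde{\overline{S}}^{-1}\widetilde{R}\to\pi_{\mathfrak{p}}(S)^{-1}(R/\mathfrak{p})$ induced by $\widetilde{\pi}$ and $\widetilde{\pi}_{\mathfrak{p}}$; the quotient map $\overline{S}^{-1}\overline{R}\to\overline{S}^{-1}\overline{R}/\overline{S}^{-1}\mathfrak{n}_{\overline{R}}$ and the isomorphism $\overline{S}^{-1}\overline{R}/\overline{S}^{-1}\mathfrak{n}_{\overline{R}}\simeq\widetilde{\overline{S}}^{-1}\widetilde{R}$; the quotient map $\widetilde{\overline{S}}^{-1}\widetilde{R}\to\widetilde{\overline{S}}^{-1}\widetilde{R}/\widetilde{\overline{S}}^{-1}\widetilde{\overline{\mathfrak{p}}}$ and the isomorphism $\widetilde{\overline{S}}^{-1}\widetilde{R}/\widetilde{\overline{S}}^{-1}\widetilde{\overline{\mathfrak{p}}}\simeq\pi_{\mathfrak{p}}(S)^{-1}(R/\mathfrak{p})$; the maps $\overline{S}^{-1}\overline{R}/\mathfrak{n}_{\overline{S}^{-1}\overline{R}}\to\overline{S}^{-1}\overline{R}/\overline{S}^{-1}\mathfrak{n}_{\overline{R}}\to\widetilde{\overline{S}}^{-1}\widetilde{R}/\widetilde{\overline{S}}^{-1}\widetilde{\overline{\mathfrak{p}}}$;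 and the map $\overline{S}^{-1}\overline{R}/\overline{S}^{-1}\mathfrak{n}_{\overline{R}}\to\overline{S}^{-1}\overline{R}/\overline{S}^{-1}\overline{\mathfrak{p}}$ followed by the isomorphism $\overline{S}^{-1}\overline{R}/\overline{S}^{-1}\overline{\mathfrak{p}}\simeq\widetilde{\overline{S}}^{-1}\widetilde{R}/\widetilde{\overline{S}}^{-1}\widetilde{\overline{\mathfrak{p}}}$. 4. Suppose that the prime radical $\mathfrak{n}_{\overline{R}}$ is a nilpotent ideal (e.g. the ring $\overline{R}$ is one-sided Noetherian). Then: (a) The map $\min(\mathfrak{a})\to\min(R\langle S^{-1}\rangle)=\min(\overline{S}^{-1}\overline{R})$, $\mathfrak{p}\mapsto\overline{S}^{-1}\overline{\mathfrak{p}}$ is a bijection, i.e. $\min(R\langle S^{-1}\rangle)=\{\overline{S}^{-1}\overline{\mathfrak{p}}\mid\mathfrak{p}\in\min(\mathfrak{a})\}$. (b) $\widetilde{\overline{S}}\in\mathrm{Den}(\widetilde{R},0)$, $\overline{S}^{-1}\mathfrak{n}_{\overline{R}}=\mathfrak{n}_{\overline{S}^{-1}\overline{R}}$ and $\overline{S}^{-1}\overline{R}/\overline{S}^{-1}\mathfrak{n}_{\overline{R}}\simeq\overline{S}^{-1}\overline{R}/\mathfrak{n}_{\overline{S}^{-1}\overline{R}}\simeq\widetilde{\overline{S}}^{-1}\widetilde{R}$.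
   Context: Rings are associative with $1$; ideals are two-sided. A multiplicative subset $S$ of $R$ is a multiplicative subsemigroup with $1\in S$, $0\notin S$. An element $x\in R$ is normal if $Rx=xR$. $S$ is a left Ore set if $Sr\cap Rs\neq\emptyset$ for all $r\in R$, $s\in S$, and a left denominator set if moreover $rs=0$ ($r\in R$, $s\in S$) implies $tr=0$ for some $t\in S$; right versions are symmetric. $\mathrm{Den}(R,\mathfrak{b})$ is the set of left and right denominator sets $S$ of $R$ with $\{r\in R\mid sr=0\text{ for some }s\in S\}=\mathfrak{b}$. For a denominator set $S$, $S^{-1}R=\{s^{-1}r\}$ is the ring of fractions and for a left ideal $I$, $S^{-1}I=\{s^{-1}i\mid s\in S, i\in I\}$. The localization of $R$ at a subset $S$ is $R\langle S^{-1}\rangle=R\langle X_S\rangle/I_S$, where $R\langle X_S\rangle$ is the ring freely generated by $R$ and a set $X_S=\{x_s\mid s\in S\}$ of free noncommuting indeterminates and $I_S$ is the ideal generated by $\{sx_s-1,\ x_ss-1\mid s\in S\}$. For a ring $R$: $\mathrm{Spec}(R)$ is the set of prime ideals, $\min(R)$ the set of minimal primes, $\mathfrak{n}_R$ the prime radical (intersection of all primes). For an ideal $\mathfrak{a}$, $\min(\mathfrak{a})$ is the set of prime ideals minimal over $\mathfrak{a}$. Known facts and notation: a multiplicative set $S$ generated by normal elements is a left and right Ore set; for such $S$ the set $\mathfrak{a}=\{r\in R\mid srt=0\text{ for some }s,t\in S\}$ is a proper ideal of $R$, and with $\pi:R\to\overline{R}:=R/\mathfrak{a}$, $r\mapsto\overline{r}=r+\mathfrak{a}$,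 and $\overline{S}:=\pi(S)$, one has $\overline{S}\in\mathrm{Den}(\overline{R},0)$ and an $R$-isomorphism $R\langle S^{-1}\rangle\simeq\overline{S}^{-1}\overline{R}$, used to identify these rings. Let $\widetilde{\pi}:\overline{R}\to\widetilde{R}:=\overline{R}/\mathfrak{n}_{\overline{R}}$ be the quotient map and $\widetilde{\overline{S}}:=\widetilde{\pi}(\overline{S})$ (also written $\widetilde{S}$). For $\mathfrak{p}\in\min(\mathfrak{a})$, $\overline{\mathfrak{p}}:=\pi(\mathfrak{p})\in\min(\overline{R})$ and $\widetilde{\overline{\mathfrak{p}}}:=\widetilde{\pi}(\overline{\mathfrak{p}})\in\min(\widetilde{R})$; $\mathfrak{p}\mapsto\overline{\mathfrak{p}}\mapsto\widetilde{\overline{\mathfrak{p}}}$ are bijections $\min(\mathfrak{a})\to\min(\overline{R})\to\min(\widetilde{R})$. $\widetilde{\pi}_{\mathfrak{p}}:\widetilde{R}\to R/\mathfrak{p}$ is the natural epimorphism. *)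

theory Defs
  imports
    "HOL-Algebra.QuotRing"
    "HOL-Algebra.Ideal_Product"
    "HOL-Library.Poly_Mapping"
begin

(* Rings are HOL-Algebra rings: associative, with one, not necessarily commutative.
   The locale "ideal" is that of two-sided ideals. *)

section \<open>Multiplicative sets, Ore sets and denominator sets\<close>

definition multiplicative_subset :: "('a, 'b) ring_scheme \<Rightarrow> 'a set \<Rightarrow> bool" where
  "multiplicative_subset R S \<longleftrightarrow> submonoid S R \<and> \<zero>\<^bsub>R\<^esub> \<notin> S"

definition normal_element :: "('a, 'b) ring_scheme \<Rightarrow> 'a \<Rightarrow> bool" where
  "normal_element R x \<longleftrightarrow>
     x \<in> carrier R \<and> (carrier R #>\<^bsub>R\<^esub> x) = (x <#\<^bsub>R\<^esub> carrier R)"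

definition generated_by_normal_elements :: "('a, 'b) ring_scheme \<Rightarrow> 'a set \<Rightarrow> bool" where
  "generated_by_normal_elements R S \<longleftrightarrow>
     (\<exists>G. (\<forall>x\<in>G. normal_element R x) \<and> S = \<Inter> {H. submonoid H R \<and> G \<subseteq> H})"

definition left_ore_set :: "('a, 'b) ring_scheme \<Rightarrow> 'a set \<Rightarrow> bool" where
  "left_ore_set R S \<longleftrightarrow> multiplicative_subset R S \<and>
     (\<forall>r\<in>carrier R. \<forall>s\<in>S. (S #>\<^bsub>R\<^esub> r) \<inter> (carrier R #>\<^bsub>R\<^esub> s) \<noteq> {})"

definition right_ore_set :: "('a, 'b) ring_scheme \<Rightarrow> 'a set \<Rightarrow> bool" where
  "right_ore_set R S \<longleftrightarrow> multiplicative_subset R S \<and>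
     (\<forall>r\<in>carrier R. \<forall>s\<in>S. (r <#\<^bsub>R\<^esub> S) \<inter> (s <#\<^bsub>R\<^esub> carrier R) \<noteq> {})"

definition left_denominator_set :: "('a, 'b) ring_scheme \<Rightarrow> 'a set \<Rightarrow> bool" where
  "left_denominator_set R S \<longleftrightarrow> left_ore_set R S \<and>
     (\<forall>r\<in>carrier R. \<forall>s\<in>S. r \<otimes>\<^bsub>R\<^esub> s = \<zero>\<^bsub>R\<^esub> \<longrightarrow> (\<exists>t\<in>S. t \<otimes>\<^bsub>R\<^esub> r = \<zero>\<^bsub>R\<^esub>))"

definition right_denominator_set :: "('a, 'b) ring_scheme \<Rightarrow> 'a set \<Rightarrow> bool" where
  "right_denominator_set R S \<longleftrightarrow> right_ore_set R S \<and>
     (\<forall>r\<in>carrier R. \<forall>s\<in>S. s \<otimes>\<^bsub>R\<^esub> r = \<zero>\<^bsub>R\<^esub> \<longrightarrow> (\<exists>t\<in>S. r \<otimes>\<^bsub>R\<^esub> t = \<zero>\<^bsub>R\<^esub>))"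

definition Den :: "('a, 'b) ring_scheme \<Rightarrow> 'a set \<Rightarrow> 'a set set" where
  "Den R \<bb> = {S. left_denominator_set R S \<and> right_denominator_set R S \<and>
                 {r \<in> carrier R. \<exists>s\<in>S. s \<otimes>\<^bsub>R\<^esub> r = \<zero>\<^bsub>R\<^esub>} = \<bb>}"

definition two_sided_torsion :: "('a, 'b) ring_scheme \<Rightarrow> 'a set \<Rightarrow> 'a set" where
  "two_sided_torsion R S =
     {r \<in> carrier R. \<exists>s\<in>S. \<exists>t\<in>S. s \<otimes>\<^bsub>R\<^esub> r \<otimes>\<^bsub>R\<^esub> t = \<zero>\<^bsub>R\<^esub>}"


section \<open>Prime ideals\<close>

(* The library's "primeideal" is restricted to commutative rings and completely prime ideals,
   so the usual ideal-theoretic notion for noncommutative rings is introduced here. *)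

definition prime_spectrum :: "('a, 'b) ring_scheme \<Rightarrow> 'a set set" where
  "prime_spectrum R = {P. ideal P R \<and> P \<noteq> carrier R \<and>
     (\<forall>I J. ideal I R \<longrightarrow> ideal J R \<longrightarrow> I \<cdot>\<^bsub>R\<^esub> J \<subseteq> P \<longrightarrow> I \<subseteq> P \<or> J \<subseteq> P)}"

definition minimal_primes_over :: "('a, 'b) ring_scheme \<Rightarrow> 'a set \<Rightarrow> 'a set set" where
  "minimal_primes_over R I = {P \<in> prime_spectrum R. I \<subseteq> P \<and>
     (\<forall>Q\<in>prime_spectrum R. I \<subseteq> Q \<longrightarrow> Q \<subseteq> P \<longrightarrow> Q = P)}"

definition minimal_primes :: "('a, 'b) ring_scheme \<Rightarrow> 'a set set" where
  "minimal_primes R =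
     {P \<in> prime_spectrum R. \<forall>Q\<in>prime_spectrum R. Q \<subseteq> P \<longrightarrow> Q = P}"

(* The intersection with the carrier only matters for the zero ring, which has no primes. *)
definition prime_radical :: "('a, 'b) ring_scheme \<Rightarrow> 'a set" where
  "prime_radical R = carrier R \<inter> \<Inter> (prime_spectrum R)"

primrec ideal_power :: "('a, 'b) ring_scheme \<Rightarrow> 'a set \<Rightarrow> nat \<Rightarrow> 'a set" where
  "ideal_power R I 0 = carrier R"
| "ideal_power R I (Suc n) = ideal_power R I n \<cdot>\<^bsub>R\<^esub> I"

definition nilpotent_ideal :: "('a, 'b) ring_scheme \<Rightarrow> 'a set \<Rightarrow> bool" where
  "nilpotent_ideal R I \<longleftrightarrow> ideal I R \<and> (\<exists>n. ideal_power R I n = {\<zero>\<^bsub>R\<^esub>})"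


section \<open>Left rings of fractions\<close>

(* The Ore construction on pairs (s, r), standing for s^{-1} r. The definitions make sense
   (and THE has a unique witness) when S is a left denominator set of R. *)

definition frac_rel :: "('a, 'b) ring_scheme \<Rightarrow> 'a set \<Rightarrow> (('a \<times> 'a) \<times> ('a \<times> 'a)) set" where
  "frac_rel R S = {((s, r), (t, q)). s \<in> S \<and> r \<in> carrier R \<and> t \<in> S \<and> q \<in> carrier R \<and>
     (\<exists>x\<in>carrier R. \<exists>y\<in>carrier R.
        x \<otimes>\<^bsub>R\<^esub> s = y \<otimes>\<^bsub>R\<^esub> t \<and> x \<otimes>\<^bsub>R\<^esub> s \<in> S \<and> x \<otimes>\<^bsub>R\<^esub> r = y \<otimes>\<^bsub>R\<^esub> q)}"

definition frac :: "('a, 'b) ring_scheme \<Rightarrow> 'a set \<Rightarrow> 'a \<Rightarrow> 'a \<Rightarrow> ('a \<times> 'a) set" where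
  "frac R S s r = frac_rel R S `` {(s, r)}"

(* (s^{-1} r) (t^{-1} q) = (u s)^{-1} (x q) where u r = x t with u in S *)
definition frac_mult ::
  "('a, 'b) ring_scheme \<Rightarrow> 'a set \<Rightarrow> ('a \<times> 'a) set \<Rightarrow> ('a \<times> 'a) set \<Rightarrow> ('a \<times> 'a) set" where
  "frac_mult R S A B = (THE C. \<exists>s\<in>S. \<exists>r\<in>carrier R. \<exists>t\<in>S. \<exists>q\<in>carrier R. \<exists>u\<in>S. \<exists>x\<in>carrier R.
     A = frac R S s r \<and> B = frac R S t q \<and> u \<otimes>\<^bsub>R\<^esub> r = x \<otimes>\<^bsub>R\<^esub> t \<and>
     C = frac R S (u \<otimes>\<^bsub>R\<^esub> s) (x \<otimes>\<^bsub>R\<^esub> q))"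

(* s^{-1} r + t^{-1} q = (x s)^{-1} (x r + y q) where x s = y t is in S *)
definition frac_add ::
  "('a, 'b) ring_scheme \<Rightarrow> 'a set \<Rightarrow> ('a \<times> 'a) set \<Rightarrow> ('a \<times> 'a) set \<Rightarrow> ('a \<times> 'a) set" where
  "frac_add R S A B = (THE C. \<exists>s\<in>S. \<exists>r\<in>carrier R. \<exists>t\<in>S. \<exists>q\<in>carrier R.
     \<exists>x\<in>carrier R. \<exists>y\<in>carrier R.
     A = frac R S s r \<and> B = frac R S t q \<and> x \<otimes>\<^bsub>R\<^esub> s = y \<otimes>\<^bsub>R\<^esub> t \<and> x \<otimes>\<^bsub>R\<^esub> s \<in> S \<and>
     C = frac R S (x \<otimes>\<^bsub>R\<^esub> s) (x \<otimes>\<^bsub>R\<^esub> r \<oplus>\<^bsub>R\<^esub> y \<otimes>\<^bsub>R\<^esub> q))"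

definition frac_ring :: "('a, 'b) ring_scheme \<Rightarrow> 'a set \<Rightarrow> ('a \<times> 'a) set ring" where
  "frac_ring R S =
     \<lparr> carrier = {frac R S s r | s r. s \<in> S \<and> r \<in> carrier R},
       mult = frac_mult R S,
       one = frac R S \<one>\<^bsub>R\<^esub> \<one>\<^bsub>R\<^esub>,
       zero = frac R S \<one>\<^bsub>R\<^esub> \<zero>\<^bsub>R\<^esub>,
       add = frac_add R S \<rparr>"

definition frac_hom :: "('a, 'b) ring_scheme \<Rightarrow> 'a set \<Rightarrow> 'a \<Rightarrow> ('a \<times> 'a) set" where
  "frac_hom R S r = frac R S \<one>\<^bsub>R\<^esub> r"

definition frac_ideal :: "('a, 'b) ring_scheme \<Rightarrow> 'a set \<Rightarrow> 'a set \<Rightarrow> ('a \<times> 'a) set set" where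
  "frac_ideal R S I = {frac R S s i | s i. s \<in> S \<and> i \<in> I}"


section \<open>Induced maps\<close>

(* The map h with h (f x) = g x for all x in D; it is defined on the image of D under f
   provided g is constant on the fibres of f. *)
definition induced :: "'x set \<Rightarrow> ('x \<Rightarrow> 'y) \<Rightarrow> ('x \<Rightarrow> 'z) \<Rightarrow> 'y \<Rightarrow> 'z" where
  "induced D f g y = (THE z. \<exists>x\<in>D. f x = y \<and> g x = z)"

(* s^{-1} r is sent to (f s)^{-1} (f r) *)
definition frac_map ::
  "('a, 'b) ring_scheme \<Rightarrow> 'a set \<Rightarrow> ('c, 'd) ring_scheme \<Rightarrow> 'c set \<Rightarrow> ('a \<Rightarrow> 'c)
     \<Rightarrow> ('a \<times> 'a) set \<Rightarrow> ('c \<times> 'c) set" where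
  "frac_map R S R' S' f =
     induced (S \<times> carrier R) (\<lambda>(s, r). frac R S s r) (\<lambda>(s, r). frac R' S' (f s) (f r))"


section \<open>The localization of a ring at a subset\<close>

datatype 'x free_word = Word (letters: "'x list")

instantiation free_word :: (type) monoid_add
begin

definition zero_free_word :: "'a free_word" where
  "0 = Word []"

definition plus_free_word :: "'a free_word \<Rightarrow> 'a free_word \<Rightarrow> 'a free_word" where
  "u + v = Word (letters u @ letters v)"

instance
  by standard (simp_all add: zero_free_word_def plus_free_word_def)

end

(* The free ring on X: integral combinations of words in X. Since addition of words is
   concatenation, multiplication in the type of finitely supported functions is the
   noncommutative convolution product. *)
definition free_ring :: "'x set \<Rightarrow> ('x free_word \<Rightarrow>\<^sub>0 int) ring" where
  "free_ring X =
     \<lparr> carrier = {f. \<forall>w\<in>Poly_Mapping.keys f. set (letters w) \<subseteq> X},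
       mult = (*), one = 1, zero = 0, add = (+) \<rparr>"

definition free_gen :: "'x \<Rightarrow> 'x free_word \<Rightarrow>\<^sub>0 int" where
  "free_gen x = Poly_Mapping.single (Word [x]) 1"

(* R<X>, the ring freely generated by the ring R and noncommuting (also with elements of R)
   indeterminates x_s, s in X: letters Inl r represent the elements of R and are subject to
   the relations of R, letters Inr s represent the indeterminates x_s. *)

definition letter_ring :: "('a, 'b) ring_scheme \<Rightarrow> 'a set \<Rightarrow> (('a + 'a) free_word \<Rightarrow>\<^sub>0 int) ring" where
  "letter_ring R X = free_ring (Inl ` carrier R \<union> Inr ` X)"

definition ring_relations :: "('a, 'b) ring_scheme \<Rightarrow> (('a + 'a) free_word \<Rightarrow>\<^sub>0 int) set" where
  "ring_relations R =
     {free_gen (Inl (r \<oplus>\<^bsub>R\<^esub> r')) - (free_gen (Inl r) + free_gen (Inl r')) | r r'.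
        r \<in> carrier R \<and> r' \<in> carrier R} \<union>
     {free_gen (Inl (r \<otimes>\<^bsub>R\<^esub> r')) - free_gen (Inl r) * free_gen (Inl r') | r r'.
        r \<in> carrier R \<and> r' \<in> carrier R} \<union>
     {free_gen (Inl \<one>\<^bsub>R\<^esub>) - 1}"

definition relation_ideal :: "('a, 'b) ring_scheme \<Rightarrow> 'a set \<Rightarrow> (('a + 'a) free_word \<Rightarrow>\<^sub>0 int) set" where
  "relation_ideal R X = Idl\<^bsub>letter_ring R X\<^esub> (ring_relations R)"

definition free_extension ::
  "('a, 'b) ring_scheme \<Rightarrow> 'a set \<Rightarrow> (('a + 'a) free_word \<Rightarrow>\<^sub>0 int) set ring" where
  "free_extension R X = letter_ring R X Quot relation_ideal R X"

definition free_coeff ::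
  "('a, 'b) ring_scheme \<Rightarrow> 'a set \<Rightarrow> 'a \<Rightarrow> (('a + 'a) free_word \<Rightarrow>\<^sub>0 int) set" where
  "free_coeff R X r = relation_ideal R X +>\<^bsub>letter_ring R X\<^esub> free_gen (Inl r)"

definition free_indet ::
  "('a, 'b) ring_scheme \<Rightarrow> 'a set \<Rightarrow> 'a \<Rightarrow> (('a + 'a) free_word \<Rightarrow>\<^sub>0 int) set" where
  "free_indet R X s = relation_ideal R X +>\<^bsub>letter_ring R X\<^esub> free_gen (Inr s)"

definition inverting_ideal ::
  "('a, 'b) ring_scheme \<Rightarrow> 'a set \<Rightarrow> (('a + 'a) free_word \<Rightarrow>\<^sub>0 int) set set" where
  "inverting_ideal R S = (let F = free_extension R S in
     Idl\<^bsub>F\<^esub> (\<Union>s\<in>S. {free_coeff R S s \<otimes>\<^bsub>F\<^esub> free_indet R S s \<ominus>\<^bsub>F\<^esub> \<one>\<^bsub>F\<^esub>,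
                  free_indet R S s \<otimes>\<^bsub>F\<^esub> free_coeff R S s \<ominus>\<^bsub>F\<^esub> \<one>\<^bsub>F\<^esub>}))"

definition localization ::
  "('a, 'b) ring_scheme \<Rightarrow> 'a set \<Rightarrow> (('a + 'a) free_word \<Rightarrow>\<^sub>0 int) set set ring" where
  "localization R S = free_extension R S Quot inverting_ideal R S"

definition localization_hom ::
  "('a, 'b) ring_scheme \<Rightarrow> 'a set \<Rightarrow> 'a \<Rightarrow> (('a + 'a) free_word \<Rightarrow>\<^sub>0 int) set set" where
  "localization_hom R S r = inverting_ideal R S +>\<^bsub>free_extension R S\<^esub> free_coeff R S r"

definition localization_inverse ::
  "('a, 'b) ring_scheme \<Rightarrow> 'a set \<Rightarrow> 'a \<Rightarrow> (('a + 'a) free_word \<Rightarrow>\<^sub>0 int) set set" where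
  "localization_inverse R S s = inverting_ideal R S +>\<^bsub>free_extension R S\<^esub> free_indet R S s"

(* The identification of the ring of fractions of R' = f(R) at f(S) with the localization
   of R at S: (f s)^{-1} (f r) is sent to (the class of) x_s r. *)
definition fractions_to_localization ::
  "('a, 'b) ring_scheme \<Rightarrow> 'a set \<Rightarrow> ('c, 'd) ring_scheme \<Rightarrow> ('a \<Rightarrow> 'c)
     \<Rightarrow> ('c \<times> 'c) set \<Rightarrow> (('a + 'a) free_word \<Rightarrow>\<^sub>0 int) set set" where
  "fractions_to_localization R S R' f =
     induced (S \<times> carrier R) (\<lambda>(s, r). frac R' (f ` S) (f s) (f r))
       (\<lambda>(s, r). localization_inverse R S s \<otimes>\<^bsub>localization R S\<^esub> localization_hom R S r)"

end

theory Submission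
  imports
    "HOL-Algebra.Multiplicative_Group"
    "HOL-Algebra.Free_Abelian_Groups"
    Defs
begin

text \<open>
  Modulo \<open>\<aa>\<close> the elements of \<open>S\<close> become regular and remain normal, so each \<open>s\<close> induces an automorphism
  \<open>r \<mapsto> s r s\<^sup>-\<^sup>1\<close> of the ring, which permutes its finitely many minimal primes. A power of \<open>s\<close> fixes a given
  minimal prime \<open>p\<close>, and then \<open>p\<close> cannot contain it: the elements \<open>s\<^sup>i c\<close> with \<open>c \<notin> p\<close> form an m-system
  avoiding \<open>0\<close>. Hence \<open>S\<close> misses every minimal prime, is regular modulo each of them and modulo the prime
  radical, and minimal primes extend to pairwise incomparable primes of the ring of fractions. If the prime
  radical is nilpotent, every prime of the ring of fractions contains the intersection of these finitely
  many primes, so they are all the minimal ones; the semiprime quotient is a special case. The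
  identification with the universal localization rests on every element of the latter being of the form
  \<open>x\<^sub>s r\<close>.
\<close>

section \<open>Ideals and prime ideals\<close>

text \<open>Two things can go wrong when an ideal is localized at one-sided fractions: the result
  may fail to be two-sided, and a prime may blow up to the whole ring. Saturation excludes both: if
  \<open>s \<otimes> r\<close> or \<open>r \<otimes> s\<close> in \<open>I\<close> forces
  \<open>r\<close> in \<open>I\<close>, then conjugation maps \<open>I\<close> into itself, and a
  fraction lies in \<open>frac_ideal R S I\<close> exactly when its numerator lies in
  \<open>I\<close>. Every prime missing \<open>S\<close> is saturated, so disjointness from
  \<open>S\<close> is the only thing to be proved about minimal primes. Finiteness enters twice: to
  make the conjugates of a prime recur, and to pass from an intersection contained in a prime to one
  of its members. Nilpotency is useful because it survives localization: the powers of a localized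
  ideal lie in the localizations of its powers. Maps out of quotients and rings of fractions are
  definite descriptions (\<open>induced\<close>); each is known by its values on representatives,
  and the diagram is checked on those.\<close>

lemma (in ring) ideal_intro:
  assumes "I \<subseteq> carrier R" and "\<zero> \<in> I"
    and "\<And>a b. a \<in> I \<Longrightarrow> b \<in> I \<Longrightarrow> a \<oplus> b \<in> I"
    and l: "\<And>a r. a \<in> I \<Longrightarrow> r \<in> carrier R \<Longrightarrow> r \<otimes> a \<in> I"
    and r: "\<And>a r. a \<in> I \<Longrightarrow> r \<in> carrier R \<Longrightarrow> a \<otimes> r \<in> I"
  shows "ideal I R"
proof (rule idealI[OF ring_axioms])
  show "subgroup I (add_monoid R)"
  proof (rule add.subgroupI)
    fix a assume a: "a \<in> I"
    then have "(\<ominus> \<one>) \<otimes> a \<in> I" using l by simp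
    moreover have "(\<ominus> \<one>) \<otimes> a = \<ominus> a" using a assms(1) l_minus by auto
    ultimately show "\<ominus> a \<in> I" by simp
  qed (use assms in auto)
qed (use l r in auto)

lemma (in ideal) zero_mem [simp]: "\<zero> \<in> I"
  by simp

lemma (in ideal) coset_eq_iff:
  assumes "x \<in> carrier R" "y \<in> carrier R"
  shows "I +> x = I +> y \<longleftrightarrow> x \<ominus> y \<in> I"
  using quotient_eq_iff_same_a_r_cos[OF is_ideal assms] by simp

lemma (in ideal) coset_eq_zero_iff:
  assumes "x \<in> carrier R"
  shows "I +> x = \<zero>\<^bsub>R Quot I\<^esub> \<longleftrightarrow> x \<in> I"
  unfolding FactRing_def using assms a_rcos_const a_rcos_self by auto

text \<open>The factor \<open>r\<close> between \<open>x\<close> and \<open>b\<close> makes the set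
  two-sided; without it only a left ideal would result. It contains \<open>a\<close> exactly when
  \<open>a R b\<close> lies in \<open>P\<close>.\<close>

lemma (in ring) ideal_left_colon:
  assumes "ideal P R" "b \<in> carrier R"
  shows "ideal {x \<in> carrier R. \<forall>r\<in>carrier R. x \<otimes> r \<otimes> b \<in> P} R"
proof -
  interpret P: ideal P R by fact
  have "x \<otimes> s \<otimes> r \<otimes> b \<in> P"
    if "\<forall>r\<in>carrier R. x \<otimes> r \<otimes> b \<in> P" "x \<in> carrier R" "s \<in> carrier R" "r \<in> carrier R" for x s r
    using that by (metis m_assoc m_closed)
  moreover have "s \<otimes> x \<otimes> r \<otimes> b \<in> P"
    if "\<forall>r\<in>carrier R. x \<otimes> r \<otimes> b \<in> P" "x \<in> carrier R" "s \<in> carrier R" "r \<in> carrier R" for x s r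
    using that assms(2) by (metis P.I_l_closed m_assoc m_closed)
  ultimately show ?thesis
    by (intro ideal_intro) (use assms in \<open>auto simp: l_distr\<close>)
qed

text \<open>Companion of the left colon ideal: with \<open>I\<close> taken to be the left colon of
  \<open>b\<close>, this ideal contains \<open>b\<close>, and the product of the two falls into
  \<open>P\<close>. The pair replaces the ideals generated by \<open>a\<close> and
  \<open>b\<close>.\<close>

lemma (in ring) ideal_right_colon:
  assumes "ideal P R" "I \<subseteq> carrier R"
  shows "ideal {y \<in> carrier R. \<forall>x\<in>I. \<forall>r\<in>carrier R. x \<otimes> r \<otimes> y \<in> P} R"
proof -
  interpret P: ideal P R by fact
  have l: "x \<otimes> r \<otimes> (s \<otimes> y) \<in> P"
    if h: "\<forall>x\<in>I. \<forall>r\<in>carrier R. x \<otimes> r \<otimes> y \<in> P" "x \<in> I" "r \<in> carrier R" "s \<in> carrier R" "y \<in> carrier R"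
    for x r s y
  proof -
    have "x \<otimes> (r \<otimes> s) \<otimes> y \<in> P" using h by simp
    moreover have "x \<in> carrier R" using h(2) assms(2) by auto
    ultimately show ?thesis using h by (simp add: m_assoc)
  qed
  have r: "x \<otimes> r \<otimes> (y \<otimes> s) \<in> P"
    if h: "\<forall>x\<in>I. \<forall>r\<in>carrier R. x \<otimes> r \<otimes> y \<in> P" "x \<in> I" "r \<in> carrier R" "s \<in> carrier R" "y \<in> carrier R"
    for x r s y
  proof -
    have "x \<otimes> r \<otimes> y \<otimes> s \<in> P" using P.I_r_closed[OF _ h(4)] h(1-3) by blast
    moreover have "x \<in> carrier R" using h(2) assms(2) by auto
    ultimately show ?thesis using h by (simp add: m_assoc)
  qed
  have add: "x \<otimes> r \<otimes> (y \<oplus> z) \<in> P"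
    if h: "x \<otimes> r \<otimes> y \<in> P" "x \<otimes> r \<otimes> z \<in> P" "x \<in> I" "r \<in> carrier R" "y \<in> carrier R" "z \<in> carrier R"
    for x r y z
  proof -
    have "x \<in> carrier R" using h(3) assms(2) by auto
    then have "x \<otimes> r \<otimes> (y \<oplus> z) = x \<otimes> r \<otimes> y \<oplus> x \<otimes> r \<otimes> z" using h by (simp add: r_distr)
    then show ?thesis using h(1,2) by simp
  qed
  have zero: "x \<otimes> r \<otimes> \<zero> \<in> P" if "x \<in> I" "r \<in> carrier R" for x r
  proof -
    have "x \<in> carrier R" using that(1) assms(2) by auto
    then show ?thesis using that by simp
  qed
  show ?thesis
    by (rule ideal_intro) (use l r add zero in auto)
qed

lemma prime_spectrumD:
  assumes "P \<in> prime_spectrum R"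
  shows "ideal P R" "P \<noteq> carrier R"
  using assms by (auto simp: prime_spectrum_def)

text \<open>The elementwise form is the one that transfers along homomorphisms and to fractions.
  Forwards, the colon ideals through \<open>a\<close> and \<open>b\<close> have their product in
  \<open>P\<close>; backwards, elements of \<open>I\<close> and \<open>J\<close> outside
  \<open>P\<close> would violate the test.\<close>

lemma (in ring) prime_spectrum_iff:
  "P \<in> prime_spectrum R \<longleftrightarrow> ideal P R \<and> P \<noteq> carrier R \<and>
     (\<forall>a\<in>carrier R. \<forall>b\<in>carrier R. (\<forall>r\<in>carrier R. a \<otimes> r \<otimes> b \<in> P) \<longrightarrow> a \<in> P \<or> b \<in> P)"
    (is "_ \<longleftrightarrow> ?elem")
proof
  assume P: "P \<in> prime_spectrum R"
  then interpret P: ideal P R by (simp add: prime_spectrum_def)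
  have "a \<in> P \<or> b \<in> P"
    if a: "a \<in> carrier R" and b: "b \<in> carrier R" and ab: "\<forall>r\<in>carrier R. a \<otimes> r \<otimes> b \<in> P" for a b
  proof -
    define I where "I = {x \<in> carrier R. \<forall>r\<in>carrier R. x \<otimes> r \<otimes> b \<in> P}"
    define J where "J = {y \<in> carrier R. \<forall>x\<in>I. \<forall>r\<in>carrier R. x \<otimes> r \<otimes> y \<in> P}"
    have I: "ideal I R" unfolding I_def by (rule ideal_left_colon[OF P.is_ideal b])
    have J: "ideal J R"
      unfolding J_def by (rule ideal_right_colon[OF P.is_ideal]) (auto simp: I_def)
    have "x \<in> P" if "x \<in> I \<cdot> J" for x
      using that
    proof (induct rule: ideal_prod.induct)
      case (prod i j)
      \<comment> \<open>The middle factor \<open>\<one>\<close> turns the condition on all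
        \<open>i \<otimes> r \<otimes> j\<close> into one on the product itself.\<close>
      then have "i \<otimes> \<one> \<otimes> j \<in> P" by (auto simp: J_def)
      moreover have "i \<in> carrier R" using prod by (simp add: I_def)
      ultimately show ?case by simp
    qed auto
    then have "I \<subseteq> P \<or> J \<subseteq> P" using P I J by (auto simp: prime_spectrum_def)
    moreover have "a \<in> I" "b \<in> J" using a b ab by (auto simp: I_def J_def)
    ultimately show ?thesis by auto
  qed
  then show ?elem using P by (auto simp: prime_spectrum_def)
next
  assume R: ?elem
  then interpret P: ideal P R by simp
  have "I \<subseteq> P \<or> J \<subseteq> P" if I: "ideal I R" and J: "ideal J R" and IJ: "I \<cdot> J \<subseteq> P" for I J
  proof (rule ccontr)
    assume "\<not> ?thesis"
    then obtain a b where a: "a \<in> I" "a \<notin> P" and b: "b \<in> J" "b \<notin> P" by auto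
    have "a \<otimes> r \<otimes> b \<in> P" if "r \<in> carrier R" for r
      using IJ ideal_prod.prod[of "a \<otimes> r" I b J R] ideal.I_r_closed[OF I a(1) that] b by auto
    then show False using R a b ideal.Icarr[OF I] ideal.Icarr[OF J] by blast
  qed
  then show "P \<in> prime_spectrum R" using R by (auto simp: prime_spectrum_def)
qed

lemma (in ring) prime_spectrumE:
  assumes "P \<in> prime_spectrum R" "a \<in> carrier R" "b \<in> carrier R"
    and "\<And>r. r \<in> carrier R \<Longrightarrow> a \<otimes> r \<otimes> b \<in> P"
  shows "a \<in> P \<or> b \<in> P"
  using assms prime_spectrum_iff by blast

section \<open>Zorn arguments: primes avoiding an m-system, and minimal primes\<close>

lemma (in ring) ideal_Union_chain:
  assumes "C \<noteq> {}" "subset.chain {I. ideal I R} C"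
  shows "ideal (\<Union>C) R"
proof -
  have id: "\<And>I. I \<in> C \<Longrightarrow> ideal I R" using assms by (auto simp: subset_chain_def)
  have add: "a \<oplus> b \<in> I" if "I \<in> C" "a \<in> I" "b \<in> I" for I a b
  proof -
    interpret ideal I R by (rule id[OF that(1)])
    show ?thesis using that by simp
  qed
  show ?thesis
  proof (rule ideal_intro)
    show "\<Union>C \<subseteq> carrier R" using id ideal.Icarr by (metis Union_least subsetI)
    show "\<zero> \<in> \<Union>C" using assms(1) id ideal.zero_mem by (metis UnionI ex_in_conv)
  next
    fix a b assume "a \<in> \<Union>C" "b \<in> \<Union>C"
    then obtain I J where IJ: "I \<in> C" "J \<in> C" "a \<in> I" "b \<in> J" by auto
    then have "I \<subseteq> J \<or> J \<subseteq> I" using assms(2) by (auto simp: subset_chain_def)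
    then show "a \<oplus> b \<in> \<Union>C" using IJ add by (metis UnionI subsetD)
  next
    fix a r assume "a \<in> \<Union>C" and r: "r \<in> carrier R"
    then obtain I where I: "I \<in> C" "a \<in> I" by auto
    interpret ideal I R by (rule id[OF I(1)])
    show "r \<otimes> a \<in> \<Union>C" "a \<otimes> r \<in> \<Union>C" using I I_l_closed[OF I(2) r] I_r_closed[OF I(2) r] by blast+
  qed
qed

text \<open>An ideal \<open>P\<close> maximal among those containing \<open>I\<close> and missing
  \<open>M\<close> is prime: if \<open>a R b\<close> lay inside \<open>P\<close> with both elements
  outside, the two colon ideals would properly contain \<open>P\<close> and so meet \<open>M\<close>
  in some \<open>m\<close> and \<open>m'\<close>; then a suitable
  \<open>m \<otimes> r \<otimes> m'\<close> lies in \<open>M\<close> and in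
  \<open>P\<close>.\<close>

lemma (in ring) exists_prime_avoiding:
  assumes M: "M \<subseteq> carrier R" "M \<noteq> {}"
    and msys: "\<And>a b. a \<in> M \<Longrightarrow> b \<in> M \<Longrightarrow> \<exists>r\<in>carrier R. a \<otimes> r \<otimes> b \<in> M"
    and I: "ideal I R" "I \<inter> M = {}"
  obtains P where "P \<in> prime_spectrum R" "I \<subseteq> P" "P \<inter> M = {}"
proof -
  define A where "A = {J. ideal J R \<and> I \<subseteq> J \<and> J \<inter> M = {}}"
  have "\<exists>P\<in>A. \<forall>X\<in>A. P \<subseteq> X \<longrightarrow> X = P"
  proof (rule subset_Zorn_nonempty)
    show "A \<noteq> {}" using I by (auto simp: A_def)
    fix C assume C: "C \<noteq> {}" "subset.chain A C"
    then have "ideal (\<Union>C) R"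
      by (intro ideal_Union_chain) (auto simp: subset_chain_def A_def)
    moreover have "I \<subseteq> \<Union>C" "\<Union>C \<inter> M = {}" using C unfolding subset_chain_def A_def by blast+
    ultimately show "\<Union>C \<in> A" by (auto simp: A_def)
  qed
  then obtain P where "P \<in> A" and max: "\<And>X. X \<in> A \<Longrightarrow> P \<subseteq> X \<Longrightarrow> X = P" by blast
  then have P: "ideal P R" "I \<subseteq> P" "P \<inter> M = {}" by (auto simp: A_def)
  interpret P: ideal P R by fact
  have meets: "J \<inter> M \<noteq> {}" if "ideal J R" "P \<subseteq> J" "c \<in> J" "c \<notin> P" for J c
    using max[of J] that P by (auto simp: A_def)
  have "a \<in> P \<or> b \<in> P"
    if a: "a \<in> carrier R" and b: "b \<in> carrier R" and ab: "\<forall>r\<in>carrier R. a \<otimes> r \<otimes> b \<in> P" for a b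
  proof (rule ccontr)
    assume n: "\<not> ?thesis"
    define I' where "I' = {x \<in> carrier R. \<forall>r\<in>carrier R. x \<otimes> r \<otimes> b \<in> P}"
    define J where "J = {y \<in> carrier R. \<forall>x\<in>I'. \<forall>r\<in>carrier R. x \<otimes> r \<otimes> y \<in> P}"
    have I': "ideal I' R" unfolding I'_def by (rule ideal_left_colon[OF P.is_ideal b])
    have J: "ideal J R"
      unfolding J_def by (rule ideal_right_colon[OF P.is_ideal]) (auto simp: I'_def)
    have "P \<subseteq> I'" using b by (auto simp: I'_def P.I_r_closed)
    moreover have "a \<in> I'" using a ab by (simp add: I'_def)
    ultimately obtain m where m: "m \<in> I'" "m \<in> M" using meets[OF I'] n by blast
    have "P \<subseteq> J" by (auto simp: J_def I'_def P.I_l_closed)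
    moreover have "b \<in> J" using b by (simp add: J_def I'_def)
    ultimately obtain m' where m': "m' \<in> J" "m' \<in> M" using meets[OF J] n by blast
    obtain r where "r \<in> carrier R" "m \<otimes> r \<otimes> m' \<in> M" using msys m m' by blast
    then show False using m m' P(3) by (auto simp: J_def)
  qed
  moreover have "P \<noteq> carrier R" using P M by auto
  ultimately have "P \<in> prime_spectrum R" using P(1) by (auto simp: prime_spectrum_iff)
  then show thesis using that P by blast
qed

text \<open>If one member omits \<open>a\<close> and another omits \<open>b\<close>, the smaller of
  the two omits both, and its primeness applies.\<close>

lemma (in ring) prime_Inter_chain:
  assumes "C \<noteq> {}" "C \<subseteq> prime_spectrum R"
    and chain: "\<And>P Q. P \<in> C \<Longrightarrow> Q \<in> C \<Longrightarrow> P \<subseteq> Q \<or> Q \<subseteq> P"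
  shows "\<Inter>C \<in> prime_spectrum R"
proof -
  have id: "ideal (\<Inter>C) R"
  proof (rule i_Intersect)
    show "ideal P R" if "P \<in> C" for P using that assms(2) prime_spectrumD(1) by auto
  qed (rule assms(1))
  have "\<Inter>C \<noteq> carrier R"
  proof
    assume eq: "\<Inter>C = carrier R"
    obtain P where "P \<in> C" using assms(1) by blast
    then have "carrier R \<subseteq> P" "P \<in> prime_spectrum R" using eq assms(2) by auto
    then show False using prime_spectrumD[of P R] ideal.Icarr[of P R] by (meson subsetI subset_antisym)
  qed
  moreover have "a \<in> \<Inter>C \<or> b \<in> \<Inter>C"
    if "a \<in> carrier R" "b \<in> carrier R" "\<forall>r\<in>carrier R. a \<otimes> r \<otimes> b \<in> \<Inter>C" for a b
  proof (rule ccontr)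
    assume "\<not> ?thesis"
    then obtain P Q where PQ: "P \<in> C" "Q \<in> C" "a \<notin> P" "b \<notin> Q" unfolding Inter_iff by blast
    have "P \<subseteq> Q \<or> Q \<subseteq> P" by (rule chain[OF PQ(1,2)])
    then obtain N where "N \<in> C" "a \<notin> N" "b \<notin> N" using PQ by (metis subsetD)
    moreover have "a \<in> N \<or> b \<in> N"
      by (rule prime_spectrumE[OF _ that(1,2)]) (use that(3) assms(2) \<open>N \<in> C\<close> in auto)
    ultimately show False by blast
  qed
  ultimately show ?thesis unfolding prime_spectrum_iff using id by blast
qed

lemma (in ring) exists_minimal_prime_below:
  assumes P: "P \<in> prime_spectrum R" "I \<subseteq> P"
  obtains Q where "Q \<in> minimal_primes_over R I" "Q \<subseteq> P"
proof -
  define A where "A = {Q \<in> prime_spectrum R. I \<subseteq> Q \<and> Q \<subseteq> P}"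
  \<comment> \<open>Zorn's lemma yields maximal sets, so it is applied to the complements of the
    primes between \<open>I\<close> and \<open>P\<close>; the union of a chain of complements is the
    complement of an intersection of primes.\<close>
  have "\<exists>M\<in>(\<lambda>Q. - Q) ` A. \<forall>X\<in>(\<lambda>Q. - Q) ` A. M \<subseteq> X \<longrightarrow> X = M"
  proof (rule subset_Zorn_nonempty)
    show "(\<lambda>Q. - Q) ` A \<noteq> {}" using P by (auto simp: A_def)
    fix C assume C: "C \<noteq> {}" "subset.chain ((\<lambda>Q. - Q) ` A) C"
    define D where "D = uminus ` C"
    have "C \<subseteq> uminus ` A" using C(2) by (simp add: subset_chain_def)
    then have "D \<subseteq> uminus ` uminus ` A" unfolding D_def by (rule image_mono)
    then have D: "D \<noteq> {}" "D \<subseteq> A" using C(1) by (auto simp: D_def image_image)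
    have "X \<subseteq> Y \<or> Y \<subseteq> X" if "X \<in> C" "Y \<in> C" for X Y
      using C(2) that by (simp add: subset_chain_def)
    then have chain: "P \<subseteq> Q \<or> Q \<subseteq> P" if "P \<in> D" "Q \<in> D" for P Q
      using that by (force simp: D_def)
    have "D \<subseteq> prime_spectrum R" using D(2) by (auto simp: A_def)
    then have "\<Inter>D \<in> prime_spectrum R" using prime_Inter_chain D(1) chain by blast
    moreover have "I \<subseteq> \<Inter>D" "\<Inter>D \<subseteq> P" using D unfolding A_def by blast+
    ultimately have "\<Inter>D \<in> A" by (simp add: A_def)
    moreover have "\<Union>C = - \<Inter>D" by (auto simp: D_def)
    ultimately show "\<Union>C \<in> (\<lambda>Q. - Q) ` A" by simp
  qed
  then obtain Q where Q: "Q \<in> A" and min: "\<And>X. X \<in> A \<Longrightarrow> X \<subseteq> Q \<Longrightarrow> X = Q" by auto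
  have "Q \<in> minimal_primes_over R I"
    using Q min unfolding minimal_primes_over_def A_def
    by (simp, metis subset_trans)
  then show thesis using that Q by (auto simp: A_def)
qed

lemma (in ring) minimal_primes_eq_over_zero:
  "minimal_primes R = minimal_primes_over R {\<zero>}"
proof -
  have "\<zero> \<in> P" if "P \<in> prime_spectrum R" for P
    using that ideal.zero_mem prime_spectrumD by blast
  then show ?thesis by (auto simp: minimal_primes_def minimal_primes_over_def)
qed

lemma minimal_primes_prime: "p \<in> minimal_primes R \<Longrightarrow> p \<in> prime_spectrum R"
  by (simp add: minimal_primes_def)

lemma minimal_primes_over_prime: "p \<in> minimal_primes_over R I \<Longrightarrow> p \<in> prime_spectrum R"
  by (simp add: minimal_primes_over_def)

section \<open>The prime radical, powers of ideals and finite intersections\<close>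

lemma (in ring) ideal_carrier_Int_Inter:
  assumes "\<And>I. I \<in> A \<Longrightarrow> ideal I R"
  shows "ideal (carrier R \<inter> \<Inter>A) R"
proof -
  have "ideal (\<Inter>(insert (carrier R) A)) R"
    using assms oneideal by (intro i_Intersect) auto
  then show ?thesis by simp
qed

lemma (in ring) prime_radical_ideal: "ideal (prime_radical R) R"
  unfolding prime_radical_def
  by (rule ideal_carrier_Int_Inter) (auto dest: prime_spectrumD)

text \<open>Every prime contains a minimal one, so the remaining primes do not shrink the
  intersection.\<close>

lemma (in ring) prime_radical_minimal_primes:
  "prime_radical R = carrier R \<inter> \<Inter>(minimal_primes R)"
proof -
  have "x \<in> P" if x: "x \<in> \<Inter>(minimal_primes R)" and P: "P \<in> prime_spectrum R" for x P
  proof -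
    have "{\<zero>} \<subseteq> P" using P ideal.zero_mem prime_spectrumD by blast
    then obtain Q where "Q \<in> minimal_primes R" "Q \<subseteq> P"
      using exists_minimal_prime_below[OF P] minimal_primes_eq_over_zero by metis
    then show ?thesis using x by auto
  qed
  then show ?thesis by (auto simp: prime_radical_def dest: minimal_primes_prime)
qed

lemma (in ring) ideal_power_ideal: "ideal I R \<Longrightarrow> ideal (ideal_power R I n) R"
  by (induction n) (auto simp: oneideal ideal_prod_is_ideal)

lemma (in ring) ideal_power_subset_prime:
  assumes "P \<in> prime_spectrum R" "ideal I R" "ideal_power R I n \<subseteq> P"
  shows "I \<subseteq> P"
  using assms(3)
proof (induction n)
  \<comment> \<open>The zeroth power is the whole ring, which no prime contains, so the base case is
    vacuous.\<close>
  case 0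
  then show ?case using prime_spectrumD[OF assms(1)] ideal.Icarr by fastforce
next
  case (Suc n)
  then show ?case using assms ideal_power_ideal[OF assms(2), of n]
    by (metis (no_types, lifting) ideal_power.simps(2) prime_spectrum_def mem_Collect_eq)
qed

text \<open>A product of two ideals lies in their intersection, so primeness splits off one member
  at a time. Intersecting with the carrier gives the empty family its proper meaning: the whole
  ring, which no prime contains.\<close>

lemma (in ring) finite_Inter_subset_prime:
  assumes "P \<in> prime_spectrum R" "finite A" "\<And>I. I \<in> A \<Longrightarrow> ideal I R"
    and "carrier R \<inter> \<Inter>A \<subseteq> P"
  shows "\<exists>I\<in>A. I \<subseteq> P"
  using assms(2-4)
proof (induction A rule: finite_induct)
  case empty
  then show ?case using prime_spectrumD[OF assms(1)] ideal.Icarr by fastforce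
next
  case (insert I A)
  have J: "ideal (carrier R \<inter> \<Inter>A) R" using insert by (intro ideal_carrier_Int_Inter) auto
  have I: "ideal I R" using insert.prems(1) by simp
  have "I \<inter> (carrier R \<inter> \<Inter>A) \<subseteq> P" using insert.prems(2) by auto
  then have "I \<cdot> (carrier R \<inter> \<Inter>A) \<subseteq> P" using ideal_prod_inter[OF I J] by (rule order_trans[rotated])
  then have "I \<subseteq> P \<or> carrier R \<inter> \<Inter>A \<subseteq> P"
    using assms(1) I J unfolding prime_spectrum_def by blast
  then show ?case using insert.IH insert.prems(1) by auto
qed

text \<open>Criterion by which the minimal primes of a ring of fractions will be listed: each prime
  contains the intersection of the finite set \<open>A\<close>, hence a member of \<open>A\<close>,
  and incomparability keeps the members minimal.\<close>

lemma (in ring) minimal_primes_eqI: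
  assumes "finite A" "A \<subseteq> prime_spectrum R"
    and incomparable: "\<And>P Q. P \<in> A \<Longrightarrow> Q \<in> A \<Longrightarrow> P \<subseteq> Q \<Longrightarrow> P = Q"
    and "\<And>P. P \<in> prime_spectrum R \<Longrightarrow> carrier R \<inter> \<Inter>A \<subseteq> P"
  shows "minimal_primes R = A"
proof -
  have below: "\<exists>Q\<in>A. Q \<subseteq> P" if P: "P \<in> prime_spectrum R" for P
    using finite_Inter_subset_prime[OF P assms(1) _ assms(4)[OF P]] assms(2)
    by (auto dest: prime_spectrumD)
  show ?thesis
  proof (intro subset_antisym subsetI)
    fix P assume "P \<in> minimal_primes R"
    then show "P \<in> A" using below[of P] assms(2) by (auto simp: minimal_primes_def)
  next
    fix P assume P: "P \<in> A"
    have "Q = P" if "Q \<in> prime_spectrum R" "Q \<subseteq> P" for Q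
      using below[OF that(1)] incomparable that P by blast
    then show "P \<in> minimal_primes R" using P assms(2) by (auto simp: minimal_primes_def)
  qed
qed

lemma (in ring) minimal_primes_incomparable:
  assumes "P \<in> minimal_primes R" "Q \<in> minimal_primes R" "P \<subseteq> Q"
  shows "P = Q"
  using assms by (auto simp: minimal_primes_def)

section \<open>Surjective ring homomorphisms\<close>

locale ring_epi = ring_hom_ring +
  assumes surj: "h ` carrier R = carrier S"

lemma (in ideal) ring_epi_coset: "ring_epi R (R Quot I) ((+>) I)"
proof -
  interpret q: ring_hom_ring R "R Quot I" "(+>) I" by (rule rcos_ring_hom_ring)
  have "(+>) I ` carrier R = carrier (R Quot I)"
    unfolding FactRing_def A_RCOSETS_def' by auto
  then show ?thesis by unfold_locales
qed

lemma (in ring) minus_add_cancel: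
  assumes "x \<in> carrier R" "y \<in> carrier R"
  shows "x \<ominus> y \<oplus> y = x"
  using assms by (simp add: minus_eq a_assoc l_neg)

lemma (in ring_hom_ring) hom_minus_eq_iff:
  assumes "x \<in> carrier R" "y \<in> carrier R"
  shows "h x = h y \<longleftrightarrow> h (x \<ominus>\<^bsub>R\<^esub> y) = \<zero>\<^bsub>S\<^esub>"
proof -
  have "h (x \<ominus>\<^bsub>R\<^esub> y) = h x \<ominus>\<^bsub>S\<^esub> h y" using assms by (simp add: R.minus_eq S.minus_eq)
  then show ?thesis using assms by simp
qed

lemma (in ring_hom_ring) preimage_ideal:
  assumes "ideal J S"
  shows "ideal {x \<in> carrier R. h x \<in> J} R"
proof -
  interpret J: ideal J S by fact
  show ?thesis by (rule R.ideal_intro) (auto simp: J.I_l_closed J.I_r_closed)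
qed

lemma ring_hom_ring_compose:
  assumes "ring_hom_ring A B f" "ring_hom_ring B C g"
  shows "ring_hom_ring A C (g \<circ> f)"
  using assms unfolding ring_hom_ring_def ring_hom_ring_axioms_def
  by (auto intro: ring_hom_trans)

lemma ring_epi_compose:
  assumes "ring_epi A B f" "ring_epi B C g"
  shows "ring_epi A C (g \<circ> f)"
  using assms ring_hom_ring_compose[of A B f C g]
  unfolding ring_epi_def ring_epi_axioms_def by (simp add: image_comp[symmetric] del: comp_apply)

context ring_epi
begin

lemma image_ideal:
  assumes "ideal I R"
  shows "ideal (h ` I) S"
proof -
  interpret I: ideal I R by fact
  have l: "r \<otimes>\<^bsub>S\<^esub> h a \<in> h ` I" "h a \<otimes>\<^bsub>S\<^esub> r \<in> h ` I" if ar: "a \<in> I" "r \<in> carrier S" for a r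
  proof -
    obtain r' where r': "r' \<in> carrier R" "r = h r'" using surj ar(2) by auto
    have "r \<otimes>\<^bsub>S\<^esub> h a = h (r' \<otimes>\<^bsub>R\<^esub> a)" "h a \<otimes>\<^bsub>S\<^esub> r = h (a \<otimes>\<^bsub>R\<^esub> r')" using r' ar by auto
    then show "r \<otimes>\<^bsub>S\<^esub> h a \<in> h ` I" "h a \<otimes>\<^bsub>S\<^esub> r \<in> h ` I"
      using I.I_l_closed[OF ar(1) r'(1)] I.I_r_closed[OF ar(1) r'(1)] by (metis imageI)+
  qed
  show ?thesis
  proof (rule S.ideal_intro)
    show "\<zero>\<^bsub>S\<^esub> \<in> h ` I" by (rule image_eqI[of _ _ "\<zero>\<^bsub>R\<^esub>"]) auto
    fix a b assume "a \<in> h ` I" "b \<in> h ` I"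
    then obtain x y where "x \<in> I" "y \<in> I" "a = h x" "b = h y" by auto
    then show "a \<oplus>\<^bsub>S\<^esub> b \<in> h ` I" by (intro image_eqI[of _ _ "x \<oplus>\<^bsub>R\<^esub> y"]) auto
  qed (use l in auto)
qed

lemma image_preimage:
  "J \<subseteq> carrier S \<Longrightarrow> h ` {x \<in> carrier R. h x \<in> J} = J"
  by (auto simp: surj[symmetric])

text \<open>An ideal containing the kernel is a union of fibres: \<open>h x = h y\<close> with
  \<open>y \<in> I\<close> puts the difference of \<open>x\<close> and \<open>y\<close> into the
  kernel, hence into \<open>I\<close>.\<close>

lemma mem_image_iff:
  assumes "ideal I R" "\<And>z. z \<in> carrier R \<Longrightarrow> h z = \<zero>\<^bsub>S\<^esub> \<Longrightarrow> z \<in> I" "x \<in> carrier R"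
  shows "h x \<in> h ` I \<longleftrightarrow> x \<in> I"
proof
  interpret I: ideal I R by fact
  assume "h x \<in> h ` I"
  then obtain y where y: "y \<in> I" "h x = h y" by auto
  then have "x \<ominus>\<^bsub>R\<^esub> y \<in> I" using assms hom_minus_eq_iff[of x y] by auto
  then have "x \<ominus>\<^bsub>R\<^esub> y \<oplus>\<^bsub>R\<^esub> y \<in> I" using y by blast
  then show "x \<in> I" using R.minus_add_cancel[OF assms(3)] y(1) I.Icarr by simp
qed simp

lemma image_subset_iff_subset:
  assumes "ideal I R" "ideal J R" "\<And>z. z \<in> carrier R \<Longrightarrow> h z = \<zero>\<^bsub>S\<^esub> \<Longrightarrow> z \<in> J"
  shows "h ` I \<subseteq> h ` J \<longleftrightarrow> I \<subseteq> J"
  using mem_image_iff[OF assms(2,3)] ideal.Icarr[OF assms(1)] by blast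

lemma prime_image_iff:
  assumes P: "ideal P R" and ker: "\<And>z. z \<in> carrier R \<Longrightarrow> h z = \<zero>\<^bsub>S\<^esub> \<Longrightarrow> z \<in> P"
  shows "h ` P \<in> prime_spectrum S \<longleftrightarrow> P \<in> prime_spectrum R"
proof -
  note mem = mem_image_iff[OF P ker]
  have "h ` P = carrier S \<longleftrightarrow> P = carrier R"
    using mem surj ideal.Icarr[OF P] by blast
  \<comment> \<open>Writing the target as the image of the source turns quantifiers over the target
    into quantifiers over the source; \<open>mem\<close> then strips \<open>h\<close> from each
    membership.\<close>
  moreover have "(\<forall>a\<in>carrier S. \<forall>b\<in>carrier S. (\<forall>r\<in>carrier S. a \<otimes>\<^bsub>S\<^esub> r \<otimes>\<^bsub>S\<^esub> b \<in> h ` P) \<longrightarrow> a \<in> h ` P \<or> b \<in> h ` P)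
    \<longleftrightarrow> (\<forall>a\<in>carrier R. \<forall>b\<in>carrier R. (\<forall>r\<in>carrier R. a \<otimes>\<^bsub>R\<^esub> r \<otimes>\<^bsub>R\<^esub> b \<in> P) \<longrightarrow> a \<in> P \<or> b \<in> P)"
    unfolding surj[symmetric] ball_simps
    by (simp add: mem hom_mult[symmetric] del: hom_mult cong: ball_cong)
  ultimately show ?thesis
    unfolding R.prime_spectrum_iff S.prime_spectrum_iff using P image_ideal[OF P] by simp
qed

lemma prime_spectrum_imageE:
  assumes "P \<in> prime_spectrum S"
  obtains P' where "P' \<in> prime_spectrum R" "\<And>z. z \<in> carrier R \<Longrightarrow> h z = \<zero>\<^bsub>S\<^esub> \<Longrightarrow> z \<in> P'" "P = h ` P'"
proof -
  let ?P = "{x \<in> carrier R. h x \<in> P}"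
  have P: "ideal P S" using assms prime_spectrumD by blast
  have im: "h ` ?P = P"
    using image_preimage ideal.Icarr[OF P] by blast
  have z: "\<And>z. z \<in> carrier R \<Longrightarrow> h z = \<zero>\<^bsub>S\<^esub> \<Longrightarrow> z \<in> ?P"
    using ideal.zero_mem[OF P] by simp
  show thesis
    using that[of ?P] prime_image_iff[OF preimage_ideal[OF P] z] im z assms by auto
qed

text \<open>On ideals containing the kernel, taking images preserves and reflects inclusion, so
  minimality passes both ways. Apart from quotient maps, this is applied with the zero ideal to
  conjugations.\<close>

lemma bij_betw_minimal_primes_over:
  assumes I: "ideal I R" and ker: "\<And>z. z \<in> carrier R \<Longrightarrow> h z = \<zero>\<^bsub>S\<^esub> \<Longrightarrow> z \<in> I"
  shows "bij_betw ((`) h) (minimal_primes_over R I) (minimal_primes_over S (h ` I))"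
proof -
  have sub: "h ` P \<subseteq> h ` Q \<longleftrightarrow> P \<subseteq> Q" if "ideal P R" "ideal Q R" "I \<subseteq> Q" for P Q
    using image_subset_iff_subset[of P Q] that ker by blast
  have pr: "h ` P \<in> prime_spectrum S \<longleftrightarrow> P \<in> prime_spectrum R" if "ideal P R" "I \<subseteq> P" for P
    using prime_image_iff[of P] that ker by blast
  have pre: "\<exists>P'. P' \<in> prime_spectrum R \<and> I \<subseteq> P' \<and> P = h ` P'"
    if P: "P \<in> prime_spectrum S" "h ` I \<subseteq> P" for P
  proof -
    obtain P' where P': "P' \<in> prime_spectrum R" "\<And>z. z \<in> carrier R \<Longrightarrow> h z = \<zero>\<^bsub>S\<^esub> \<Longrightarrow> z \<in> P'" "P = h ` P'"
      using prime_spectrum_imageE[OF P(1)] by metis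
    have "I \<subseteq> P'" using P(2) P' image_subset_iff_subset[OF I] prime_spectrumD by blast
    then show ?thesis using P' by blast
  qed
  show ?thesis
    unfolding bij_betw_def
  proof (intro conjI inj_onI)
    fix P Q assume "P \<in> minimal_primes_over R I" "Q \<in> minimal_primes_over R I" "h ` P = h ` Q"
    then have PQ: "ideal P R" "ideal Q R" "I \<subseteq> P" "I \<subseteq> Q" and eq: "h ` P = h ` Q"
      by (auto simp: minimal_primes_over_def prime_spectrum_def)
    have "P \<subseteq> Q" using sub[OF PQ(1,2,4)] eq by simp
    moreover have "Q \<subseteq> P" using sub[OF PQ(2,1,3)] eq by simp
    ultimately show "P = Q" by simp
  next
    show "(`) h ` minimal_primes_over R I = minimal_primes_over S (h ` I)"
    proof (intro subset_antisym subsetI)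
      fix P' assume "P' \<in> (`) h ` minimal_primes_over R I"
      then obtain P where P: "P \<in> minimal_primes_over R I" and P': "P' = h ` P" by auto
      then have P2: "P \<in> prime_spectrum R" "ideal P R" "I \<subseteq> P"
        using prime_spectrumD by (auto simp: minimal_primes_over_def)
      have "Q = h ` P" if Q: "Q \<in> prime_spectrum S" "h ` I \<subseteq> Q" "Q \<subseteq> h ` P" for Q
      proof -
        obtain Q' where Q': "Q' \<in> prime_spectrum R" "I \<subseteq> Q'" "Q = h ` Q'" using pre[OF Q(1,2)] by blast
        then have "Q' \<subseteq> P" using sub[of Q' P] P2 Q(3) prime_spectrumD(1)[OF Q'(1)] by simp
        then have "Q' = P" using P Q' by (auto simp: minimal_primes_over_def)
        then show ?thesis using Q' by simp
      qed
      then show "P' \<in> minimal_primes_over S (h ` I)"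
        using P2 P' pr[of P] by (auto simp: minimal_primes_over_def)
    next
      fix P' assume P': "P' \<in> minimal_primes_over S (h ` I)"
      then obtain P where P: "P \<in> prime_spectrum R" "I \<subseteq> P" "P' = h ` P"
        using pre[of P'] by (auto simp: minimal_primes_over_def)
      have "Q = P" if Q: "Q \<in> prime_spectrum R" "I \<subseteq> Q" "Q \<subseteq> P" for Q
      proof -
        have id: "ideal P R" "ideal Q R" using P Q prime_spectrumD by auto
        have "h ` Q \<in> prime_spectrum S" "h ` I \<subseteq> h ` Q" "h ` Q \<subseteq> h ` P"
          using pr[OF id(2) Q(2)] Q by auto
        then have "h ` Q = h ` P" using P' P by (auto simp: minimal_primes_over_def)
        then have "P \<subseteq> Q" using sub[OF id Q(2)] by simp
        then show ?thesis using Q(3) by simp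
      qed
      then have "P \<in> minimal_primes_over R I" using P by (auto simp: minimal_primes_over_def)
      then show "P' \<in> (`) h ` minimal_primes_over R I" using P by blast
    qed
  qed
qed

end

lemma (in ring_epi) bij_betw_minimal_primes:
  assumes I: "ideal I R" and ker: "\<And>z. z \<in> carrier R \<Longrightarrow> h z = \<zero>\<^bsub>S\<^esub> \<longleftrightarrow> z \<in> I"
  shows "bij_betw ((`) h) (minimal_primes_over R I) (minimal_primes S)"
proof -
  have "h ` I = (\<lambda>_. \<zero>\<^bsub>S\<^esub>) ` I"
    by (rule image_cong[OF refl]) (use ker ideal.Icarr[OF I] in blast)
  then have "h ` I = {\<zero>\<^bsub>S\<^esub>}" using image_constant[OF ideal.zero_mem[OF I]] by simp
  then show ?thesis
    using bij_betw_minimal_primes_over[OF I] ker unfolding S.minimal_primes_eq_over_zero by simp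
qed

lemma (in ideal) bij_betw_minimal_primes_quotient:
  "bij_betw ((`) ((+>) I)) (minimal_primes_over R I) (minimal_primes (R Quot I))"
  by (rule ring_epi.bij_betw_minimal_primes[OF ring_epi_coset is_ideal coset_eq_zero_iff])

lemma (in ring) minimal_primes_over_prime_radical:
  "minimal_primes_over R (prime_radical R) = minimal_primes R"
  by (auto simp: minimal_primes_over_def minimal_primes_def prime_radical_def)

text \<open>Every prime contains the radical, so its image in the quotient is again prime; a class
  lying in all these images has its representative in every prime.\<close>

lemma (in ring) prime_radical_quotient:
  "prime_radical (R Quot prime_radical R) = {\<zero>\<^bsub>R Quot prime_radical R\<^esub>}"
proof -
  interpret n: ideal "prime_radical R" R by (rule prime_radical_ideal)
  interpret q: ring_epi R "R Quot prime_radical R" "(+>) (prime_radical R)" by (rule n.ring_epi_coset)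
  have "x = \<zero>\<^bsub>R Quot prime_radical R\<^esub>" if x: "x \<in> prime_radical (R Quot prime_radical R)" for x
  proof -
    have "x \<in> carrier (R Quot prime_radical R)" using x by (simp add: prime_radical_def)
    then obtain y where y: "y \<in> carrier R" "x = prime_radical R +> y" using q.surj by (metis imageE)
    have "y \<in> p" if p: "p \<in> prime_spectrum R" for p
    proof -
      have ker: "z \<in> p" if "z \<in> carrier R" "prime_radical R +> z = \<zero>\<^bsub>R Quot prime_radical R\<^esub>" for z
        using n.coset_eq_zero_iff[OF that(1)] that(2) p by (auto simp: prime_radical_def)
      have "(+>) (prime_radical R) ` p \<in> prime_spectrum (R Quot prime_radical R)"
        using q.prime_image_iff[OF prime_spectrumD(1)[OF p] ker] p by blast
      then have "x \<in> (+>) (prime_radical R) ` p" using x by (simp add: prime_radical_def)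
      then show ?thesis unfolding y(2) using q.mem_image_iff[OF prime_spectrumD(1)[OF p] ker y(1)] by blast
    qed
    then have "y \<in> prime_radical R" using y(1) by (simp add: prime_radical_def)
    then show ?thesis using n.coset_eq_zero_iff[OF y(1)] y(2) by simp
  qed
  moreover have "\<zero>\<^bsub>R Quot prime_radical R\<^esub> \<in> prime_radical (R Quot prime_radical R)"
    by (rule ideal.zero_mem[OF ring.prime_radical_ideal[OF n.quotient_is_ring]])
  ultimately show ?thesis by blast
qed

text \<open>Supplies nilpotency for a ring whose prime radical vanishes. The exponent is one,
  because the zeroth power is the whole ring.\<close>

lemma (in ring) ideal_power_zero: "ideal_power R {\<zero>} (Suc 0) = {\<zero>}"
proof -
  have "carrier R \<cdot> {\<zero>} \<subseteq> {\<zero>}" using ideal_prod_inter[OF oneideal zeroideal] by auto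
  moreover have "\<zero> \<in> carrier R \<cdot> {\<zero>}" by (rule ideal.zero_mem[OF ideal_prod_is_ideal[OF oneideal zeroideal]])
  ultimately show ?thesis by auto
qed

section \<open>Homomorphisms induced on an epimorphic image\<close>

lemma induced_eqI:
  assumes "x \<in> D" "\<And>x'. x' \<in> D \<Longrightarrow> f x' = f x \<Longrightarrow> g x' = g x"
  shows "induced D f g (f x) = g x"
  unfolding induced_def
proof (rule the_equality)
  show "\<exists>y\<in>D. f y = f x \<and> g y = g x" using assms(1) by blast
  show "z = g x" if "\<exists>y\<in>D. f y = f x \<and> g y = z" for z using that assms(2) by blast
qed

text \<open>The factorization of \<open>g\<close> through the surjection \<open>f\<close>. The
  kernel condition makes \<open>g\<close> constant on the fibres of \<open>f\<close>, so the
  description in \<open>induced\<close> has a unique value. All natural maps between factor rings in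
  the diagram arise in this way.\<close>

locale induced_hom = ring_epi A B f + g: ring_hom_ring A C g for A B f C g +
  assumes ker: "\<And>x. x \<in> carrier A \<Longrightarrow> f x = \<zero>\<^bsub>B\<^esub> \<Longrightarrow> g x = \<zero>\<^bsub>C\<^esub>"
begin

lemma induced_apply:
  assumes "x \<in> carrier A"
  shows "induced (carrier A) f g (f x) = g x"
proof (rule induced_eqI[OF assms])
  fix x' assume x': "x' \<in> carrier A" "f x' = f x"
  then have "f (x' \<ominus>\<^bsub>A\<^esub> x) = \<zero>\<^bsub>B\<^esub>" using hom_minus_eq_iff assms by blast
  then show "g x' = g x" using ker[of "x' \<ominus>\<^bsub>A\<^esub> x"] g.hom_minus_eq_iff x' assms by simp
qed

lemma induced_ring_hom: "ring_hom_ring B C (induced (carrier A) f g)"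
proof (rule ring_hom_ringI[OF S.ring_axioms g.S.ring_axioms])
  let ?k = "induced (carrier A) f g"
  show "?k \<one>\<^bsub>B\<^esub> = \<one>\<^bsub>C\<^esub>" using induced_apply[of "\<one>\<^bsub>A\<^esub>"] by simp
  fix x assume "x \<in> carrier B"
  then obtain x' where x': "x' \<in> carrier A" "x = f x'" using surj by auto
  then show "?k x \<in> carrier C" by (simp add: induced_apply)
  fix y assume "y \<in> carrier B"
  then obtain y' where y': "y' \<in> carrier A" "y = f y'" using surj by auto
  show "?k (x \<otimes>\<^bsub>B\<^esub> y) = ?k x \<otimes>\<^bsub>C\<^esub> ?k y"
    using x' y' induced_apply[of "x' \<otimes>\<^bsub>A\<^esub> y'"] by (simp add: induced_apply)
  show "?k (x \<oplus>\<^bsub>B\<^esub> y) = ?k x \<oplus>\<^bsub>C\<^esub> ?k y"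
    using x' y' induced_apply[of "x' \<oplus>\<^bsub>A\<^esub> y'"] by (simp add: induced_apply)
qed

lemma induced_ring_iso:
  assumes "g ` carrier A = carrier C"
    and "\<And>x. x \<in> carrier A \<Longrightarrow> g x = \<zero>\<^bsub>C\<^esub> \<Longrightarrow> f x = \<zero>\<^bsub>B\<^esub>"
  shows "induced (carrier A) f g \<in> ring_iso B C"
proof -
  let ?k = "induced (carrier A) f g"
  interpret k: ring_hom_ring B C ?k by (rule induced_ring_hom)
  have "?k ` carrier B = carrier C"
    unfolding surj[symmetric] image_image using induced_apply assms(1) by (simp cong: image_cong)
  moreover have "inj_on ?k (carrier B)"
  proof (rule inj_onI)
    fix x y assume xy: "x \<in> carrier B" "y \<in> carrier B" "?k x = ?k y"
    then obtain x' y' where "x' \<in> carrier A" "x = f x'" "y' \<in> carrier A" "y = f y'"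
      using surj by (metis imageE)
    with xy show "x = y"
      using assms(2)[of "x' \<ominus>\<^bsub>A\<^esub> y'"] g.hom_minus_eq_iff[of x' y'] hom_minus_eq_iff[of x' y']
      by (simp add: induced_apply)
  qed
  ultimately show ?thesis using k.homh by (auto simp: ring_iso_def bij_betw_def)
qed

end

lemma (in induced_hom) ring_epi_induced:
  assumes "g ` carrier A = carrier C"
  shows "ring_epi B C (induced (carrier A) f g)"
proof -
  have "induced (carrier A) f g ` carrier B = carrier C"
    unfolding surj[symmetric] image_image using induced_apply assms by (simp cong: image_cong)
  then show ?thesis using induced_ring_hom by (simp add: ring_epi_def ring_epi_axioms_def)
qed

lemma ring_iso_imp_ring_epi:
  assumes "ring A" "ring B" "f \<in> ring_iso A B"
  shows "ring_epi A B f"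
  using assms ring_hom_ringI2[of A B f]
  by (simp add: ring_epi_def ring_epi_axioms_def ring_iso_def bij_betw_def)

lemma ring_iso_eq_zero_iff:
  assumes "ring A" "ring B" "f \<in> ring_iso A B" "z \<in> carrier A"
  shows "f z = \<zero>\<^bsub>B\<^esub> \<longleftrightarrow> z \<in> {\<zero>\<^bsub>A\<^esub>}"
proof -
  interpret ring_epi A B f by (rule ring_iso_imp_ring_epi[OF assms(1-3)])
  have "inj_on f (carrier A)" using assms(3) by (simp add: ring_iso_def bij_betw_def)
  then have "f z = f \<zero>\<^bsub>A\<^esub> \<longleftrightarrow> z = \<zero>\<^bsub>A\<^esub>" using assms(4) by (intro inj_on_eq_iff) auto
  then show ?thesis by simp
qed

section \<open>Multiplicative sets of normal elements\<close>

text \<open>Normality is required of every element and not of a generating set;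
  \<open>normal_submonoidI\<close> makes the passage.\<close>

locale normal_submonoid = ring R for R (structure) +
  fixes S
  assumes submonoid_S: "submonoid S R"
    and normal: "s \<in> S \<Longrightarrow> normal_element R s"
    and zero_notin: "\<zero> \<notin> S"
begin

lemma S_closed [simp]: "s \<in> S \<Longrightarrow> s \<in> carrier R"
  using submonoid.subset[OF submonoid_S] by auto

lemma one_in_S [simp]: "\<one> \<in> S"
  by (rule submonoid.one_closed[OF submonoid_S])

lemma mult_in_S [simp]: "s \<in> S \<Longrightarrow> t \<in> S \<Longrightarrow> s \<otimes> t \<in> S"
  by (rule submonoid.m_closed[OF submonoid_S])

lemma pow_in_S [simp]: "s \<in> S \<Longrightarrow> s [^] (n::nat) \<in> S"
  by (induction n) auto

lemma normal_leftE:
  assumes "s \<in> S" "r \<in> carrier R"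
  obtains r' where "r' \<in> carrier R" "s \<otimes> r = r' \<otimes> s"
  using normal[OF assms(1)] assms(2) unfolding normal_element_def r_coset_def l_coset_def by blast

lemma normal_rightE:
  assumes "s \<in> S" "r \<in> carrier R"
  obtains r' where "r' \<in> carrier R" "r \<otimes> s = s \<otimes> r'"
  using normal[OF assms(1)] assms(2) unfolding normal_element_def r_coset_def l_coset_def by blast

lemma multiplicative_subset: "multiplicative_subset R S"
  using submonoid_S zero_notin by (simp add: multiplicative_subset_def)

lemma left_ore_set: "left_ore_set R S"
proof -
  have "(S #> r) \<inter> (carrier R #> s) \<noteq> {}" if r: "r \<in> carrier R" and s: "s \<in> S" for r s
  proof -
    obtain r' where "r' \<in> carrier R" "s \<otimes> r = r' \<otimes> s" using normal_leftE[OF s r] .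
    then show ?thesis using s unfolding r_coset_def by blast
  qed
  then show ?thesis using multiplicative_subset by (simp add: left_ore_set_def)
qed

lemma right_ore_set: "right_ore_set R S"
proof -
  have "(r <# S) \<inter> (s <# carrier R) \<noteq> {}" if r: "r \<in> carrier R" and s: "s \<in> S" for r s
  proof -
    obtain r' where "r' \<in> carrier R" "r \<otimes> s = s \<otimes> r'" using normal_rightE[OF s r] .
    then show ?thesis using s unfolding l_coset_def by blast
  qed
  then show ?thesis using multiplicative_subset by (simp add: right_ore_set_def)
qed

text \<open>The localization of a saturated ideal \<open>I\<close> is a two-sided ideal that contracts back to \<open>I\<close>.\<close>

definition saturated :: "'a set \<Rightarrow> bool" where
  "saturated I \<longleftrightarrow> ideal I R \<and>
     (\<forall>s\<in>S. \<forall>r\<in>carrier R. s \<otimes> r \<in> I \<or> r \<otimes> s \<in> I \<longrightarrow> r \<in> I)"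

lemma saturatedD:
  assumes "saturated I"
  shows "ideal I R"
    and "s \<in> S \<Longrightarrow> r \<in> carrier R \<Longrightarrow> s \<otimes> r \<in> I \<Longrightarrow> r \<in> I"
    and "s \<in> S \<Longrightarrow> r \<in> carrier R \<Longrightarrow> r \<otimes> s \<in> I \<Longrightarrow> r \<in> I"
  using assms unfolding saturated_def by blast+

text \<open>Normality gives \<open>s \<otimes> x = x' \<otimes> s\<close>, so
  \<open>s \<otimes> r \<in> p\<close> already forces
  \<open>s \<otimes> x \<otimes> r \<in> p\<close> for every \<open>x\<close>; since
  \<open>s\<close> is outside \<open>p\<close>, primeness yields \<open>r \<in> p\<close>. The other
  side is symmetric.\<close>

lemma saturated_prime:
  assumes p: "p \<in> prime_spectrum R" "p \<inter> S = {}"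
  shows "saturated p"
proof -
  interpret p: ideal p R using p by (simp add: prime_spectrum_def)
  have "r \<in> p" if s: "s \<in> S" and r: "r \<in> carrier R" and sr: "s \<otimes> r \<in> p" for s r
  proof -
    have "s \<otimes> x \<otimes> r \<in> p" if x: "x \<in> carrier R" for x
    proof -
      obtain x' where x': "x' \<in> carrier R" "s \<otimes> x = x' \<otimes> s" using normal_leftE[OF s x] .
      then have "s \<otimes> x \<otimes> r = x' \<otimes> (s \<otimes> r)" using s r by (simp add: m_assoc)
      then show ?thesis using p.I_l_closed[OF sr x'(1)] by simp
    qed
    then show ?thesis using prime_spectrumE[OF p(1), of s r] s r p(2) by auto
  qed
  moreover have "r \<in> p" if s: "s \<in> S" and r: "r \<in> carrier R" and rs: "r \<otimes> s \<in> p" for s r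
  proof -
    have "r \<otimes> x \<otimes> s \<in> p" if x: "x \<in> carrier R" for x
    proof -
      obtain x' where x': "x' \<in> carrier R" "x \<otimes> s = s \<otimes> x'" using normal_rightE[OF s x] .
      then have "r \<otimes> x \<otimes> s = (r \<otimes> s) \<otimes> x'" using s r x by (simp add: m_assoc)
      then show ?thesis using p.I_r_closed[OF rs x'(1)] by simp
    qed
    then show ?thesis using prime_spectrumE[OF p(1), of r s] s r p(2) by auto
  qed
  ultimately show ?thesis using p.is_ideal unfolding saturated_def by blast
qed

lemma saturated_Inter:
  assumes "\<And>I. I \<in> A \<Longrightarrow> saturated I"
  shows "saturated (carrier R \<inter> \<Inter>A)"
proof -
  have "ideal (carrier R \<inter> \<Inter>A) R"
    by (rule ideal_carrier_Int_Inter) (rule saturatedD(1)[OF assms])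
  moreover have "r \<in> \<Inter>A" if "s \<in> S" "r \<in> carrier R" "s \<otimes> r \<in> \<Inter>A \<or> r \<otimes> s \<in> \<Inter>A" for s r
  proof
    fix I assume I: "I \<in> A"
    then have "s \<otimes> r \<in> I \<or> r \<otimes> s \<in> I" using that(3) by auto
    then show "r \<in> I" using saturatedD(2,3)[OF assms[OF I] that(1,2)] by auto
  qed
  ultimately show ?thesis unfolding saturated_def by blast
qed

lemma two_sided_torsionI:
  assumes "s \<in> S" "t \<in> S" "r \<in> carrier R" "s \<otimes> r \<otimes> t = \<zero>"
  shows "r \<in> two_sided_torsion R S"
  using assms unfolding two_sided_torsion_def by blast

lemma saturated_two_sided_torsion: "saturated (two_sided_torsion R S)"
proof -
  let ?a = "two_sided_torsion R S"
  have "ideal ?a R"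
  proof (rule ideal_intro)
    show "?a \<subseteq> carrier R" by (auto simp: two_sided_torsion_def)
    have "\<one> \<otimes> \<zero> \<otimes> \<one> = \<zero>" by simp
    then show "\<zero> \<in> ?a" unfolding two_sided_torsion_def using one_in_S by blast
  next
    fix a b assume "a \<in> ?a" "b \<in> ?a"
    then obtain s t s' t' where a: "a \<in> carrier R" "s \<in> S" "t \<in> S" "s \<otimes> a \<otimes> t = \<zero>"
      and b: "b \<in> carrier R" "s' \<in> S" "t' \<in> S" "s' \<otimes> b \<otimes> t' = \<zero>"
      by (auto simp: two_sided_torsion_def)
    \<comment> \<open>One pair of factors must annihilate both \<open>a\<close> and
      \<open>b\<close>. In \<open>s \<otimes> s'\<close> the factor \<open>s'\<close> already faces
      \<open>b\<close>, and rewriting it as \<open>x \<otimes> s\<close> lets \<open>s\<close> face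
      \<open>a\<close>; on the right, \<open>t' \<otimes> t\<close> does the same.\<close>
    obtain x where x: "x \<in> carrier R" "s \<otimes> s' = x \<otimes> s" using normal_leftE[of s s'] a b by auto
    obtain y where y: "y \<in> carrier R" "t' \<otimes> t = t \<otimes> y" using normal_rightE[of t t'] a b by auto
    have "(s \<otimes> s') \<otimes> a \<otimes> (t' \<otimes> t) = x \<otimes> (s \<otimes> a \<otimes> t) \<otimes> y"
      unfolding x(2) y(2) using a(1-3) b(1-3) x(1) y(1) by (simp add: m_assoc)
    also have "\<dots> = \<zero>" unfolding a(4) using x y by simp
    finally have A: "(s \<otimes> s') \<otimes> a \<otimes> (t' \<otimes> t) = \<zero>" .
    have "(s \<otimes> s') \<otimes> b \<otimes> (t' \<otimes> t) = s \<otimes> (s' \<otimes> b \<otimes> t') \<otimes> t"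
      using a(1-3) b(1-3) by (simp add: m_assoc)
    also have "\<dots> = \<zero>" unfolding b(4) using a by simp
    finally have B: "(s \<otimes> s') \<otimes> b \<otimes> (t' \<otimes> t) = \<zero>" .
    have "(s \<otimes> s') \<otimes> (a \<oplus> b) \<otimes> (t' \<otimes> t) = \<zero>"
      using A B a(1-3) b(1-3) by (simp add: r_distr l_distr)
    then show "a \<oplus> b \<in> ?a"
      by (rule two_sided_torsionI[rotated 3]) (use a b in auto)
  next
    fix a r assume "a \<in> ?a" and r: "r \<in> carrier R"
    then obtain s t where a: "a \<in> carrier R" "s \<in> S" "t \<in> S" "s \<otimes> a \<otimes> t = \<zero>"
      by (auto simp: two_sided_torsion_def)
    obtain x where x: "x \<in> carrier R" "s \<otimes> r = x \<otimes> s" using normal_leftE[OF a(2) r] .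
    have "s \<otimes> (r \<otimes> a) \<otimes> t = (s \<otimes> r) \<otimes> a \<otimes> t" using a(1-3) r by (simp add: m_assoc)
    also have "\<dots> = x \<otimes> (s \<otimes> a \<otimes> t)" unfolding x(2) using a(1-3) x(1) by (simp add: m_assoc)
    also have "\<dots> = \<zero>" unfolding a(4) using x by simp
    finally have "s \<otimes> (r \<otimes> a) \<otimes> t = \<zero>" .
    then show "r \<otimes> a \<in> ?a"
      by (rule two_sided_torsionI[rotated 3]) (use a r in auto)
    obtain y where y: "y \<in> carrier R" "r \<otimes> t = t \<otimes> y" using normal_rightE[OF a(3) r] .
    have "s \<otimes> (a \<otimes> r) \<otimes> t = s \<otimes> a \<otimes> (r \<otimes> t)" using a(1-3) r by (simp add: m_assoc)
    also have "\<dots> = (s \<otimes> a \<otimes> t) \<otimes> y" unfolding y(2) using a(1-3) y(1) by (simp add: m_assoc)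
    also have "\<dots> = \<zero>" unfolding a(4) using y by simp
    finally have "s \<otimes> (a \<otimes> r) \<otimes> t = \<zero>" .
    then show "a \<otimes> r \<in> ?a"
      by (rule two_sided_torsionI[rotated 3]) (use a r in auto)
  qed
  moreover have "r \<in> ?a" if h: "u \<in> S" "r \<in> carrier R" "u \<otimes> r \<in> ?a" for u r
  proof -
    obtain s t where st: "s \<in> S" "t \<in> S" "s \<otimes> (u \<otimes> r) \<otimes> t = \<zero>"
      using h(3) by (auto simp: two_sided_torsion_def)
    then have "(s \<otimes> u) \<otimes> r \<otimes> t = \<zero>" using h(1,2) by (simp add: m_assoc)
    then show ?thesis
      by (rule two_sided_torsionI[rotated 3]) (use st h in auto)
  qed
  moreover have "r \<in> ?a" if h: "u \<in> S" "r \<in> carrier R" "r \<otimes> u \<in> ?a" for u r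
  proof -
    obtain s t where st: "s \<in> S" "t \<in> S" "s \<otimes> (r \<otimes> u) \<otimes> t = \<zero>"
      using h(3) by (auto simp: two_sided_torsion_def)
    then have "s \<otimes> r \<otimes> (u \<otimes> t) = \<zero>" using h(1,2) by (simp add: m_assoc)
    then show ?thesis
      by (rule two_sided_torsionI[rotated 3]) (use st h in auto)
  qed
  ultimately show ?thesis unfolding saturated_def by blast
qed

lemma two_sided_torsion_disjoint: "two_sided_torsion R S \<inter> S = {}"
proof -
  have "s \<otimes> x \<otimes> t \<noteq> \<zero>" if "s \<in> S" "x \<in> S" "t \<in> S" for s x t
    using that mult_in_S zero_notin by metis
  then show ?thesis by (auto simp: two_sided_torsion_def)
qed

end

text \<open>Products of normal elements are normal, so the normal elements form a submonoid; it
  contains the generators and therefore the intersection that defines \<open>S\<close>.\<close>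

lemma normal_submonoidI:
  assumes R: "ring R" and S: "multiplicative_subset R S" "generated_by_normal_elements R S"
  shows "normal_submonoid R S"
proof -
  interpret ring R by fact
  obtain G where G: "\<And>x. x \<in> G \<Longrightarrow> normal_element R x" "S = \<Inter> {H. submonoid H R \<and> G \<subseteq> H}"
    using S(2) unfolding generated_by_normal_elements_def by blast
  have iff: "normal_element R x \<longleftrightarrow> x \<in> carrier R \<and>
    (\<forall>r\<in>carrier R. \<exists>r'\<in>carrier R. r \<otimes>\<^bsub>R\<^esub> x = x \<otimes>\<^bsub>R\<^esub> r') \<and> (\<forall>r\<in>carrier R. \<exists>r'\<in>carrier R. x \<otimes>\<^bsub>R\<^esub> r = r' \<otimes>\<^bsub>R\<^esub> x)" for x
    unfolding normal_element_def r_coset_def l_coset_def by blast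
  have "submonoid {x. normal_element R x} R"
  proof
    show "{x. normal_element R x} \<subseteq> carrier R" by (auto simp: normal_element_def)
    show "\<one>\<^bsub>R\<^esub> \<in> {x. normal_element R x}" by (auto simp: iff)
    fix x y assume "x \<in> {x. normal_element R x}" "y \<in> {x. normal_element R x}"
    then have x: "x \<in> carrier R" "\<And>r. r \<in> carrier R \<Longrightarrow> \<exists>r'\<in>carrier R. r \<otimes>\<^bsub>R\<^esub> x = x \<otimes>\<^bsub>R\<^esub> r'"
         "\<And>r. r \<in> carrier R \<Longrightarrow> \<exists>r'\<in>carrier R. x \<otimes>\<^bsub>R\<^esub> r = r' \<otimes>\<^bsub>R\<^esub> x"
      and y: "y \<in> carrier R" "\<And>r. r \<in> carrier R \<Longrightarrow> \<exists>r'\<in>carrier R. r \<otimes>\<^bsub>R\<^esub> y = y \<otimes>\<^bsub>R\<^esub> r'"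
         "\<And>r. r \<in> carrier R \<Longrightarrow> \<exists>r'\<in>carrier R. y \<otimes>\<^bsub>R\<^esub> r = r' \<otimes>\<^bsub>R\<^esub> y"
      by (auto simp: iff)
    have "\<exists>r'\<in>carrier R. r \<otimes>\<^bsub>R\<^esub> (x \<otimes>\<^bsub>R\<^esub> y) = x \<otimes>\<^bsub>R\<^esub> y \<otimes>\<^bsub>R\<^esub> r'" if r: "r \<in> carrier R" for r
    proof -
      obtain r1 where r1: "r1 \<in> carrier R" "r \<otimes>\<^bsub>R\<^esub> x = x \<otimes>\<^bsub>R\<^esub> r1" using x(2)[OF r] by auto
      obtain r2 where r2: "r2 \<in> carrier R" "r1 \<otimes>\<^bsub>R\<^esub> y = y \<otimes>\<^bsub>R\<^esub> r2" using y(2)[OF r1(1)] by auto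
      have "r \<otimes>\<^bsub>R\<^esub> (x \<otimes>\<^bsub>R\<^esub> y) = x \<otimes>\<^bsub>R\<^esub> (r1 \<otimes>\<^bsub>R\<^esub> y)"
        using r r1 x(1) y(1) by (metis m_assoc)
      also have "\<dots> = x \<otimes>\<^bsub>R\<^esub> y \<otimes>\<^bsub>R\<^esub> r2" using r2 x(1) y(1) by (metis m_assoc)
      finally show ?thesis using r2(1) by blast
    qed
    moreover have "\<exists>r'\<in>carrier R. x \<otimes>\<^bsub>R\<^esub> y \<otimes>\<^bsub>R\<^esub> r = r' \<otimes>\<^bsub>R\<^esub> (x \<otimes>\<^bsub>R\<^esub> y)" if r: "r \<in> carrier R" for r
    proof -
      obtain r1 where r1: "r1 \<in> carrier R" "y \<otimes>\<^bsub>R\<^esub> r = r1 \<otimes>\<^bsub>R\<^esub> y" using y(3)[OF r] by auto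
      obtain r2 where r2: "r2 \<in> carrier R" "x \<otimes>\<^bsub>R\<^esub> r1 = r2 \<otimes>\<^bsub>R\<^esub> x" using x(3)[OF r1(1)] by auto
      have "x \<otimes>\<^bsub>R\<^esub> y \<otimes>\<^bsub>R\<^esub> r = x \<otimes>\<^bsub>R\<^esub> r1 \<otimes>\<^bsub>R\<^esub> y"
        using r r1 x(1) y(1) by (metis m_assoc)
      also have "\<dots> = r2 \<otimes>\<^bsub>R\<^esub> (x \<otimes>\<^bsub>R\<^esub> y)" using r2 x(1) y(1) by (metis m_assoc)
      finally show ?thesis using r2(1) by blast
    qed
    ultimately show "x \<otimes>\<^bsub>R\<^esub> y \<in> {x. normal_element R x}" using x(1) y(1) by (auto simp: iff)
  qed
  then have "S \<subseteq> {x. normal_element R x}" using G by blast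
  then show ?thesis using S(1) R
    by (intro normal_submonoid.intro normal_submonoid_axioms.intro) (auto simp: multiplicative_subset_def)
qed

section \<open>Regular normal elements\<close>

locale normal_regular_set = normal_submonoid +
  assumes l_regular: "s \<in> S \<Longrightarrow> r \<in> carrier R \<Longrightarrow> s \<otimes> r = \<zero> \<Longrightarrow> r = \<zero>"
    and r_regular: "s \<in> S \<Longrightarrow> r \<in> carrier R \<Longrightarrow> r \<otimes> s = \<zero> \<Longrightarrow> r = \<zero>"
begin

lemma S_in_Den: "S \<in> Den R {\<zero>}"
proof -
  have l: "\<exists>t\<in>S. t \<otimes> r = \<zero>" if "r \<in> carrier R" "s \<in> S" "r \<otimes> s = \<zero>" for r s
    using that r_regular one_in_S by (metis l_one)
  have r: "\<exists>t\<in>S. r \<otimes> t = \<zero>" if "r \<in> carrier R" "s \<in> S" "s \<otimes> r = \<zero>" for r s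
    using that l_regular one_in_S by (metis r_one)
  have "{r \<in> carrier R. \<exists>s\<in>S. s \<otimes> r = \<zero>} = {\<zero>}"
  proof (intro subset_antisym subsetI)
    fix r assume "r \<in> {\<zero>}"
    moreover have "\<one> \<otimes> \<zero> = \<zero>" by simp
    ultimately show "r \<in> {r \<in> carrier R. \<exists>s\<in>S. s \<otimes> r = \<zero>}" using one_in_S by blast
  qed (use l_regular in auto)
  then show ?thesis
    using left_ore_set right_ore_set l r
    unfolding Den_def left_denominator_set_def right_denominator_set_def by blast
qed

lemma S_l_cancel:
  assumes "s \<in> S" "r \<in> carrier R" "q \<in> carrier R"
  shows "s \<otimes> r = s \<otimes> q \<longleftrightarrow> r = q"
proof
  assume eq: "s \<otimes> r = s \<otimes> q"
  have "s \<otimes> (r \<ominus> q) = s \<otimes> r \<ominus> s \<otimes> q"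
    using assms by (simp add: minus_eq r_distr r_minus)
  then have "s \<otimes> (r \<ominus> q) = \<zero>" using eq assms by simp
  then show "r = q" using l_regular[of s "r \<ominus> q"] assms by simp
qed simp

lemma S_r_cancel:
  assumes "s \<in> S" "r \<in> carrier R" "q \<in> carrier R"
  shows "r \<otimes> s = q \<otimes> s \<longleftrightarrow> r = q"
proof
  assume eq: "r \<otimes> s = q \<otimes> s"
  have "(r \<ominus> q) \<otimes> s = r \<otimes> s \<ominus> q \<otimes> s"
    using assms by (simp add: minus_eq l_distr l_minus)
  then have "(r \<ominus> q) \<otimes> s = \<zero>" using eq assms by simp
  then show "r = q" using r_regular[of s "r \<ominus> q"] assms by simp
qed simp

text \<open>The element \<open>s r s\<^sup>-\<^sup>1\<close>, although \<open>s\<close> need not be invertible.\<close>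

definition conjugate :: "'a \<Rightarrow> 'a \<Rightarrow> 'a" where
  "conjugate s r = (THE r'. r' \<in> carrier R \<and> s \<otimes> r = r' \<otimes> s)"

lemma conjugate_unique:
  assumes "s \<in> S" "r' \<in> carrier R" "s \<otimes> r = r' \<otimes> s"
  shows "conjugate s r = r'"
  unfolding conjugate_def
proof (rule the_equality)
  show "r'' = r'" if "r'' \<in> carrier R \<and> s \<otimes> r = r'' \<otimes> s" for r''
    using that assms S_r_cancel[of s r'' r'] by simp
qed (use assms in simp)

lemma conjugate:
  assumes "s \<in> S" "r \<in> carrier R"
  shows conjugate_closed [simp]: "conjugate s r \<in> carrier R"
    and conjugate_eq: "s \<otimes> r = conjugate s r \<otimes> s"
proof -
  obtain r' where "r' \<in> carrier R" "s \<otimes> r = r' \<otimes> s" using normal_leftE[OF assms] .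
  moreover from this have "conjugate s r = r'" using conjugate_unique assms by simp
  ultimately show "conjugate s r \<in> carrier R" "s \<otimes> r = conjugate s r \<otimes> s" by simp_all
qed

text \<open>Each law follows by exhibiting the element that \<open>conjugate_unique\<close> singles
  out. Surjectivity uses the other half of normality: \<open>r \<otimes> s\<close> has the form
  \<open>s \<otimes> x\<close>, and then \<open>r\<close> is the conjugate of
  \<open>x\<close>.\<close>

lemma conjugate_epi:
  assumes s: "s \<in> S"
  shows "ring_epi R R (conjugate s)"
proof -
  have "ring_hom_ring R R (conjugate s)"
  proof (rule ring_hom_ringI[OF ring_axioms ring_axioms])
    fix x y assume xy: "x \<in> carrier R" "y \<in> carrier R"
    have "s \<otimes> (x \<otimes> y) = conjugate s x \<otimes> s \<otimes> y"
      using s xy conjugate_eq[of s x] by (simp add: m_assoc[symmetric])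
    also have "\<dots> = conjugate s x \<otimes> conjugate s y \<otimes> s"
      using s xy conjugate_eq[of s y] by (simp add: m_assoc)
    finally show "conjugate s (x \<otimes> y) = conjugate s x \<otimes> conjugate s y"
      using s xy by (intro conjugate_unique) auto
    have "s \<otimes> (x \<oplus> y) = (conjugate s x \<oplus> conjugate s y) \<otimes> s"
      using s xy conjugate_eq[of s x] conjugate_eq[of s y] by (simp add: l_distr r_distr)
    then show "conjugate s (x \<oplus> y) = conjugate s x \<oplus> conjugate s y"
      using s xy by (intro conjugate_unique) auto
  next
    show "conjugate s \<one> = \<one>" using s by (intro conjugate_unique) auto
  qed (use s in simp)
  moreover have "conjugate s ` carrier R = carrier R"
  proof (intro subset_antisym subsetI)
    fix r assume r: "r \<in> carrier R"
    obtain x where "x \<in> carrier R" "r \<otimes> s = s \<otimes> x" using normal_rightE[OF s r] .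
    then show "r \<in> conjugate s ` carrier R" using conjugate_unique[of s r x] s r by auto
  qed (use s in auto)
  ultimately show ?thesis by (simp add: ring_epi_def ring_epi_axioms_def)
qed

lemma conjugate_eq_zero:
  assumes "s \<in> S" "r \<in> carrier R" "conjugate s r = \<zero>"
  shows "r = \<zero>"
  using assms conjugate_eq[of s r] l_regular[of s r] by simp

lemma conjugate_mult:
  assumes "s \<in> S" "t \<in> S" "r \<in> carrier R"
  shows "conjugate (s \<otimes> t) r = conjugate s (conjugate t r)"
proof (rule conjugate_unique)
  have "s \<otimes> t \<otimes> r = s \<otimes> conjugate t r \<otimes> t"
    using assms conjugate_eq[of t r] by (simp add: m_assoc)
  then show "s \<otimes> t \<otimes> r = conjugate s (conjugate t r) \<otimes> (s \<otimes> t)"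
    using assms conjugate_eq[of s "conjugate t r"] by (simp add: m_assoc)
qed (use assms in auto)

section \<open>Conjugation acting on the minimal primes\<close>

lemma conjugate_minimal_prime:
  assumes "s \<in> S" "p \<in> minimal_primes R"
  shows "conjugate s ` p \<in> minimal_primes R"
proof -
  interpret c: ring_epi R R "conjugate s" by (rule conjugate_epi[OF assms(1)])
  have 0: "conjugate s ` {\<zero>} = {\<zero>}" by simp
  have "z \<in> {\<zero>}" if "z \<in> carrier R" "conjugate s z = \<zero>" for z
    using conjugate_eq_zero[OF assms(1) that] by simp
  then have "bij_betw ((`) (conjugate s)) (minimal_primes R) (minimal_primes R)"
    using c.bij_betw_minimal_primes_over[OF zeroideal] unfolding minimal_primes_eq_over_zero 0 by blast
  then show ?thesis using assms(2) by (rule bij_betw_apply)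
qed

text \<open>Conjugation is injective because \<open>s\<close> is regular. Used in both directions,
  this cancels \<open>conjugate (s [^] j)\<close> from an equality of images.\<close>

lemma conjugate_image_subset:
  assumes "s \<in> S" "P \<subseteq> carrier R" "Q \<subseteq> carrier R" "conjugate s ` P = conjugate s ` Q"
  shows "P \<subseteq> Q"
proof
  interpret c: ring_epi R R "conjugate s" by (rule conjugate_epi[OF assms(1)])
  fix x assume x: "x \<in> P"
  then obtain y where y: "y \<in> Q" "conjugate s x = conjugate s y" using assms(4) by blast
  then have "conjugate s (x \<ominus> y) = \<zero>" using c.hom_minus_eq_iff[of x y] x assms by auto
  then have "x \<ominus> y = \<zero>" using conjugate_eq_zero[of s "x \<ominus> y"] x y assms by auto
  then show "x \<in> Q" using x y assms r_right_minus_eq[of x y] by auto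
qed

text \<open>The elements \<open>t\<^sup>i c\<close> with \<open>c \<notin> p\<close> form an m-system without \<open>0\<close>. A prime avoiding it lies in \<open>p\<close>,
  so it is \<open>p\<close> by minimality.\<close>

lemma minimal_prime_avoids_stabiliser:
  assumes p: "p \<in> minimal_primes R" and t: "t \<in> S" "conjugate t ` p = p"
  shows "t \<notin> p"
proof -
  have prime: "p \<in> prime_spectrum R" using p minimal_primes_prime by auto
  interpret p: ideal p R using prime by (rule prime_spectrumD)
  have stab: "conjugate (t [^] j) ` p = p" for j :: nat
  proof (induction j)
    case 0
    have "conjugate \<one> x = x" if "x \<in> p" for x using that by (intro conjugate_unique) auto
    then show ?case by (auto simp: image_iff)
  next
    case (Suc j)
    have "conjugate (t [^] Suc j) ` p = conjugate (t [^] j) ` conjugate t ` p"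
      unfolding image_image nat_pow_Suc using t(1)
      by (intro image_cong) (auto simp: conjugate_mult)
    then show ?case using Suc t(2) by simp
  qed
  define M where "M = {t [^] i \<otimes> c | (i::nat) c. c \<in> carrier R - p}"
  have 0: "\<zero> \<notin> M"
    using l_regular t(1) by (auto simp: M_def) (metis p.zero_mem pow_in_S)
  have M: "M \<subseteq> carrier R" using t(1) by (auto simp: M_def)
  have one: "\<one> \<notin> p" using p.one_imp_carrier prime_spectrumD(2)[OF prime] by auto
  \<comment> \<open>Exponent 1 and \<open>c = \<one>\<close>. A prime avoiding \<open>M\<close>
    therefore avoids \<open>t\<close>.\<close>
  then have tM: "t \<in> M" unfolding M_def
    using t(1) by (intro CollectI exI[of _ 1] exI[of _ "\<one>"]) (auto simp: one)
  have msys: "\<exists>r\<in>carrier R. a \<otimes> r \<otimes> b \<in> M" if ab: "a \<in> M" "b \<in> M" for a b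
  proof -
    obtain i c where a: "a = t [^] (i::nat) \<otimes> c" and c: "c \<in> carrier R" "c \<notin> p" using ab by (auto simp: M_def)
    obtain j d where b: "b = t [^] (j::nat) \<otimes> d" and d: "d \<in> carrier R" "d \<notin> p" using ab by (auto simp: M_def)
    define u where "u = t [^] j"
    have u: "u \<in> S" using t(1) by (simp add: u_def)
    obtain c' where c': "c' \<in> carrier R" "c \<otimes> u = u \<otimes> c'" using normal_rightE[OF u c(1)] .
    have "conjugate u c' = c" using conjugate_unique[of u c c'] u c c' by simp
    \<comment> \<open>If \<open>c'\<close> were in \<open>p\<close>, its conjugate \<open>c\<close>
      would lie in the image of \<open>p\<close>, which is \<open>p\<close> again by
      stability.\<close>
    then have "c' \<notin> p" using c stab[of j] by (auto simp: u_def)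
    then obtain r where r: "r \<in> carrier R" "c' \<otimes> r \<otimes> d \<notin> p"
      using prime_spectrumE[OF prime c'(1) d(1)] d(2) by auto
    \<comment> \<open>The element placed between \<open>a\<close> and \<open>b\<close> is
      \<open>conjugate u r\<close>, because \<open>conjugate u r \<otimes> u\<close> equals
      \<open>u \<otimes> r\<close>. Then \<open>u\<close> passes \<open>c\<close> as well, and the
      powers of \<open>t\<close> collect in front of
      \<open>c' \<otimes> r \<otimes> d\<close>.\<close>
    have "a \<otimes> conjugate u r \<otimes> b = t [^] i \<otimes> c \<otimes> (conjugate u r \<otimes> u) \<otimes> d"
      using a b c d r u t(1) by (simp add: m_assoc u_def)
    also have "\<dots> = t [^] i \<otimes> (c \<otimes> u) \<otimes> r \<otimes> d"
      using c d r u t(1) by (simp add: m_assoc conjugate_eq[symmetric])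
    also have "\<dots> = t [^] i \<otimes> u \<otimes> (c' \<otimes> r \<otimes> d)"
      using c' d r u t(1) by (simp add: m_assoc)
    also have "t [^] i \<otimes> u = t [^] (i + j)" using t(1) by (simp add: u_def nat_pow_mult)
    finally have "a \<otimes> conjugate u r \<otimes> b \<in> M" unfolding M_def using r c' d by blast
    then show ?thesis using r(1) u by auto
  qed
  have disj: "{\<zero>} \<inter> M = {}" and ne: "M \<noteq> {}" using 0 tM by auto
  obtain q where q: "q \<in> prime_spectrum R" "q \<inter> M = {}"
    using exists_prime_avoiding[OF M ne msys zeroideal disj] by metis
  have "q \<subseteq> p"
  proof
    fix x assume x: "x \<in> q"
    then have "x \<in> carrier R" using q prime_spectrumD ideal.Icarr by metis
    \<comment> \<open>With exponent 0, \<open>M\<close> contains the complement of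
      \<open>p\<close>.\<close>
    moreover have "x \<in> M" if "x \<notin> p"
      unfolding M_def using that \<open>x \<in> carrier R\<close> by (intro CollectI exI[of _ 0] exI[of _ x]) simp
    ultimately show "x \<in> p" using x q(2) by blast
  qed
  then have "q = p" using p q(1) by (auto simp: minimal_primes_def)
  then show ?thesis using q(2) tM by auto
qed

text \<open>Conjugation by \<open>s\<close> permutes the finitely many minimal primes, so some power of \<open>s\<close> stabilises \<open>p\<close>.\<close>

lemma minimal_prime_disjoint:
  assumes fin: "finite (minimal_primes R)" and p: "p \<in> minimal_primes R"
  shows "p \<inter> S = {}"
proof (rule ccontr)
  assume "p \<inter> S \<noteq> {}"
  then obtain s where s: "s \<in> p" "s \<in> S" by auto
  have prime: "p \<in> prime_spectrum R" using p minimal_primes_prime by auto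
  interpret p: ideal p R using prime by (rule prime_spectrumD)
  let ?f = "\<lambda>n::nat. conjugate (s [^] n) ` p"
  have "range ?f \<subseteq> minimal_primes R" using conjugate_minimal_prime[OF _ p] s by auto
  then have "\<not> inj ?f" using fin finite_imageD finite_subset infinite_UNIV_nat by metis
  then obtain j k where jk: "j < k" "?f j = ?f k"
    by (metis (no_types, lifting) injI linorder_neqE_nat)
  define m where "m = k - j"
  have k: "s [^] k = s [^] j \<otimes> s [^] m" using jk s by (simp add: m_def nat_pow_mult)
  have "?f k = conjugate (s [^] j) ` conjugate (s [^] m) ` p"
    unfolding k image_image using s by (intro image_cong) (auto simp: conjugate_mult)
  then have eq: "conjugate (s [^] j) ` p = conjugate (s [^] j) ` conjugate (s [^] m) ` p" using jk by simp
  have sub: "conjugate (s [^] m) ` p \<subseteq> carrier R" using s by auto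
  \<comment> \<open>Cancelling the injective map \<open>conjugate (s [^] j)\<close> from
    \<open>eq\<close> shows that \<open>s [^] m\<close> stabilises \<open>p\<close>.\<close>
  have "p = conjugate (s [^] m) ` p"
    using conjugate_image_subset[OF _ _ sub eq] conjugate_image_subset[OF _ sub _ eq[symmetric]] s p.a_subset
    by (intro subset_antisym) auto
  then have "s [^] m \<notin> p" using minimal_prime_avoids_stabiliser[OF p] s by auto
  \<comment> \<open>\<open>j < k\<close> makes \<open>m\<close> positive, so \<open>s [^] m\<close>
    has a factor \<open>s\<close> and lies in \<open>p\<close>.\<close>
  moreover obtain m' where "m = Suc m'" using jk unfolding m_def by (metis Suc_diff_Suc)
  then have "s [^] m \<in> p" using s p.I_l_closed[of s "s [^] m'"] by simp
  ultimately show False by simp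
qed

end

section \<open>The ring of fractions at a set of regular normal elements\<close>

context normal_regular_set
begin

abbreviation (input) "\<Q> \<equiv> frac_ring R S"

text \<open>Normality makes the Ore condition explicit: the multipliers are \<open>t\<close> and
  \<open>conjugate t s\<close>.\<close>

lemma common_denominator:
  assumes "s \<in> S" "t \<in> S"
  obtains a b where "a \<in> carrier R" "b \<in> carrier R" "a \<otimes> s \<in> S" "a \<otimes> s = b \<otimes> t"
proof (rule that)
  show "t \<otimes> s = conjugate t s \<otimes> t" using assms by (simp add: conjugate_eq)
qed (use assms in auto)

text \<open>The existential test in \<open>frac_rel\<close> may be carried out with any given pair
  of multipliers; all comparisons of fractions rest on this.\<close>

lemma frac_rel_iff:
  assumes st: "s \<in> S" "t \<in> S" and rq: "r \<in> carrier R" "q \<in> carrier R"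
    and ab: "a \<in> carrier R" "b \<in> carrier R" "a \<otimes> s \<in> S" "a \<otimes> s = b \<otimes> t"
  shows "((s, r), (t, q)) \<in> frac_rel R S \<longleftrightarrow> a \<otimes> r = b \<otimes> q"
proof
  assume "a \<otimes> r = b \<otimes> q"
  then show "((s, r), (t, q)) \<in> frac_rel R S"
    unfolding frac_rel_def using assms by blast
next
  assume "((s, r), (t, q)) \<in> frac_rel R S"
  then obtain x y where xy: "x \<in> carrier R" "y \<in> carrier R" "x \<otimes> s = y \<otimes> t" "x \<otimes> s \<in> S" "x \<otimes> r = y \<otimes> q"
    unfolding frac_rel_def by blast
  \<comment> \<open>The two common denominators are related by
    \<open>d \<otimes> (a \<otimes> s) = m \<otimes> d\<close>. Cancelling \<open>s\<close> and
    \<open>t\<close> on the right gives \<open>d \<otimes> a = m \<otimes> x\<close> and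
    \<open>d \<otimes> b = m \<otimes> y\<close>, which carry one equality of numerators to the
    other.\<close>
  define d where "d = x \<otimes> s"
  define m where "m = conjugate d (a \<otimes> s)"
  have d: "d \<in> S" using xy by (simp add: d_def)
  have m: "m \<in> carrier R" using d ab by (simp add: m_def)
  have dm: "d \<otimes> (a \<otimes> s) = m \<otimes> d" unfolding m_def using d ab by (intro conjugate_eq) auto
  have "(d \<otimes> a) \<otimes> s = (m \<otimes> x) \<otimes> s"
    using dm d st ab(1) m xy(1) by (simp add: m_assoc d_def)
  then have 1: "d \<otimes> a = m \<otimes> x" using S_r_cancel[OF st(1)] d ab(1) m xy(1) by simp
  have "d \<otimes> (b \<otimes> t) = m \<otimes> (y \<otimes> t)" using dm ab(4) xy(3) d_def by simp
  then have "(d \<otimes> b) \<otimes> t = (m \<otimes> y) \<otimes> t"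
    using d st ab(2) m xy(2) by (simp add: m_assoc)
  then have 2: "d \<otimes> b = m \<otimes> y" using S_r_cancel[OF st(2)] d ab(2) m xy(2) by simp
  have "d \<otimes> (a \<otimes> r) = m \<otimes> x \<otimes> r" using 1 d ab(1) rq by (simp add: m_assoc[symmetric])
  also have "\<dots> = m \<otimes> y \<otimes> q" using xy rq m by (simp add: m_assoc)
  also have "\<dots> = d \<otimes> (b \<otimes> q)" using 2 d ab(2) rq by (simp add: m_assoc[symmetric])
  finally show "a \<otimes> r = b \<otimes> q" using S_l_cancel[OF d] ab rq by simp
qed

lemma equiv_frac_rel: "equiv (S \<times> carrier R) (frac_rel R S)"
proof (rule equivI)
  show "frac_rel R S \<subseteq> (S \<times> carrier R) \<times> (S \<times> carrier R)" by (auto simp: frac_rel_def)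
  show "refl_on (S \<times> carrier R) (frac_rel R S)"
  proof (rule refl_onI)
    fix x assume "x \<in> S \<times> carrier R"
    then obtain s r where x: "x = (s, r)" and sr: "s \<in> S" "r \<in> carrier R" by auto
    show "(x, x) \<in> frac_rel R S" unfolding x using frac_rel_iff[OF sr(1) sr(1) sr(2) sr(2), of \<one> \<one>] sr by simp
  qed
  show "sym (frac_rel R S)"
  proof (rule symI)
    fix x y assume "(x, y) \<in> frac_rel R S"
    then obtain s r t q a b where "x = (s, r)" "y = (t, q)" "s \<in> S" "r \<in> carrier R" "t \<in> S" "q \<in> carrier R"
      "a \<in> carrier R" "b \<in> carrier R" "a \<otimes> s = b \<otimes> t" "a \<otimes> s \<in> S" "a \<otimes> r = b \<otimes> q"
      unfolding frac_rel_def by blast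
    then have "b \<otimes> t = a \<otimes> s" "b \<otimes> t \<in> S" "b \<otimes> q = a \<otimes> r" by simp_all
    then show "(y, x) \<in> frac_rel R S"
      unfolding frac_rel_def \<open>x = _\<close> \<open>y = _\<close> using \<open>s \<in> S\<close> \<open>t \<in> S\<close> \<open>r \<in> _\<close> \<open>q \<in> _\<close> \<open>a \<in> _\<close> \<open>b \<in> _\<close>
      by blast
  qed
  show "trans (frac_rel R S)"
  proof (rule transI)
    fix x y z assume h: "(x, y) \<in> frac_rel R S" "(y, z) \<in> frac_rel R S"
    obtain s r t q u w where xyz: "x = (s, r)" "y = (t, q)" "z = (u, w)" by (metis surj_pair)
    have c: "s \<in> S" "r \<in> carrier R" "t \<in> S" "q \<in> carrier R" "u \<in> S" "w \<in> carrier R"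
      using h by (auto simp: xyz frac_rel_def)
    obtain a b where ab: "a \<in> carrier R" "b \<in> carrier R" "a \<otimes> s \<in> S" "a \<otimes> s = b \<otimes> t"
      using common_denominator[OF c(1,3)] .
    \<comment> \<open>Extends the common denominator of the first two fractions to one for all
      three.\<close>
    obtain a' b' where ab': "a' \<in> carrier R" "b' \<in> carrier R" "a' \<otimes> (a \<otimes> s) \<in> S" "a' \<otimes> (a \<otimes> s) = b' \<otimes> u"
      using common_denominator[OF ab(3) c(5)] .
    have "a \<otimes> r = b \<otimes> q" using frac_rel_iff[OF c(1,3,2,4) ab] h(1) xyz by simp
    moreover have "a' \<otimes> b \<otimes> q = b' \<otimes> w"
    proof -
      have "a' \<otimes> b \<otimes> t = a' \<otimes> (a \<otimes> s)" using ab ab'(1) c by (simp add: m_assoc)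
      then have "a' \<otimes> b \<otimes> t \<in> S" "a' \<otimes> b \<otimes> t = b' \<otimes> u" using ab'(3,4) by simp_all
      then show ?thesis using frac_rel_iff[OF c(3,5,4,6) _ ab'(2)] h(2) xyz ab(2) ab'(1) by simp
    qed
    ultimately have "a' \<otimes> a \<otimes> r = b' \<otimes> w" using ab ab'(1) c by (simp add: m_assoc)
    moreover have "a' \<otimes> a \<otimes> s = a' \<otimes> (a \<otimes> s)" using ab ab'(1) c by (simp add: m_assoc)
    ultimately show "(x, z) \<in> frac_rel R S"
      using frac_rel_iff[OF c(1,5,2,6) _ ab'(2), of "a' \<otimes> a"] ab ab' xyz by simp
  qed
qed

lemma frac_eq_iff:
  assumes "s \<in> S" "t \<in> S" "r \<in> carrier R" "q \<in> carrier R"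
    and "a \<in> carrier R" "b \<in> carrier R" "a \<otimes> s \<in> S" "a \<otimes> s = b \<otimes> t"
  shows "frac R S s r = frac R S t q \<longleftrightarrow> a \<otimes> r = b \<otimes> q"
  unfolding frac_def using assms
  by (subst eq_equiv_class_iff[OF equiv_frac_rel]) (auto simp: frac_rel_iff[OF assms])

lemma frac_expand:
  assumes "s \<in> S" "r \<in> carrier R" "a \<in> carrier R" "a \<otimes> s \<in> S"
  shows "frac R S (a \<otimes> s) (a \<otimes> r) = frac R S s r"
  using frac_eq_iff[of "a \<otimes> s" s "a \<otimes> r" r \<one> a] assms by simp

lemma frac_eq_same_iff:
  assumes "s \<in> S" "r \<in> carrier R" "q \<in> carrier R"
  shows "frac R S s r = frac R S s q \<longleftrightarrow> r = q"
  using frac_eq_iff[of s s r q \<one> \<one>] assms by simp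

lemma frac_eq_common:
  assumes "frac R S s r = frac R S t q" "s \<in> S" "t \<in> S" "r \<in> carrier R" "q \<in> carrier R"
  obtains a b where "a \<in> carrier R" "b \<in> carrier R" "a \<otimes> s \<in> S" "a \<otimes> s = b \<otimes> t" "a \<otimes> r = b \<otimes> q"
  using common_denominator[OF assms(2,3)] frac_eq_iff[OF assms(2-5)] assms(1) by metis

lemma frac_ring_carrierE:
  assumes "x \<in> carrier \<Q>"
  obtains s r where "s \<in> S" "r \<in> carrier R" "x = frac R S s r"
  using assms by (auto simp: frac_ring_def)

lemma frac_closed [simp]:
  "s \<in> S \<Longrightarrow> r \<in> carrier R \<Longrightarrow> frac R S s r \<in> carrier \<Q>"
  by (auto simp: frac_ring_def)

text \<open>Fractions over one denominator are added by adding numerators, so the additive laws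
  reduce to those of \<open>R\<close>.\<close>

lemma frac_ring_carrierE2:
  assumes "x \<in> carrier \<Q>" "y \<in> carrier \<Q>"
  obtains s r q where "s \<in> S" "r \<in> carrier R" "q \<in> carrier R" "x = frac R S s r" "y = frac R S s q"
proof -
  obtain s r where x: "s \<in> S" "r \<in> carrier R" "x = frac R S s r" using frac_ring_carrierE[OF assms(1)] .
  obtain t q where y: "t \<in> S" "q \<in> carrier R" "y = frac R S t q" using frac_ring_carrierE[OF assms(2)] .
  obtain a b where ab: "a \<in> carrier R" "b \<in> carrier R" "a \<otimes> s \<in> S" "a \<otimes> s = b \<otimes> t"
    using common_denominator[OF x(1) y(1)] .
  have "x = frac R S (a \<otimes> s) (a \<otimes> r)" using frac_expand[of s r a] x ab(1-3) by simp
  moreover have "y = frac R S (a \<otimes> s) (b \<otimes> q)" using frac_expand[of t q b] y ab by simp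
  ultimately show thesis using that[of "a \<otimes> s" "a \<otimes> r" "b \<otimes> q"] x y ab by simp
qed

lemma frac_ring_carrierE3:
  assumes "x \<in> carrier \<Q>" "y \<in> carrier \<Q>" "z \<in> carrier \<Q>"
  obtains s r q w where "s \<in> S" "r \<in> carrier R" "q \<in> carrier R" "w \<in> carrier R"
    "x = frac R S s r" "y = frac R S s q" "z = frac R S s w"
proof -
  obtain s r q where xy: "s \<in> S" "r \<in> carrier R" "q \<in> carrier R" "x = frac R S s r" "y = frac R S s q"
    using frac_ring_carrierE2[OF assms(1,2)] .
  obtain t w where z: "t \<in> S" "w \<in> carrier R" "z = frac R S t w" using frac_ring_carrierE[OF assms(3)] .
  obtain a b where ab: "a \<in> carrier R" "b \<in> carrier R" "a \<otimes> s \<in> S" "a \<otimes> s = b \<otimes> t"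
    using common_denominator[OF xy(1) z(1)] .
  have "x = frac R S (a \<otimes> s) (a \<otimes> r)" "y = frac R S (a \<otimes> s) (a \<otimes> q)" using frac_expand[of s _ a] xy ab(1-3) by simp_all
  moreover have "z = frac R S (a \<otimes> s) (b \<otimes> w)" using frac_expand[of t w b] z ab by simp
  ultimately show thesis using that[of "a \<otimes> s" "a \<otimes> r" "a \<otimes> q" "b \<otimes> w"] xy z ab by simp
qed

lemma frac_add:
  assumes s: "s \<in> S" and rq: "r \<in> carrier R" "q \<in> carrier R"
  shows "frac R S s r \<oplus>\<^bsub>\<Q>\<^esub> frac R S s q = frac R S s (r \<oplus> q)"
proof -
  have "frac_add R S (frac R S s r) (frac R S s q) = frac R S s (r \<oplus> q)"
    unfolding frac_add_def
  proof (rule the_equality)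
    have "\<one> \<otimes> s = \<one> \<otimes> s \<and> \<one> \<otimes> s \<in> S \<and> frac R S s (r \<oplus> q) = frac R S (\<one> \<otimes> s) (\<one> \<otimes> r \<oplus> \<one> \<otimes> q)"
      using assms by simp
    then show "\<exists>s'\<in>S. \<exists>r'\<in>carrier R. \<exists>t\<in>S. \<exists>q'\<in>carrier R. \<exists>x\<in>carrier R. \<exists>y\<in>carrier R.
      frac R S s r = frac R S s' r' \<and> frac R S s q = frac R S t q' \<and> x \<otimes> s' = y \<otimes> t \<and> x \<otimes> s' \<in> S \<and>
      frac R S s (r \<oplus> q) = frac R S (x \<otimes> s') (x \<otimes> r' \<oplus> y \<otimes> q')"
      using assms by blast
  next
    fix C
    assume "\<exists>s'\<in>S. \<exists>r'\<in>carrier R. \<exists>t\<in>S. \<exists>q'\<in>carrier R. \<exists>x\<in>carrier R. \<exists>y\<in>carrier R.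
      frac R S s r = frac R S s' r' \<and> frac R S s q = frac R S t q' \<and> x \<otimes> s' = y \<otimes> t \<and> x \<otimes> s' \<in> S \<and>
      C = frac R S (x \<otimes> s') (x \<otimes> r' \<oplus> y \<otimes> q')"
    then obtain s' r' t q' x y where h: "s' \<in> S" "r' \<in> carrier R" "t \<in> S" "q' \<in> carrier R"
      "x \<in> carrier R" "y \<in> carrier R" "frac R S s r = frac R S s' r'" "frac R S s q = frac R S t q'"
      "x \<otimes> s' = y \<otimes> t" "x \<otimes> s' \<in> S" "C = frac R S (x \<otimes> s') (x \<otimes> r' \<oplus> y \<otimes> q')"
      by blast
    obtain a b where ab: "a \<in> carrier R" "b \<in> carrier R" "a \<otimes> s \<in> S" "a \<otimes> s = b \<otimes> (x \<otimes> s')"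
      using common_denominator[OF s h(10)] .
    have 1: "a \<otimes> s = (b \<otimes> x) \<otimes> s'" "a \<otimes> s = (b \<otimes> y) \<otimes> t"
      using ab h by (simp_all add: m_assoc)
    have "a \<otimes> r = (b \<otimes> x) \<otimes> r'"
      using frac_eq_iff[OF s h(1) rq(1) h(2) ab(1) _ ab(3) 1(1)] h ab by simp
    moreover have "a \<otimes> q = (b \<otimes> y) \<otimes> q'"
      using frac_eq_iff[OF s h(3) rq(2) h(4) ab(1) _ ab(3) 1(2)] h ab by simp
    ultimately have "a \<otimes> (r \<oplus> q) = b \<otimes> (x \<otimes> r' \<oplus> y \<otimes> q')"
      using ab(1,2) h(1-6) rq by (simp add: r_distr m_assoc)
    then show "C = frac R S s (r \<oplus> q)"
      unfolding h(11)
      using frac_eq_iff[OF s h(10) _ _ ab, of "r \<oplus> q" "x \<otimes> r' \<oplus> y \<otimes> q'"] h(1-6) rq by simp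
  qed
  then show ?thesis by (simp add: frac_ring_def)
qed

text \<open>Independence of all choices, which makes the description in \<open>frac_mult\<close>
  definite. Over a common denominator the claim is
  \<open>a \<otimes> (x \<otimes> q) = b \<otimes> (x' \<otimes> q')\<close>, whereas the hypotheses
  give the same equation with \<open>t\<close>, \<open>t'\<close> in place of \<open>q\<close>,
  \<open>q'\<close>.\<close>

lemma frac_mult_unique:
  assumes S: "s \<in> S" "s' \<in> S" "t \<in> S" "t' \<in> S" "u \<in> S" "u' \<in> S"
    and R: "r \<in> carrier R" "r' \<in> carrier R" "q \<in> carrier R" "q' \<in> carrier R" "x \<in> carrier R" "x' \<in> carrier R"
    and eq: "frac R S s r = frac R S s' r'" "frac R S t q = frac R S t' q'"
    and ux: "u \<otimes> r = x \<otimes> t" "u' \<otimes> r' = x' \<otimes> t'"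
  shows "frac R S (u \<otimes> s) (x \<otimes> q) = frac R S (u' \<otimes> s') (x' \<otimes> q')"
proof -
  obtain a b where ab: "a \<in> carrier R" "b \<in> carrier R" "a \<otimes> (u \<otimes> s) \<in> S" "a \<otimes> (u \<otimes> s) = b \<otimes> (u' \<otimes> s')"
    using common_denominator[of "u \<otimes> s" "u' \<otimes> s'"] S by auto
  have 1: "a \<otimes> u \<otimes> s \<in> S" "a \<otimes> u \<otimes> s = b \<otimes> u' \<otimes> s'"
    using ab S by (simp_all add: m_assoc)
  have "a \<otimes> u \<otimes> r = b \<otimes> u' \<otimes> r'"
    using frac_eq_iff[OF S(1,2) R(1,2) _ _ 1] ab S eq by simp
  then have axt: "a \<otimes> x \<otimes> t = b \<otimes> x' \<otimes> t'"
    using ab S R ux by (simp add: m_assoc)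
  \<comment> \<open>To exchange \<open>t\<close>, \<open>t'\<close> for \<open>q\<close>,
    \<open>q'\<close>, the equation is multiplied on the left by \<open>t'\<close>. As the second
    fractions agree, the same \<open>c\<close> satisfies
    \<open>t' \<otimes> t = c \<otimes> t'\<close> and
    \<open>t' \<otimes> q = c \<otimes> q'\<close>; the element \<open>m\<close> below carries
    \<open>t'\<close> past \<open>a \<otimes> x\<close> so that it can meet \<open>t\<close> or
    \<open>q\<close>.\<close>
  define c where "c = conjugate t' t"
  have c: "c \<in> carrier R" "t' \<otimes> t = c \<otimes> t'" using S conjugate_eq[of t' t] by (simp_all add: c_def)
  have tq: "t' \<otimes> q = c \<otimes> q'"
    using frac_eq_iff[OF S(3,4) R(3,4) _ c(1) _ c(2)] S eq by simp
  define m where "m = conjugate t' (a \<otimes> x)"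
  have m: "m \<in> carrier R" "t' \<otimes> (a \<otimes> x) = m \<otimes> t'"
    using S ab R conjugate_eq[of t' "a \<otimes> x"] by (simp_all add: m_def)
  have "m \<otimes> c \<otimes> t' = m \<otimes> t' \<otimes> t" using m(1) c S by (simp add: m_assoc)
  also have "\<dots> = t' \<otimes> (a \<otimes> x \<otimes> t)" unfolding m(2)[symmetric] using S ab R by (simp add: m_assoc)
  also have "\<dots> = t' \<otimes> (b \<otimes> x') \<otimes> t'" unfolding axt using S ab R by (simp add: m_assoc)
  finally have mc: "m \<otimes> c = t' \<otimes> (b \<otimes> x')" using S_r_cancel[OF S(4)] m c S ab R by simp
  have "t' \<otimes> (a \<otimes> (x \<otimes> q)) = (t' \<otimes> (a \<otimes> x)) \<otimes> q" using S ab R by (simp add: m_assoc)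
  also have "\<dots> = m \<otimes> (t' \<otimes> q)" unfolding m(2) using m(1) S R by (simp add: m_assoc)
  also have "\<dots> = m \<otimes> c \<otimes> q'" unfolding tq using m(1) c(1) R by (simp add: m_assoc)
  also have "\<dots> = t' \<otimes> (b \<otimes> (x' \<otimes> q'))" unfolding mc using S ab R by (simp add: m_assoc)
  finally have "a \<otimes> (x \<otimes> q) = b \<otimes> (x' \<otimes> q')" using S_l_cancel[OF S(4)] ab R by simp
  then show ?thesis using frac_eq_iff[OF _ _ _ _ ab] S R by simp
qed

lemma frac_mult:
  assumes st: "s \<in> S" "t \<in> S" "u \<in> S" and rq: "r \<in> carrier R" "q \<in> carrier R" "x \<in> carrier R"
    and ux: "u \<otimes> r = x \<otimes> t"
  shows "frac R S s r \<otimes>\<^bsub>\<Q>\<^esub> frac R S t q = frac R S (u \<otimes> s) (x \<otimes> q)"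
proof -
  have "frac_mult R S (frac R S s r) (frac R S t q) = frac R S (u \<otimes> s) (x \<otimes> q)"
    unfolding frac_mult_def
  proof (rule the_equality)
    show "\<exists>s'\<in>S. \<exists>r'\<in>carrier R. \<exists>t'\<in>S. \<exists>q'\<in>carrier R. \<exists>u'\<in>S. \<exists>x'\<in>carrier R.
      frac R S s r = frac R S s' r' \<and> frac R S t q = frac R S t' q' \<and> u' \<otimes> r' = x' \<otimes> t' \<and>
      frac R S (u \<otimes> s) (x \<otimes> q) = frac R S (u' \<otimes> s') (x' \<otimes> q')"
      using assms by blast
  next
    fix C
    assume "\<exists>s'\<in>S. \<exists>r'\<in>carrier R. \<exists>t'\<in>S. \<exists>q'\<in>carrier R. \<exists>u'\<in>S. \<exists>x'\<in>carrier R.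
      frac R S s r = frac R S s' r' \<and> frac R S t q = frac R S t' q' \<and> u' \<otimes> r' = x' \<otimes> t' \<and>
      C = frac R S (u' \<otimes> s') (x' \<otimes> q')"
    then obtain s' r' t' q' u' x' where h: "s' \<in> S" "r' \<in> carrier R" "t' \<in> S" "q' \<in> carrier R"
      "u' \<in> S" "x' \<in> carrier R" "frac R S s r = frac R S s' r'" "frac R S t q = frac R S t' q'"
      "u' \<otimes> r' = x' \<otimes> t'" "C = frac R S (u' \<otimes> s') (x' \<otimes> q')"
      by blast
    show "C = frac R S (u \<otimes> s) (x \<otimes> q)"
      unfolding h(10)
      by (rule frac_mult_unique[symmetric, OF st(1) h(1) st(2) h(3) st(3) h(5) rq(1) h(2) rq(2) h(4) rq(3) h(6,7,8) ux h(9)])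
  qed
  then show ?thesis by (simp add: frac_ring_def)
qed

lemma frac_mult_conjugate:
  assumes "s \<in> S" "t \<in> S" "r \<in> carrier R" "q \<in> carrier R"
  shows "frac R S s r \<otimes>\<^bsub>\<Q>\<^esub> frac R S t q = frac R S (t \<otimes> s) (conjugate t r \<otimes> q)"
  using assms by (intro frac_mult) (auto simp: conjugate_eq)

lemma frac_ring_zero: "s \<in> S \<Longrightarrow> \<zero>\<^bsub>\<Q>\<^esub> = frac R S s \<zero>"
  using frac_expand[of \<one> \<zero> s] by (simp add: frac_ring_def)

lemma frac_ring_one: "s \<in> S \<Longrightarrow> \<one>\<^bsub>\<Q>\<^esub> = frac R S s s"
  using frac_expand[of \<one> \<one> s] by (simp add: frac_ring_def)

lemma frac_eq_zero_iff:
  assumes "s \<in> S" "r \<in> carrier R"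
  shows "frac R S s r = \<zero>\<^bsub>\<Q>\<^esub> \<longleftrightarrow> r = \<zero>"
  using assms frac_eq_same_iff[of s r \<zero>] by (simp add: frac_ring_zero[of s])

lemma ring_frac_ring: "ring \<Q>" (is "ring ?Q")
proof (rule ringI)
  show "abelian_group ?Q"
  proof (rule abelian_groupI)
    fix x y assume xy: "x \<in> carrier ?Q" "y \<in> carrier ?Q"
    obtain s r q where 2: "s \<in> S" "r \<in> carrier R" "q \<in> carrier R" "x = frac R S s r" "y = frac R S s q"
      using frac_ring_carrierE2[OF xy] .
    then show "x \<oplus>\<^bsub>?Q\<^esub> y \<in> carrier ?Q" "x \<oplus>\<^bsub>?Q\<^esub> y = y \<oplus>\<^bsub>?Q\<^esub> x"
      by (simp_all add: frac_add a_comm)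
    fix z assume z: "z \<in> carrier ?Q"
    obtain s r q w where "s \<in> S" "r \<in> carrier R" "q \<in> carrier R" "w \<in> carrier R"
      "x = frac R S s r" "y = frac R S s q" "z = frac R S s w"
      using frac_ring_carrierE3[OF xy z] .
    then show "x \<oplus>\<^bsub>?Q\<^esub> y \<oplus>\<^bsub>?Q\<^esub> z = x \<oplus>\<^bsub>?Q\<^esub> (y \<oplus>\<^bsub>?Q\<^esub> z)"
      by (simp add: frac_add a_assoc)
  next
    show "\<zero>\<^bsub>?Q\<^esub> \<in> carrier ?Q" by (simp add: frac_ring_zero[OF one_in_S])
    fix x assume "x \<in> carrier ?Q"
    then obtain s r where x: "s \<in> S" "r \<in> carrier R" "x = frac R S s r" using frac_ring_carrierE by metis
    then show "\<zero>\<^bsub>?Q\<^esub> \<oplus>\<^bsub>?Q\<^esub> x = x" by (simp add: frac_ring_zero[of s] frac_add)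
    have "frac R S s (\<ominus> r) \<oplus>\<^bsub>?Q\<^esub> x = \<zero>\<^bsub>?Q\<^esub>"
      using x by (simp add: frac_ring_zero[of s] frac_add l_neg)
    then show "\<exists>y\<in>carrier ?Q. y \<oplus>\<^bsub>?Q\<^esub> x = \<zero>\<^bsub>?Q\<^esub>" using x by (intro bexI) auto
  qed
next
  show "Group.monoid ?Q"
  proof (rule monoidI)
    fix x y assume xy: "x \<in> carrier ?Q" "y \<in> carrier ?Q"
    obtain s r where x: "s \<in> S" "r \<in> carrier R" "x = frac R S s r" using frac_ring_carrierE[OF xy(1)] .
    obtain t q where y: "t \<in> S" "q \<in> carrier R" "y = frac R S t q" using frac_ring_carrierE[OF xy(2)] .
    show "x \<otimes>\<^bsub>?Q\<^esub> y \<in> carrier ?Q" using x y by (simp add: frac_mult_conjugate)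
    fix z assume z: "z \<in> carrier ?Q"
    obtain v w where z: "v \<in> S" "w \<in> carrier R" "z = frac R S v w" using frac_ring_carrierE[OF z] .
    \<comment> \<open>\<open>d\<close> takes \<open>q\<close> past the denominator \<open>v\<close>,
      and \<open>e\<close> takes \<open>r\<close> past \<open>v \<otimes> t\<close>. Both
      bracketings end with denominator \<open>v \<otimes> t \<otimes> s\<close> and numerator
      \<open>e \<otimes> d \<otimes> w\<close>.\<close>
    define d where "d = conjugate v q"
    define e where "e = conjugate (v \<otimes> t) r"
    have d: "d \<in> carrier R" "v \<otimes> q = d \<otimes> v" using y z conjugate_eq[of v q] by (simp_all add: d_def)
    have e: "e \<in> carrier R" "v \<otimes> t \<otimes> r = e \<otimes> (v \<otimes> t)"
      using x y z conjugate_eq[of "v \<otimes> t" r] by (simp_all add: e_def)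
    have yz: "y \<otimes>\<^bsub>?Q\<^esub> z = frac R S (v \<otimes> t) (d \<otimes> w)" unfolding y(3) z(3) using y z d by (intro frac_mult) auto
    have "x \<otimes>\<^bsub>?Q\<^esub> (y \<otimes>\<^bsub>?Q\<^esub> z) = frac R S (v \<otimes> t \<otimes> s) (e \<otimes> (d \<otimes> w))"
      unfolding yz x(3) using x y z d(1) e by (intro frac_mult) auto
    \<comment> \<open>The multiplier is \<open>v \<otimes> t\<close> in place of \<open>t\<close>,
      so that the numerator ends in \<open>v \<otimes> q\<close> and \<open>z\<close> can be
      multiplied in with multiplier \<open>\<one>\<close>.\<close>
    moreover have "x \<otimes>\<^bsub>?Q\<^esub> y = frac R S (v \<otimes> t \<otimes> s) (e \<otimes> v \<otimes> q)"
      unfolding x(3) y(3) using x y z e by (intro frac_mult) (auto simp: m_assoc)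
    moreover have "frac R S (v \<otimes> t \<otimes> s) (e \<otimes> v \<otimes> q) \<otimes>\<^bsub>?Q\<^esub> z = frac R S (\<one> \<otimes> (v \<otimes> t \<otimes> s)) (e \<otimes> d \<otimes> w)"
      unfolding z(3) using x y z d e(1) by (intro frac_mult) (auto simp: m_assoc)
    ultimately show "x \<otimes>\<^bsub>?Q\<^esub> y \<otimes>\<^bsub>?Q\<^esub> z = x \<otimes>\<^bsub>?Q\<^esub> (y \<otimes>\<^bsub>?Q\<^esub> z)"
      using x y z d(1) e(1) by (simp add: m_assoc)
  next
    show "\<one>\<^bsub>?Q\<^esub> \<in> carrier ?Q" by (simp add: frac_ring_one[OF one_in_S])
    fix x assume "x \<in> carrier ?Q"
    then obtain s r where x: "s \<in> S" "r \<in> carrier R" "x = frac R S s r" using frac_ring_carrierE by metis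
    have "frac R S s s \<otimes>\<^bsub>?Q\<^esub> frac R S s r = frac R S (\<one> \<otimes> s) (\<one> \<otimes> r)"
      using x by (intro frac_mult) auto
    then show "\<one>\<^bsub>?Q\<^esub> \<otimes>\<^bsub>?Q\<^esub> x = x" using x by (simp add: frac_ring_one[of s])
    have "frac R S s r \<otimes>\<^bsub>?Q\<^esub> frac R S \<one> \<one> = frac R S (\<one> \<otimes> s) (r \<otimes> \<one>)"
      using x by (intro frac_mult) auto
    then show "x \<otimes>\<^bsub>?Q\<^esub> \<one>\<^bsub>?Q\<^esub> = x" using x by (simp add: frac_ring_one[OF one_in_S])
  qed
next
  fix x y z assume xyz: "x \<in> carrier ?Q" "y \<in> carrier ?Q" "z \<in> carrier ?Q"
  obtain s r q where xy: "s \<in> S" "r \<in> carrier R" "q \<in> carrier R" "x = frac R S s r" "y = frac R S s q"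
    using frac_ring_carrierE2[OF xyz(1,2)] .
  obtain t w where z: "t \<in> S" "w \<in> carrier R" "z = frac R S t w" using frac_ring_carrierE[OF xyz(3)] .
  \<comment> \<open>Multiplication by \<open>z\<close> on the right conjugates the numerators of
    \<open>x\<close> and \<open>y\<close> by \<open>t\<close>; additivity of conjugation enters
    here.\<close>
  interpret c: ring_epi R R "conjugate t" by (rule conjugate_epi[OF z(1)])
  interpret c': ring_epi R R "conjugate s" by (rule conjugate_epi[OF xy(1)])
  show "(x \<oplus>\<^bsub>?Q\<^esub> y) \<otimes>\<^bsub>?Q\<^esub> z = x \<otimes>\<^bsub>?Q\<^esub> z \<oplus>\<^bsub>?Q\<^esub> y \<otimes>\<^bsub>?Q\<^esub> z"
    using xy z by (simp add: frac_add frac_mult_conjugate l_distr)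
  show "z \<otimes>\<^bsub>?Q\<^esub> (x \<oplus>\<^bsub>?Q\<^esub> y) = z \<otimes>\<^bsub>?Q\<^esub> x \<oplus>\<^bsub>?Q\<^esub> z \<otimes>\<^bsub>?Q\<^esub> y"
    using xy z by (simp add: frac_add frac_mult_conjugate r_distr)
qed

lemma ring_hom_frac_hom: "ring_hom_ring R \<Q> (frac_hom R S)"
proof (rule ring_hom_ringI[OF ring_axioms ring_frac_ring])
  fix x y assume xy: "x \<in> carrier R" "y \<in> carrier R"
  have "frac R S \<one> x \<otimes>\<^bsub>\<Q>\<^esub> frac R S \<one> y = frac R S (\<one> \<otimes> \<one>) (x \<otimes> y)"
    using xy by (intro frac_mult) auto
  then show "frac_hom R S (x \<otimes> y) = frac_hom R S x \<otimes>\<^bsub>\<Q>\<^esub> frac_hom R S y"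
    using xy by (simp add: frac_hom_def)
qed (auto simp: frac_hom_def frac_add frac_ring_one[OF one_in_S])

end

section \<open>Localized ideals and primes of the ring of fractions\<close>

context normal_regular_set
begin

text \<open>If the fraction also has a numerator \<open>i\<close> in \<open>I\<close> over some
  denominator \<open>t\<close>, then \<open>t \<otimes> r = c \<otimes> i\<close> lies in
  \<open>I\<close>, and saturation removes \<open>t\<close>.\<close>

lemma frac_mem_frac_ideal_iff:
  assumes I: "saturated I" and s: "s \<in> S" and r: "r \<in> carrier R"
  shows "frac R S s r \<in> frac_ideal R S I \<longleftrightarrow> r \<in> I"
proof
  interpret I: ideal I R by (rule saturatedD(1)[OF I])
  assume "frac R S s r \<in> frac_ideal R S I"
  then obtain t i where ti: "t \<in> S" "i \<in> I" "frac R S s r = frac R S t i" by (auto simp: frac_ideal_def)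
  define c where "c = conjugate t s"
  have c: "c \<in> carrier R" "t \<otimes> s = c \<otimes> t" using ti s conjugate_eq[of t s] by (simp_all add: c_def)
  have "t \<otimes> r = c \<otimes> i"
    using frac_eq_iff[OF s ti(1) r I.Icarr[OF ti(2)] _ c(1) _ c(2)] ti s by simp
  then have "t \<otimes> r \<in> I" using I.I_l_closed[OF ti(2) c(1)] by simp
  then show "r \<in> I" using saturatedD(2)[OF I ti(1) r] by simp
qed (use s in \<open>auto simp: frac_ideal_def\<close>)

text \<open>\<open>conjugate s i \<otimes> s\<close> equals \<open>s \<otimes> i\<close>, which lies
  in \<open>I\<close>, and saturation strips the right factor. This is what makes localized ideals
  closed under right multiplication.\<close>

lemma saturated_conjugate:
  assumes I: "saturated I" and s: "s \<in> S" and i: "i \<in> I"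
  shows "conjugate s i \<in> I"
proof (rule saturatedD(3)[OF I s])
  interpret I: ideal I R by (rule saturatedD(1)[OF I])
  have ic: "i \<in> carrier R" using i by (rule I.Icarr)
  then show "conjugate s i \<in> carrier R" using s by simp
  show "conjugate s i \<otimes> s \<in> I"
    unfolding conjugate_eq[OF s ic, symmetric] using I.I_l_closed[OF i] s by simp
qed

lemma frac_ideal_subset_carrier:
  "I \<subseteq> carrier R \<Longrightarrow> frac_ideal R S I \<subseteq> carrier \<Q>"
  by (auto simp: frac_ideal_def)

lemma saturated_subset_carrier: "saturated I \<Longrightarrow> I \<subseteq> carrier R"
  by (rule subsetI) (rule ideal.Icarr[OF saturatedD(1)])

lemma ideal_frac_ideal:
  assumes I: "saturated I"
  shows "ideal (frac_ideal R S I) \<Q>"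
proof -
  interpret I: ideal I R by (rule saturatedD(1)[OF I])
  interpret Q: ring \<Q> by (rule ring_frac_ring)
  note mem = frac_mem_frac_ideal_iff[OF I]
  note sub = frac_ideal_subset_carrier[OF I.a_subset]
  show ?thesis
  proof (rule Q.ideal_intro[OF sub])
    show "\<zero>\<^bsub>\<Q>\<^esub> \<in> frac_ideal R S I" by (simp add: frac_ring_zero[OF one_in_S] mem)
  next
    fix x y assume xy: "x \<in> frac_ideal R S I" "y \<in> frac_ideal R S I"
    then obtain s r q where "s \<in> S" "r \<in> carrier R" "q \<in> carrier R" "x = frac R S s r" "y = frac R S s q"
      using frac_ring_carrierE2[of x y] sub by blast
    then show "x \<oplus>\<^bsub>\<Q>\<^esub> y \<in> frac_ideal R S I" using xy by (simp add: frac_add mem)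
  next
    fix x y assume x: "x \<in> frac_ideal R S I" and y: "y \<in> carrier \<Q>"
    obtain s i where i: "s \<in> S" "i \<in> I" "x = frac R S s i" using x by (auto simp: frac_ideal_def)
    obtain t q where q: "t \<in> S" "q \<in> carrier R" "y = frac R S t q" using frac_ring_carrierE[OF y] .
    have "conjugate s q \<otimes> i \<in> I" using i q by (simp add: I.I_l_closed)
    then show "y \<otimes>\<^bsub>\<Q>\<^esub> x \<in> frac_ideal R S I"
      using i q I.Icarr by (simp add: frac_mult_conjugate mem)
    have "conjugate t i \<in> I" using saturated_conjugate[OF I q(1) i(2)] .
    then have "conjugate t i \<otimes> q \<in> I" using q by (simp add: I.I_r_closed)
    then show "x \<otimes>\<^bsub>\<Q>\<^esub> y \<in> frac_ideal R S I"
      using i q I.Icarr by (simp add: frac_mult_conjugate mem)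
  qed
qed

lemma frac_ideal_subset_iff:
  assumes "saturated I" "saturated J"
  shows "frac_ideal R S I \<subseteq> frac_ideal R S J \<longleftrightarrow> I \<subseteq> J"
proof
  assume *: "frac_ideal R S I \<subseteq> frac_ideal R S J"
  show "I \<subseteq> J"
  proof
    fix x assume x: "x \<in> I"
    then have xR: "x \<in> carrier R" using saturated_subset_carrier[OF assms(1)] by auto
    show "x \<in> J"
      using x * frac_mem_frac_ideal_iff[OF assms(1) one_in_S xR] frac_mem_frac_ideal_iff[OF assms(2) one_in_S xR]
      by auto
  qed
next
  assume "I \<subseteq> J"
  then show "frac_ideal R S I \<subseteq> frac_ideal R S J" unfolding frac_ideal_def by blast
qed

text \<open>For a fixed representative, membership in every localized ideal is membership of one
  numerator in every ideal, so infinite families cause no difficulty with denominators.\<close>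

lemma frac_ideal_Inter:
  assumes "\<And>I. I \<in> A \<Longrightarrow> saturated I"
  shows "frac_ideal R S (carrier R \<inter> \<Inter>A) = carrier \<Q> \<inter> \<Inter>(frac_ideal R S ` A)"
proof -
  have "x \<in> frac_ideal R S (carrier R \<inter> \<Inter>A) \<longleftrightarrow> x \<in> \<Inter>(frac_ideal R S ` A)"
    if x: "x \<in> carrier \<Q>" for x
  proof -
    obtain s r where sr: "s \<in> S" "r \<in> carrier R" "x = frac R S s r" using frac_ring_carrierE[OF x] .
    have "x \<in> frac_ideal R S (carrier R \<inter> \<Inter>A) \<longleftrightarrow> r \<in> \<Inter>A"
      using frac_mem_frac_ideal_iff[OF saturated_Inter[OF assms] sr(1,2)] sr by simp
    also have "\<dots> \<longleftrightarrow> (\<forall>I\<in>A. x \<in> frac_ideal R S I)"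
      using frac_mem_frac_ideal_iff[OF assms sr(1,2)] sr(3) by simp
    finally show ?thesis by simp
  qed
  moreover have "frac_ideal R S (carrier R \<inter> \<Inter>A) \<subseteq> carrier \<Q>"
    by (rule frac_ideal_subset_carrier) auto
  ultimately show ?thesis by blast
qed

lemma prime_frac_ideal:
  assumes I: "saturated I" and prime: "I \<in> prime_spectrum R"
  shows "frac_ideal R S I \<in> prime_spectrum \<Q>"
proof -
  interpret I: ideal I R by (rule saturatedD(1)[OF I])
  interpret Q: ring \<Q> by (rule ring_frac_ring)
  note mem = frac_mem_frac_ideal_iff[OF I]
  have "\<one> \<notin> I" using prime_spectrumD(2)[OF prime] I.one_imp_carrier by blast
  then have "frac R S \<one> \<one> \<notin> frac_ideal R S I" by (simp add: mem)
  then have "frac_ideal R S I \<noteq> carrier \<Q>" using frac_closed[OF one_in_S one_closed] by metis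
  moreover have "x \<in> frac_ideal R S I \<or> y \<in> frac_ideal R S I"
    if xy: "x \<in> carrier \<Q>" "y \<in> carrier \<Q>"
      and h: "\<forall>z\<in>carrier \<Q>. x \<otimes>\<^bsub>\<Q>\<^esub> z \<otimes>\<^bsub>\<Q>\<^esub> y \<in> frac_ideal R S I" for x y
  proof -
    obtain s a where x: "s \<in> S" "a \<in> carrier R" "x = frac R S s a" using frac_ring_carrierE[OF xy(1)] .
    obtain t b where y: "t \<in> S" "b \<in> carrier R" "y = frac R S t b" using frac_ring_carrierE[OF xy(2)] .
    have "a \<otimes> r \<otimes> b \<in> I" if r: "r \<in> carrier R" for r
    proof -
      \<comment> \<open>The test element has numerator \<open>r \<otimes> t\<close>: its
        \<open>t\<close> cancels the denominator of \<open>y\<close>, and the triple product has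
        numerator \<open>a \<otimes> r \<otimes> b\<close>.\<close>
      have "x \<otimes>\<^bsub>\<Q>\<^esub> frac R S \<one> (r \<otimes> t) = frac R S (\<one> \<otimes> s) (a \<otimes> (r \<otimes> t))"
        unfolding x(3) using x y r by (intro frac_mult) auto
      moreover have "frac R S (\<one> \<otimes> s) (a \<otimes> (r \<otimes> t)) \<otimes>\<^bsub>\<Q>\<^esub> y = frac R S (\<one> \<otimes> (\<one> \<otimes> s)) (a \<otimes> r \<otimes> b)"
        unfolding y(3) using x y r by (intro frac_mult) (auto simp: m_assoc)
      ultimately have "frac R S (\<one> \<otimes> (\<one> \<otimes> s)) (a \<otimes> r \<otimes> b) \<in> frac_ideal R S I"
        using h y(1) r frac_closed[OF one_in_S, of "r \<otimes> t"] by (metis S_closed m_closed)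
      then show ?thesis using mem x y r by simp
    qed
    then have "a \<in> I \<or> b \<in> I" using prime_spectrumE[OF prime x(2) y(2)] by blast
    then show ?thesis using x y by (simp add: mem)
  qed
  ultimately show ?thesis
    unfolding Q.prime_spectrum_iff using ideal_frac_ideal[OF I] by blast
qed

text \<open>Powers of a saturated ideal are not known to be saturated, so invariance is checked on
  the generating products: conjugation is multiplicative and preserves each factor.\<close>

lemma ideal_power_conjugate:
  assumes I: "saturated I" and s: "s \<in> S" and x: "x \<in> ideal_power R I n"
  shows "conjugate s x \<in> ideal_power R I n"
  using x
proof (induction n arbitrary: x)
  case 0
  then show ?case using s by simp
next
  case (Suc n)
  interpret c: ring_epi R R "conjugate s" by (rule conjugate_epi[OF s])
  note ids = ideal_power_ideal[OF saturatedD(1)[OF I], of n] saturatedD(1)[OF I]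
  have "x \<in> ideal_power R I n \<cdot> I" using Suc.prems by simp
  then have "conjugate s x \<in> ideal_power R I n \<cdot> I"
  proof (induction rule: ideal_prod.induct)
    case (prod i j)
    then have "conjugate s i \<otimes> conjugate s j \<in> ideal_power R I n \<cdot> I"
      using Suc.IH saturated_conjugate[OF I s] by (intro ideal_prod.prod)
    then show ?case using prod ids ideal.Icarr by (metis c.hom_mult)
  next
    case (sum x y)
    then have "x \<in> carrier R" "y \<in> carrier R" using ideal_prod_in_carrier[OF ids] by auto
    then show ?case using sum by (simp add: ideal_prod.sum)
  qed
  then show ?case by simp
qed

text \<open>This inclusion suffices to transport nilpotency. Products of fractions are controlled by
  the invariance of powers under conjugation, sums by a common denominator.\<close>

lemma ideal_power_frac_ideal:
  assumes I: "saturated I"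
  shows "ideal_power \<Q> (frac_ideal R S I) n \<subseteq> frac_ideal R S (ideal_power R I n)"
proof (induction n)
  case 0
  show ?case by (auto simp: frac_ideal_def frac_ring_def)
next
  case (Suc n)
  note ids = ideal_power_ideal[OF saturatedD(1)[OF I], of n] saturatedD(1)[OF I]
  interpret P: ideal "ideal_power R I n \<cdot> I" R by (rule ideal_prod_is_ideal[OF ids])
  have "x \<in> frac_ideal R S (ideal_power R I n \<cdot> I)"
    if "x \<in> ideal_power \<Q> (frac_ideal R S I) n \<cdot>\<^bsub>\<Q>\<^esub> frac_ideal R S I" for x
    using that
  proof (induction rule: ideal_prod.induct)
    case (prod x y)
    then obtain s i t j where x: "s \<in> S" "i \<in> ideal_power R I n" "x = frac R S s i"
      and y: "t \<in> S" "j \<in> I" "y = frac R S t j"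
      using Suc.IH unfolding frac_ideal_def by blast
    have ij: "i \<in> carrier R" "j \<in> carrier R" using x y ids ideal.Icarr by metis+
    have "conjugate t i \<otimes> j \<in> ideal_power R I n \<cdot> I"
      using ideal_power_conjugate[OF I y(1) x(2)] y(2) by (rule ideal_prod.prod)
    moreover have "x \<otimes>\<^bsub>\<Q>\<^esub> y = frac R S (t \<otimes> s) (conjugate t i \<otimes> j)"
      using x y ij by (simp add: frac_mult_conjugate)
    ultimately show ?case using mult_in_S[OF y(1) x(1)] unfolding frac_ideal_def by blast
  next
    case (sum x y)
    obtain s i t j where x: "s \<in> S" "i \<in> ideal_power R I n \<cdot> I" "x = frac R S s i"
      and y: "t \<in> S" "j \<in> ideal_power R I n \<cdot> I" "y = frac R S t j"
      using sum.IH unfolding frac_ideal_def by blast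
    obtain a b where ab: "a \<in> carrier R" "b \<in> carrier R" "a \<otimes> s \<in> S" "a \<otimes> s = b \<otimes> t"
      using common_denominator[OF x(1) y(1)] .
    have "x = frac R S (a \<otimes> s) (a \<otimes> i)" using frac_expand[of s i a] x ab(1-3) P.Icarr by simp
    moreover have "y = frac R S (a \<otimes> s) (b \<otimes> j)" using frac_expand[of t j b] y ab P.Icarr by simp
    ultimately have "x \<oplus>\<^bsub>\<Q>\<^esub> y = frac R S (a \<otimes> s) (a \<otimes> i \<oplus> b \<otimes> j)"
      using x y ab(1-3) P.Icarr by (simp add: frac_add)
    moreover have "a \<otimes> i \<oplus> b \<otimes> j \<in> ideal_power R I n \<cdot> I"
      using x y ab P.I_l_closed by simp
    ultimately show ?case using ab(3) unfolding frac_ideal_def by blast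
  qed
  then show ?case by auto
qed

lemma frac_ideal_zero: "frac_ideal R S {\<zero>} = {\<zero>\<^bsub>\<Q>\<^esub>}"
proof -
  have "frac_ideal R S {\<zero>} = (\<lambda>s. frac R S s \<zero>) ` S" unfolding frac_ideal_def by blast
  also have "\<dots> = (\<lambda>s. \<zero>\<^bsub>\<Q>\<^esub>) ` S"
    by (rule image_cong[OF refl]) (rule frac_ring_zero[symmetric])
  finally show ?thesis using one_in_S by blast
qed

text \<open>The \<open>n\<close>-th power of the localized ideal lies in the localization of zero,
  which is zero; a prime containing a power of an ideal contains the ideal.\<close>

lemma frac_ideal_nilpotent_subset_prime:
  assumes I: "saturated I" "ideal_power R I n = {\<zero>}" and P: "P \<in> prime_spectrum \<Q>"
  shows "frac_ideal R S I \<subseteq> P"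
proof -
  interpret Q: ring \<Q> by (rule ring_frac_ring)
  have "ideal_power \<Q> (frac_ideal R S I) n \<subseteq> P"
    using ideal_power_frac_ideal[OF I(1), of n] ideal.zero_mem[OF prime_spectrumD(1)[OF P]]
    unfolding I(2) frac_ideal_zero by auto
  then show ?thesis by (rule Q.ideal_power_subset_prime[OF P ideal_frac_ideal[OF I(1)]])
qed

end

section \<open>Rings of fractions of a ring with finitely many minimal primes\<close>

locale normal_regular_set_finite = normal_regular_set +
  assumes finite_minimal_primes: "finite (minimal_primes R)"
begin

lemma saturated_minimal_prime:
  "p \<in> minimal_primes R \<Longrightarrow> saturated p"
  by (rule saturated_prime[OF minimal_primes_prime minimal_prime_disjoint[OF finite_minimal_primes]])

lemma saturated_prime_radical: "saturated (prime_radical R)"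
  unfolding prime_radical_minimal_primes by (rule saturated_Inter) (rule saturated_minimal_prime)

lemma frac_ideal_prime_radical:
  "frac_ideal R S (prime_radical R) = carrier \<Q> \<inter> \<Inter>(frac_ideal R S ` minimal_primes R)"
  unfolding prime_radical_minimal_primes by (rule frac_ideal_Inter) (rule saturated_minimal_prime)

lemma prime_radical_frac_ring_subset:
  "prime_radical \<Q> \<subseteq> frac_ideal R S (prime_radical R)"
proof -
  have "frac_ideal R S p \<in> prime_spectrum \<Q>" if "p \<in> minimal_primes R" for p
    using prime_frac_ideal[OF saturated_minimal_prime[OF that] minimal_primes_prime[OF that]] .
  then show ?thesis unfolding frac_ideal_prime_radical prime_radical_def[of \<Q>] by blast
qed

lemma inj_on_frac_ideal: "inj_on (frac_ideal R S) (minimal_primes R)"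
proof (rule inj_onI)
  fix p q assume pq: "p \<in> minimal_primes R" "q \<in> minimal_primes R" "frac_ideal R S p = frac_ideal R S q"
  then show "p = q"
    using frac_ideal_subset_iff[OF saturated_minimal_prime[OF pq(1)] saturated_minimal_prime[OF pq(2)]]
      minimal_primes_incomparable by auto
qed

lemma
  assumes nil: "ideal_power R (prime_radical R) n = {\<zero>}"
  shows minimal_primes_frac_ring: "minimal_primes \<Q> = frac_ideal R S ` minimal_primes R"
    and prime_radical_frac_ring: "prime_radical \<Q> = frac_ideal R S (prime_radical R)"
proof -
  interpret Q: ring \<Q> by (rule ring_frac_ring)
  show min: "minimal_primes \<Q> = frac_ideal R S ` minimal_primes R"
  proof (rule Q.minimal_primes_eqI)
    show "finite (frac_ideal R S ` minimal_primes R)" using finite_minimal_primes by simp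
    show "frac_ideal R S ` minimal_primes R \<subseteq> prime_spectrum \<Q>"
      using prime_frac_ideal saturated_minimal_prime minimal_primes_prime by blast
  next
    fix P Q assume "P \<in> frac_ideal R S ` minimal_primes R" "Q \<in> frac_ideal R S ` minimal_primes R" and PQ: "P \<subseteq> Q"
    then obtain p q where p: "p \<in> minimal_primes R" "P = frac_ideal R S p"
      and q: "q \<in> minimal_primes R" "Q = frac_ideal R S q" by auto
    have "p \<subseteq> q" using PQ frac_ideal_subset_iff[OF saturated_minimal_prime[OF p(1)] saturated_minimal_prime[OF q(1)]] p q by simp
    then show "P = Q" using minimal_primes_incomparable[OF p(1) q(1)] p q by simp
  next
    \<comment> \<open>Nilpotency is used here: an arbitrary prime contains the localized radical,
      which is the intersection of the localized minimal primes.\<close>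
    fix P assume "P \<in> prime_spectrum \<Q>"
    then show "carrier \<Q> \<inter> \<Inter>(frac_ideal R S ` minimal_primes R) \<subseteq> P"
      using frac_ideal_nilpotent_subset_prime[OF saturated_prime_radical nil] unfolding frac_ideal_prime_radical by simp
  qed
  show "prime_radical \<Q> = frac_ideal R S (prime_radical R)"
    unfolding Q.prime_radical_minimal_primes min frac_ideal_prime_radical ..
qed

end

text \<open>With no primes at all the prime radical would be the whole carrier, so one has to be
  produced. The m-system \<open>{\<one>}\<close> and the zero ideal provide it, as
  \<open>\<zero>\<close> is not in \<open>S\<close>.\<close>

lemma (in normal_regular_set_finite) prime_radical_disjoint: "prime_radical R \<inter> S = {}"
proof -
  have "\<one> \<noteq> \<zero>" using one_in_S zero_notin by metis
  then obtain P where "P \<in> prime_spectrum R"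
    using exists_prime_avoiding[of "{\<one>}" "{\<zero>}"] zeroideal by auto
  moreover from this have "{\<zero>} \<subseteq> P" using ideal.zero_mem prime_spectrumD(1) by blast
  ultimately obtain p where "p \<in> minimal_primes R"
    using exists_minimal_prime_below minimal_primes_eq_over_zero by metis
  then show ?thesis
    using minimal_prime_disjoint[OF finite_minimal_primes] unfolding prime_radical_minimal_primes by blast
qed

section \<open>Images of normal sets and induced maps of rings of fractions\<close>

text \<open>Regularity in the image is phrased through elements of \<open>R\<close>, the form in
  which saturation of the kernel supplies it; normality carries over because \<open>h\<close> is
  onto.\<close>

lemma normal_regular_set_image:
  assumes S: "normal_submonoid R S" and h: "ring_epi R T h"
    and nz: "\<And>s. s \<in> S \<Longrightarrow> h s \<noteq> \<zero>\<^bsub>T\<^esub>"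
    and l: "\<And>s r. s \<in> S \<Longrightarrow> r \<in> carrier R \<Longrightarrow> h (s \<otimes>\<^bsub>R\<^esub> r) = \<zero>\<^bsub>T\<^esub> \<Longrightarrow> h r = \<zero>\<^bsub>T\<^esub>"
    and r: "\<And>s r. s \<in> S \<Longrightarrow> r \<in> carrier R \<Longrightarrow> h (r \<otimes>\<^bsub>R\<^esub> s) = \<zero>\<^bsub>T\<^esub> \<Longrightarrow> h r = \<zero>\<^bsub>T\<^esub>"
  shows "normal_regular_set T (h ` S)"
proof -
  interpret normal_submonoid R S by fact
  interpret h: ring_epi R T h by fact
  have "submonoid (h ` S) T"
  proof
    show "h ` S \<subseteq> carrier T" by auto
    show "\<one>\<^bsub>T\<^esub> \<in> h ` S" using one_in_S h.hom_one by (metis imageI)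
    fix x y assume "x \<in> h ` S" "y \<in> h ` S"
    then obtain s t where "s \<in> S" "t \<in> S" "x = h s" "y = h t" by auto
    then show "x \<otimes>\<^bsub>T\<^esub> y \<in> h ` S" by (intro image_eqI[of _ _ "s \<otimes>\<^bsub>R\<^esub> t"]) auto
  qed
  moreover have "normal_element T x" if x: "x \<in> h ` S" for x
  proof -
    obtain s where s: "s \<in> S" "x = h s" using x by auto
    have "\<exists>q'\<in>carrier T. x \<otimes>\<^bsub>T\<^esub> q = q' \<otimes>\<^bsub>T\<^esub> x" "\<exists>q'\<in>carrier T. q \<otimes>\<^bsub>T\<^esub> x = x \<otimes>\<^bsub>T\<^esub> q'"
      if q: "q \<in> carrier T" for q
    proof -
      obtain r where r: "r \<in> carrier R" "q = h r" using h.surj q by auto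
      obtain a where a: "a \<in> carrier R" "s \<otimes>\<^bsub>R\<^esub> r = a \<otimes>\<^bsub>R\<^esub> s" using normal_leftE[OF s(1) r(1)] .
      have "h s \<otimes>\<^bsub>T\<^esub> h r = h a \<otimes>\<^bsub>T\<^esub> h s" using a r s by (simp add: h.hom_mult[symmetric] del: h.hom_mult)
      then show "\<exists>q'\<in>carrier T. x \<otimes>\<^bsub>T\<^esub> q = q' \<otimes>\<^bsub>T\<^esub> x" using a(1) r(2) s(2) h.hom_closed by blast
      obtain b where b: "b \<in> carrier R" "r \<otimes>\<^bsub>R\<^esub> s = s \<otimes>\<^bsub>R\<^esub> b" using normal_rightE[OF s(1) r(1)] .
      have "h r \<otimes>\<^bsub>T\<^esub> h s = h s \<otimes>\<^bsub>T\<^esub> h b" using b r s by (simp add: h.hom_mult[symmetric] del: h.hom_mult)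
      then show "\<exists>q'\<in>carrier T. q \<otimes>\<^bsub>T\<^esub> x = x \<otimes>\<^bsub>T\<^esub> q'" using b(1) r(2) s(2) h.hom_closed by blast
    qed
    then show ?thesis
      unfolding normal_element_def r_coset_def l_coset_def using s by auto
  qed
  moreover have "\<zero>\<^bsub>T\<^esub> \<notin> h ` S" using nz by force
  moreover have "q = \<zero>\<^bsub>T\<^esub>" if xq: "x \<in> h ` S" "q \<in> carrier T" and "x \<otimes>\<^bsub>T\<^esub> q = \<zero>\<^bsub>T\<^esub> \<or> q \<otimes>\<^bsub>T\<^esub> x = \<zero>\<^bsub>T\<^esub>" for x q
  proof -
    obtain s where s: "s \<in> S" "x = h s" using xq by auto
    obtain r' where r': "r' \<in> carrier R" "q = h r'" using h.surj xq by auto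
    have "h (s \<otimes>\<^bsub>R\<^esub> r') = \<zero>\<^bsub>T\<^esub> \<or> h (r' \<otimes>\<^bsub>R\<^esub> s) = \<zero>\<^bsub>T\<^esub>" using that(3) s r' by simp
    then show ?thesis using l[OF s(1) r'(1)] r[OF s(1) r'(1)] r' by auto
  qed
  ultimately show ?thesis
    using h.S.ring_axioms
    by (intro normal_regular_set.intro normal_submonoid.intro normal_submonoid_axioms.intro
        normal_regular_set_axioms.intro) blast+
qed

lemma (in normal_submonoid) normal_regular_set_quotient:
  assumes I: "saturated I" "I \<inter> S = {}"
  shows "normal_regular_set (R Quot I) ((+>) I ` S)"
proof -
  interpret I: ideal I R by (rule saturatedD(1)[OF I(1)])
  show ?thesis
  proof (rule normal_regular_set_image[OF normal_submonoid_axioms I.ring_epi_coset])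
    show "I +> s \<noteq> \<zero>\<^bsub>R Quot I\<^esub>" if "s \<in> S" for s
      using I.coset_eq_zero_iff[of s] that I(2) by auto
    show "I +> r = \<zero>\<^bsub>R Quot I\<^esub>" if "s \<in> S" "r \<in> carrier R" "I +> (s \<otimes> r) = \<zero>\<^bsub>R Quot I\<^esub>" for s r
      using that(3) I.coset_eq_zero_iff[OF that(2)] I.coset_eq_zero_iff[of "s \<otimes> r"] saturatedD(2)[OF I(1) that(1,2)] that(1,2)
      by simp
    show "I +> r = \<zero>\<^bsub>R Quot I\<^esub>" if "s \<in> S" "r \<in> carrier R" "I +> (r \<otimes> s) = \<zero>\<^bsub>R Quot I\<^esub>" for s r
      using that(3) I.coset_eq_zero_iff[OF that(2)] I.coset_eq_zero_iff[of "r \<otimes> s"] saturatedD(3)[OF I(1) that(1,2)] that(1,2)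
      by simp
  qed
qed

locale frac_epi = R: normal_regular_set R S + T: normal_regular_set T S' + h: ring_epi R T h
  for R S T S' h +
  assumes image_S: "h ` S = S'"
begin

lemma h_S: "s \<in> S \<Longrightarrow> h s \<in> S'"
  using image_S by auto

text \<open>Applying \<open>h\<close> to multipliers that witness the equality of two fractions
  gives witnesses for their images, so the value is independent of the representative.\<close>

lemma frac_map_frac:
  assumes "s \<in> S" "r \<in> carrier R"
  shows "frac_map R S T S' h (frac R S s r) = frac T S' (h s) (h r)"
proof -
  have eq: "frac T S' (h s') (h r') = frac T S' (h s) (h r)"
    if h: "s' \<in> S" "r' \<in> carrier R" "frac R S s' r' = frac R S s r" for s' r'
  proof -
    obtain a b where ab: "a \<in> carrier R" "b \<in> carrier R" "a \<otimes>\<^bsub>R\<^esub> s' \<in> S" "a \<otimes>\<^bsub>R\<^esub> s' = b \<otimes>\<^bsub>R\<^esub> s" "a \<otimes>\<^bsub>R\<^esub> r' = b \<otimes>\<^bsub>R\<^esub> r"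
      using R.frac_eq_common[OF h(3,1) assms(1) h(2) assms(2)] .
    have "h (a \<otimes>\<^bsub>R\<^esub> s') = h a \<otimes>\<^bsub>T\<^esub> h s'" using ab(1) h(1) by simp
    then have 1: "h a \<otimes>\<^bsub>T\<^esub> h s' \<in> S'" using h_S[OF ab(3)] by metis
    have 2: "h a \<otimes>\<^bsub>T\<^esub> h s' = h b \<otimes>\<^bsub>T\<^esub> h s" using arg_cong[OF ab(4), of h] ab(1,2) h(1) assms(1) by simp
    have 3: "h a \<otimes>\<^bsub>T\<^esub> h r' = h b \<otimes>\<^bsub>T\<^esub> h r" using arg_cong[OF ab(5), of h] ab(1,2) h(2) assms(2) by simp
    show ?thesis
      using T.frac_eq_iff[OF h_S[OF h(1)] h_S[OF assms(1)] h.hom_closed[OF h(2)] h.hom_closed[OF assms(2)]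
          h.hom_closed[OF ab(1)] h.hom_closed[OF ab(2)] 1 2] 3 by simp
  qed
  let ?f = "\<lambda>(s, r). frac R S s r" and ?g = "\<lambda>(s, r). frac T S' (h s) (h r)"
  have "induced (S \<times> carrier R) ?f ?g (?f (s, r)) = ?g (s, r)"
  proof (rule induced_eqI)
    fix x assume "x \<in> S \<times> carrier R" "?f x = ?f (s, r)"
    then show "?g x = ?g (s, r)" using eq[of "fst x" "snd x"] by (simp add: split_beta mem_Times_iff)
  qed (use assms in simp)
  then show ?thesis by (simp add: frac_map_def)
qed

lemma ring_epi_frac_map: "ring_epi (frac_ring R S) (frac_ring T S') (frac_map R S T S' h)"
proof -
  let ?F = "frac_map R S T S' h"
  have "ring_hom_ring (frac_ring R S) (frac_ring T S') ?F"
  proof (rule ring_hom_ringI[OF R.ring_frac_ring T.ring_frac_ring])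
    fix x y assume xy: "x \<in> carrier (frac_ring R S)" "y \<in> carrier (frac_ring R S)"
    obtain s r where x: "s \<in> S" "r \<in> carrier R" "x = frac R S s r" using R.frac_ring_carrierE[OF xy(1)] .
    obtain t q where y: "t \<in> S" "q \<in> carrier R" "y = frac R S t q" using R.frac_ring_carrierE[OF xy(2)] .
    show "?F x \<in> carrier (frac_ring T S')" using x h_S by (simp add: frac_map_frac)
    let ?c = "R.conjugate t r"
    have c: "?c \<in> carrier R" "t \<otimes>\<^bsub>R\<^esub> r = ?c \<otimes>\<^bsub>R\<^esub> t" using x y R.conjugate_eq by simp_all
    have "h t \<otimes>\<^bsub>T\<^esub> h r = h ?c \<otimes>\<^bsub>T\<^esub> h t" using arg_cong[OF c(2), of h] c(1) x y by simp
    then have "?F x \<otimes>\<^bsub>frac_ring T S'\<^esub> ?F y = frac T S' (h t \<otimes>\<^bsub>T\<^esub> h s) (h ?c \<otimes>\<^bsub>T\<^esub> h q)"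
      using x y c(1) h_S by (simp add: frac_map_frac) (intro T.frac_mult, auto)
    then show "?F (x \<otimes>\<^bsub>frac_ring R S\<^esub> y) = ?F x \<otimes>\<^bsub>frac_ring T S'\<^esub> ?F y"
      using x y c(1) by (simp add: R.frac_mult_conjugate frac_map_frac)
    obtain s r q where "s \<in> S" "r \<in> carrier R" "q \<in> carrier R" "x = frac R S s r" "y = frac R S s q"
      using R.frac_ring_carrierE2[OF xy] .
    then show "?F (x \<oplus>\<^bsub>frac_ring R S\<^esub> y) = ?F x \<oplus>\<^bsub>frac_ring T S'\<^esub> ?F y"
      using h_S by (simp add: R.frac_add T.frac_add frac_map_frac)
  next
    show "?F \<one>\<^bsub>frac_ring R S\<^esub> = \<one>\<^bsub>frac_ring T S'\<^esub>"
      using frac_map_frac[OF R.one_in_S R.one_closed] R.frac_ring_one[OF R.one_in_S] T.frac_ring_one[OF T.one_in_S]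
      by simp
  qed
  moreover have "?F ` carrier (frac_ring R S) = carrier (frac_ring T S')"
  proof (intro subset_antisym subsetI)
    fix y assume "y \<in> carrier (frac_ring T S')"
    then obtain t q where y: "t \<in> S'" "q \<in> carrier T" "y = frac T S' t q" using T.frac_ring_carrierE by metis
    obtain s r where "s \<in> S" "t = h s" "r \<in> carrier R" "q = h r" using y image_S h.surj by blast
    then show "y \<in> ?F ` carrier (frac_ring R S)"
      using y frac_map_frac by (intro image_eqI[of _ _ "frac R S s r"]) auto
  qed (use calculation ring_hom_closed[OF ring_hom_ring.homh] in auto)
  ultimately show ?thesis by (simp add: ring_epi_def ring_epi_axioms_def)
qed

lemma frac_map_frac_hom:
  assumes "x \<in> carrier R"
  shows "frac_map R S T S' h (frac_hom R S x) = frac_hom T S' (h x)"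
  using frac_map_frac[OF R.one_in_S assms] by (simp add: frac_hom_def)

lemma frac_map_mem_frac_ideal_iff:
  assumes I: "R.saturated I" and J: "T.saturated J"
    and IJ: "\<And>r. r \<in> carrier R \<Longrightarrow> h r \<in> J \<longleftrightarrow> r \<in> I"
    and x: "x \<in> carrier (frac_ring R S)"
  shows "frac_map R S T S' h x \<in> frac_ideal T S' J \<longleftrightarrow> x \<in> frac_ideal R S I"
proof -
  obtain s r where "s \<in> S" "r \<in> carrier R" "x = frac R S s r" using R.frac_ring_carrierE[OF x] .
  then show ?thesis
    using IJ R.frac_mem_frac_ideal_iff[OF I] T.frac_mem_frac_ideal_iff[OF J] h_S by (simp add: frac_map_frac)
qed

lemma frac_map_eq_zero_iff:
  assumes I: "R.saturated I" and ker: "\<And>r. r \<in> carrier R \<Longrightarrow> h r = \<zero>\<^bsub>T\<^esub> \<longleftrightarrow> r \<in> I"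
    and x: "x \<in> carrier (frac_ring R S)"
  shows "frac_map R S T S' h x = \<zero>\<^bsub>frac_ring T S'\<^esub> \<longleftrightarrow> x \<in> frac_ideal R S I"
proof -
  obtain s r where "s \<in> S" "r \<in> carrier R" "x = frac R S s r" using R.frac_ring_carrierE[OF x] .
  then show ?thesis
    using ker R.frac_mem_frac_ideal_iff[OF I] h_S by (simp add: frac_map_frac T.frac_eq_zero_iff)
qed

end

section \<open>Free rings and the universal property of the localization\<close>

lemma carrier_free_ring: "carrier (free_ring X) = {f. Poly_Mapping.keys f \<subseteq> {w. set (letters w) \<subseteq> X}}"
  by (auto simp: free_ring_def)

lemma free_ring_simps [simp]:
  "x \<otimes>\<^bsub>free_ring X\<^esub> y = x * y" "x \<oplus>\<^bsub>free_ring X\<^esub> y = x + y"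
  "\<one>\<^bsub>free_ring X\<^esub> = 1" "\<zero>\<^bsub>free_ring X\<^esub> = 0"
  by (simp_all add: free_ring_def)

lemma free_ring_mult_closed:
  assumes "f \<in> carrier (free_ring X)" "g \<in> carrier (free_ring X)"
  shows "f * g \<in> carrier (free_ring X)"
proof -
  have "set (letters w) \<subseteq> X" if "w \<in> Poly_Mapping.keys (f * g)" for w
  proof -
    have "w \<in> {a + b |a b. a \<in> Poly_Mapping.keys f \<and> b \<in> Poly_Mapping.keys g}"
      using keys_mult[of f g] that by (rule subsetD)
    then obtain a b where ab: "w = a + b" "a \<in> Poly_Mapping.keys f" "b \<in> Poly_Mapping.keys g"
      by blast
    then show ?thesis using assms by (simp add: carrier_free_ring plus_free_word_def subset_iff)
  qed
  then show ?thesis by (auto simp: carrier_free_ring)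
qed

lemma free_ring_uminus_closed: "f \<in> carrier (free_ring X) \<Longrightarrow> - f \<in> carrier (free_ring X)"
  by (simp add: carrier_free_ring)

lemma ring_free_ring: "ring (free_ring X)"
proof (rule ringI)
  show "abelian_group (free_ring X)"
  proof (rule abelian_groupI)
    fix f g assume "f \<in> carrier (free_ring X)" "g \<in> carrier (free_ring X)"
    then show "f \<oplus>\<^bsub>free_ring X\<^esub> g \<in> carrier (free_ring X)"
      using keys_add[of f g] unfolding carrier_free_ring by auto
  next
    fix f assume "f \<in> carrier (free_ring X)"
    then show "\<exists>g\<in>carrier (free_ring X). g \<oplus>\<^bsub>free_ring X\<^esub> f = \<zero>\<^bsub>free_ring X\<^esub>"
      using free_ring_uminus_closed[of f X] by (intro bexI[of _ "- f"]) auto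
  qed (auto simp: carrier_free_ring)
  show "Group.monoid (free_ring X)"
  proof (rule monoidI)
    show "\<one>\<^bsub>free_ring X\<^esub> \<in> carrier (free_ring X)" by (simp add: carrier_free_ring zero_free_word_def)
  qed (auto simp: free_ring_mult_closed mult.assoc)
qed (auto simp: distrib_left distrib_right)

lemma free_ring_minus:
  assumes "f \<in> carrier (free_ring X)" "g \<in> carrier (free_ring X)"
  shows "f \<ominus>\<^bsub>free_ring X\<^esub> g = f - g"
proof -
  interpret ring "free_ring X" by (rule ring_free_ring)
  have "\<ominus>\<^bsub>free_ring X\<^esub> g = - g"
    using assms free_ring_uminus_closed by (intro minus_equality) auto
  then show ?thesis by (simp add: minus_eq)
qed

lemma free_gen_closed: "x \<in> X \<Longrightarrow> free_gen x \<in> carrier (free_ring X)"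
  by (auto simp: free_gen_def carrier_free_ring)

lemma frag_of_word_Cons: "frag_of (Word (x # xs)) = free_gen x * frag_of (Word xs)"
  by (simp add: free_gen_def mult_single plus_free_word_def)

lemma frag_of_word_Nil: "frag_of (Word []) = (1 :: 'x free_word \<Rightarrow>\<^sub>0 int)"
  using single_one[where ?'a = "'x free_word" and ?'b = int] by (simp add: zero_free_word_def)

text \<open>Additively the free ring is the free abelian group on words, and words grow letter by
  letter on the left. Differences appear in place of sums to match induction on free abelian
  groups.\<close>

lemma free_ring_induct [consumes 1, case_names zero one mult diff]:
  assumes "f \<in> carrier (free_ring X)"
    and "P 0" "P 1"
    and mult: "\<And>x f. x \<in> X \<Longrightarrow> f \<in> carrier (free_ring X) \<Longrightarrow> P f \<Longrightarrow> P (free_gen x * f)"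
    and diff: "\<And>f g. f \<in> carrier (free_ring X) \<Longrightarrow> g \<in> carrier (free_ring X) \<Longrightarrow> P f \<Longrightarrow> P g \<Longrightarrow> P (f - g)"
  shows "P f"
proof -
  have word: "P (frag_of (Word xs))" if "set xs \<subseteq> X" for xs
    using that
  proof (induction xs)
    case Nil
    then show ?case using assms(3) by (simp add: frag_of_word_Nil)
  next
    case (Cons x xs)
    then have "frag_of (Word xs) \<in> carrier (free_ring X)" by (simp add: carrier_free_ring)
    then show ?case using mult Cons by (simp add: frag_of_word_Cons)
  qed
  have "Poly_Mapping.keys f \<subseteq> {w. set (letters w) \<subseteq> X}" using assms(1) by (simp add: carrier_free_ring)
  then show ?thesis
  proof (rule free_Abelian_group_induct)
    show "P (frag_of w)" if "w \<in> {w. set (letters w) \<subseteq> X}" for w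
      using that word[of "letters w"] by simp
  qed (use assms(2) diff in \<open>simp_all add: carrier_free_ring\<close>)
qed

text \<open>A word is evaluated as the ordered product of its letters; the additive extension to the
  free abelian group on words then has to be shown multiplicative.\<close>

lemma (in ring) free_ring_universal:
  assumes v: "\<And>x. x \<in> X \<Longrightarrow> v x \<in> carrier R"
  obtains h where "ring_hom_ring (free_ring X) R h" "\<And>x. x \<in> X \<Longrightarrow> h (free_gen x) = v x"
proof -
  interpret F: ring "free_ring X" by (rule ring_free_ring)
  define W where "W = {w. set (letters w) \<subseteq> X}"
  define val where "val w = foldr (\<lambda>x r. v x \<otimes> r) (letters w) \<one>" for w
  have foldr_closed: "foldr (\<lambda>x r. v x \<otimes> r) xs \<one> \<in> carrier R" if "set xs \<subseteq> X" for xs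
    using that v by (induction xs) auto
  have val_closed: "val w \<in> carrier R" if "w \<in> W" for w
    using that foldr_closed by (simp add: val_def W_def)
  have comm: "comm_group (add_monoid R)" by (rule a_comm_group)
  obtain h where h: "h \<in> hom (free_Abelian_group W) (add_monoid R)" "\<And>w. w \<in> W \<Longrightarrow> h (frag_of w) = val w"
    using comm_group.free_Abelian_group_universal[OF comm, of val W] val_closed by auto
  have carr: "carrier (free_ring X) = carrier (free_Abelian_group W)"
    by (simp add: set_eq_iff carrier_free_ring W_def)
  have closed: "h f \<in> carrier R" if "f \<in> carrier (free_ring X)" for f
    using hom_in_carrier[OF h(1)] that carr by simp
  have add: "h (f + g) = h f \<oplus> h g" if "f \<in> carrier (free_ring X)" "g \<in> carrier (free_ring X)" for f g
    using hom_mult[OF h(1), of f g] that carr by simp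
  have zero: "h 0 = \<zero>"
  proof -
    have "h 0 \<oplus> h 0 = h 0" using add[of 0 0] F.zero_closed by simp
    then show ?thesis using closed[of 0] F.zero_closed by simp
  qed
  have h_diff: "h (f - g) = h f \<ominus> h g" if fg: "f \<in> carrier (free_ring X)" "g \<in> carrier (free_ring X)" for f g
  proof -
    have "f - g \<in> carrier (free_ring X)" using free_ring_minus[OF fg] F.minus_closed[OF fg] by simp
    then have "h f = h (f - g) \<oplus> h g" using add[of "f - g" g] fg by simp
    then show ?thesis
      using closed[of f] closed[of g] closed[of "f - g"] fg \<open>f - g \<in> _\<close>
      by (simp add: minus_eq a_assoc r_neg)
  qed
  have one: "h 1 = \<one>"
    using h(2)[of "Word []"] by (simp add: val_def W_def frag_of_word_Nil)
  \<comment> \<open>Left multiplication by a letter is the basic case of multiplicativity; the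
    general one follows by induction on the left factor.\<close>
  have gen: "h (free_gen x * f) = v x \<otimes> h f" if x: "x \<in> X" and f: "f \<in> carrier (free_ring X)" for x f
  proof -
    have "Poly_Mapping.keys f \<subseteq> W" using f by (simp add: carrier_free_ring W_def)
    then show ?thesis
    proof (rule free_Abelian_group_induct)
      show "h (free_gen x * 0) = v x \<otimes> h 0" using zero v[OF x] by simp
    next
      fix f g
      assume "Poly_Mapping.keys f \<subseteq> W" "Poly_Mapping.keys g \<subseteq> W"
        and IH: "h (free_gen x * f) = v x \<otimes> h f" "h (free_gen x * g) = v x \<otimes> h g"
      then have fg: "f \<in> carrier (free_ring X)" "g \<in> carrier (free_ring X)" by (simp_all add: carr)
      note m = free_ring_mult_closed[OF free_gen_closed[OF x] fg(1)] free_ring_mult_closed[OF free_gen_closed[OF x] fg(2)]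
      show "h (free_gen x * (f - g)) = v x \<otimes> h (f - g)"
        using IH h_diff[OF fg] h_diff[OF m] closed[OF fg(1)] closed[OF fg(2)] v[OF x]
        by (simp add: right_diff_distrib minus_eq r_distr r_minus)
    next
      fix w assume w: "w \<in> W"
      then have "free_gen x * frag_of w = frag_of (Word (x # letters w))" "Word (x # letters w) \<in> W"
        using x by (simp_all add: frag_of_word_Cons W_def)
      then show "h (free_gen x * frag_of w) = v x \<otimes> h (frag_of w)" using h(2) w by (simp add: val_def)
    qed
  qed
  have mult: "h (f * g) = h f \<otimes> h g" if f: "f \<in> carrier (free_ring X)" and g: "g \<in> carrier (free_ring X)" for f g
    using f
  proof (induction f rule: free_ring_induct)
    case (mult x f)
    then have "free_gen x * f * g = free_gen x * (f * g)" by (simp add: mult.assoc)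
    then show ?case
      using mult gen[OF mult(1)] free_ring_mult_closed[OF mult(2) g] closed[OF mult(2)] closed[OF g] v[OF mult(1)]
      by (simp add: m_assoc)
  next
    case (diff f f')
    then have "(f - f') * g = f * g - f' * g" by (simp add: left_diff_distrib)
    then show ?case
      using diff h_diff[OF diff(1,2)] h_diff[OF free_ring_mult_closed[OF diff(1) g] free_ring_mult_closed[OF diff(2) g]]
        closed[OF diff(1)] closed[OF diff(2)] closed[OF g]
      by (simp add: minus_eq l_distr l_minus)
  qed (use zero one closed[OF g] in auto)
  have "ring_hom_ring (free_ring X) R h"
    by (rule ring_hom_ringI[OF ring_free_ring ring_axioms]) (auto simp: closed mult add one)
  moreover have "h (free_gen x) = v x" if "x \<in> X" for x
    using gen[OF that, of 1] F.one_closed one v[OF that] by simp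
  ultimately show thesis using that by blast
qed

section \<open>The universal localization as a quotient of a free ring in two stages\<close>

locale ring_with_subset = ring R for R (structure) +
  fixes S
  assumes S_subset: "S \<subseteq> carrier R"
begin

abbreviation (input) "\<A> \<equiv> letter_ring R S"
abbreviation (input) "\<F> \<equiv> free_extension R S"
abbreviation (input) "\<L> \<equiv> localization R S"

lemma letter_closed:
  "r \<in> carrier R \<Longrightarrow> free_gen (Inl r) \<in> carrier \<A>"
  "s \<in> S \<Longrightarrow> free_gen (Inr s) \<in> carrier \<A>"
  unfolding letter_ring_def by (auto intro: free_gen_closed)

lemma ring_letter_ring: "ring \<A>"
  unfolding letter_ring_def by (rule ring_free_ring)

lemma letter_ring_simps [simp]:
  "x \<otimes>\<^bsub>\<A>\<^esub> y = x * y" "x \<oplus>\<^bsub>\<A>\<^esub> y = x + y"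
  "\<one>\<^bsub>\<A>\<^esub> = 1" "\<zero>\<^bsub>\<A>\<^esub> = 0"
  unfolding letter_ring_def by simp_all

lemma letter_ring_minus:
  "x \<in> carrier \<A> \<Longrightarrow> y \<in> carrier \<A> \<Longrightarrow> x \<ominus>\<^bsub>\<A>\<^esub> y = x - y"
  unfolding letter_ring_def by (rule free_ring_minus)

text \<open>Expresses the relations by the operations of the letter ring, so that homomorphism laws
  and the coset criterion apply to them.\<close>

lemma ring_relations_iff:
  "x \<in> ring_relations R \<longleftrightarrow>
    (\<exists>r r'. r \<in> carrier R \<and> r' \<in> carrier R \<and>
      (x = free_gen (Inl (r \<oplus> r')) \<ominus>\<^bsub>\<A>\<^esub> (free_gen (Inl r) \<oplus>\<^bsub>\<A>\<^esub> free_gen (Inl r')) \<or>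
       x = free_gen (Inl (r \<otimes> r')) \<ominus>\<^bsub>\<A>\<^esub> (free_gen (Inl r) \<otimes>\<^bsub>\<A>\<^esub> free_gen (Inl r')))) \<or>
    x = free_gen (Inl \<one>) \<ominus>\<^bsub>\<A>\<^esub> \<one>\<^bsub>\<A>\<^esub>"
proof -
  interpret A: ring \<A> by (rule ring_letter_ring)
  have add: "free_gen (Inl (r \<oplus> r')) \<ominus>\<^bsub>\<A>\<^esub> (free_gen (Inl r) \<oplus>\<^bsub>\<A>\<^esub> free_gen (Inl r'))
      = free_gen (Inl (r \<oplus> r')) - (free_gen (Inl r) + free_gen (Inl r'))"
    and mult: "free_gen (Inl (r \<otimes> r')) \<ominus>\<^bsub>\<A>\<^esub> (free_gen (Inl r) \<otimes>\<^bsub>\<A>\<^esub> free_gen (Inl r'))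
      = free_gen (Inl (r \<otimes> r')) - free_gen (Inl r) * free_gen (Inl r')"
    if rr: "r \<in> carrier R" "r' \<in> carrier R" for r r'
    using letter_ring_minus[OF letter_closed(1) A.a_closed[OF letter_closed(1) letter_closed(1)], of "r \<oplus> r'" r r']
      letter_ring_minus[OF letter_closed(1) A.m_closed[OF letter_closed(1) letter_closed(1)], of "r \<otimes> r'" r r'] rr
    by simp_all
  have one: "free_gen (Inl \<one>) \<ominus>\<^bsub>\<A>\<^esub> \<one>\<^bsub>\<A>\<^esub> = free_gen (Inl \<one>) - 1"
    using letter_ring_minus[OF letter_closed(1) A.one_closed, of \<one>] by simp
  show ?thesis
    unfolding ring_relations_def one using add mult by (simp only: Un_iff mem_Collect_eq insert_iff empty_iff) metis
qed

lemma ideal_relation_ideal: "ideal (relation_ideal R S) \<A>"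
  and ring_relations_subset: "ring_relations R \<subseteq> relation_ideal R S"
proof -
  interpret A: ring \<A> by (rule ring_letter_ring)
  have "ring_relations R \<subseteq> carrier \<A>"
    using letter_closed(1) by (auto simp: ring_relations_iff simp del: letter_ring_simps)
  then show "ideal (relation_ideal R S) \<A>" "ring_relations R \<subseteq> relation_ideal R S"
    unfolding relation_ideal_def by (rule A.genideal_ideal, rule A.genideal_self)
qed

lemma ring_epi_free_extension:
  "ring_epi \<A> \<F> ((+>\<^bsub>\<A>\<^esub>) (relation_ideal R S))"
  unfolding free_extension_def by (rule ideal.ring_epi_coset[OF ideal_relation_ideal])

lemma ring_free_extension: "ring \<F>"
  unfolding free_extension_def by (rule ideal.quotient_is_ring[OF ideal_relation_ideal])

text \<open>The three families of relations are the three homomorphism laws, each read off from a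
  difference in the relation ideal.\<close>

lemma ring_hom_free_coeff: "ring_hom_ring R \<F> (free_coeff R S)"
proof (rule ring_hom_ringI[OF ring_axioms ring_free_extension])
  interpret I: ideal "relation_ideal R S" \<A> by (rule ideal_relation_ideal)
  interpret q: ring_epi \<A> \<F> "(+>\<^bsub>\<A>\<^esub>) (relation_ideal R S)"
    by (rule ring_epi_free_extension)
  show "free_coeff R S r \<in> carrier \<F>" if "r \<in> carrier R" for r
    unfolding free_coeff_def using letter_closed(1)[OF that] by (rule q.hom_closed)
  have eq: "relation_ideal R S +>\<^bsub>\<A>\<^esub> x = relation_ideal R S +>\<^bsub>\<A>\<^esub> y"
    if "x \<ominus>\<^bsub>\<A>\<^esub> y \<in> ring_relations R" "x \<in> carrier \<A>" "y \<in> carrier \<A>" for x y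
    using I.coset_eq_iff[OF that(2,3)] that(1) ring_relations_subset by blast
  show "free_coeff R S \<one> = \<one>\<^bsub>\<F>\<^esub>"
    unfolding free_coeff_def q.hom_one[symmetric]
    by (rule eq) (use letter_closed(1) ring.ring_simprules(6)[OF ring_letter_ring] in \<open>auto simp: ring_relations_iff simp del: letter_ring_simps\<close>)
  fix r r' assume r: "r \<in> carrier R" "r' \<in> carrier R"
  note g = letter_closed(1)[OF r(1)] letter_closed(1)[OF r(2)]
  show "free_coeff R S (r \<otimes> r') = free_coeff R S r \<otimes>\<^bsub>\<F>\<^esub> free_coeff R S r'"
    unfolding free_coeff_def q.hom_mult[OF g, symmetric]
    by (rule eq) (use r g letter_closed(1) ring.ring_simprules(5)[OF ring_letter_ring] in \<open>auto simp: ring_relations_iff simp del: letter_ring_simps\<close>)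
  show "free_coeff R S (r \<oplus> r') = free_coeff R S r \<oplus>\<^bsub>\<F>\<^esub> free_coeff R S r'"
    unfolding free_coeff_def q.hom_add[OF g, symmetric]
    by (rule eq) (use r g letter_closed(1) ring.ring_simprules(1)[OF ring_letter_ring] in \<open>auto simp: ring_relations_iff simp del: letter_ring_simps\<close>)
qed

lemma free_coeff_closed: "r \<in> carrier R \<Longrightarrow> free_coeff R S r \<in> carrier \<F>"
  using ring_hom_closed[OF ring_hom_ring.homh[OF ring_hom_free_coeff]] .

lemma free_indet_closed:
  assumes "s \<in> S"
  shows "free_indet R S s \<in> carrier \<F>"
proof -
  interpret q: ring_epi \<A> \<F> "(+>\<^bsub>\<A>\<^esub>) (relation_ideal R S)"
    by (rule ring_epi_free_extension)
  show ?thesis unfolding free_indet_def by (rule q.hom_closed[OF letter_closed(2)[OF assms]])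
qed

definition inverting_relations where
  "inverting_relations = (\<Union>s\<in>S. {free_coeff R S s \<otimes>\<^bsub>\<F>\<^esub> free_indet R S s \<ominus>\<^bsub>\<F>\<^esub> \<one>\<^bsub>\<F>\<^esub>,
     free_indet R S s \<otimes>\<^bsub>\<F>\<^esub> free_coeff R S s \<ominus>\<^bsub>\<F>\<^esub> \<one>\<^bsub>\<F>\<^esub>})"

lemma inverting_ideal_eq: "inverting_ideal R S = Idl\<^bsub>\<F>\<^esub> inverting_relations"
  unfolding inverting_ideal_def inverting_relations_def Let_def ..

lemma ideal_inverting_ideal: "ideal (inverting_ideal R S) \<F>"
  and inverting_relations_subset: "inverting_relations \<subseteq> inverting_ideal R S"
proof -
  interpret F: ring \<F> by (rule ring_free_extension)
  have "inverting_relations \<subseteq> carrier \<F>"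
    using free_coeff_closed free_indet_closed S_subset by (auto simp: inverting_relations_def)
  then show "ideal (inverting_ideal R S) \<F>" "inverting_relations \<subseteq> inverting_ideal R S"
    unfolding inverting_ideal_eq by (rule F.genideal_ideal, rule F.genideal_self)
qed

lemma ring_epi_localization:
  "ring_epi \<F> \<L> ((+>\<^bsub>\<F>\<^esub>) (inverting_ideal R S))"
  unfolding localization_def by (rule ideal.ring_epi_coset[OF ideal_inverting_ideal])

lemma ring_localization: "ring \<L>"
  unfolding localization_def by (rule ideal.quotient_is_ring[OF ideal_inverting_ideal])

lemma ring_hom_localization_hom: "ring_hom_ring R \<L> (localization_hom R S)"
proof -
  have "localization_hom R S = (+>\<^bsub>\<F>\<^esub>) (inverting_ideal R S) \<circ> free_coeff R S"
    by (auto simp: localization_hom_def)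
  then show ?thesis
    using ring_hom_ring_compose[OF ring_hom_free_coeff ring_epi.axioms(1)[OF ring_epi_localization]] by simp
qed

lemma localization_inverse:
  assumes s: "s \<in> S"
  shows localization_inverse_closed: "localization_inverse R S s \<in> carrier \<L>"
    and localization_inverse_right:
      "localization_hom R S s \<otimes>\<^bsub>\<L>\<^esub> localization_inverse R S s = \<one>\<^bsub>\<L>\<^esub>"
    and localization_inverse_left:
      "localization_inverse R S s \<otimes>\<^bsub>\<L>\<^esub> localization_hom R S s = \<one>\<^bsub>\<L>\<^esub>"
proof -
  interpret I: ideal "inverting_ideal R S" \<F> by (rule ideal_inverting_ideal)
  interpret q: ring_epi \<F> \<L> "(+>\<^bsub>\<F>\<^esub>) (inverting_ideal R S)"
    by (rule ring_epi_localization)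
  note c = free_coeff_closed[of s] free_indet_closed[OF s]
  have sR: "s \<in> carrier R" using s S_subset by auto
  show "localization_inverse R S s \<in> carrier \<L>"
    unfolding localization_inverse_def using c(2) by (rule q.hom_closed)
  have rel: "free_coeff R S s \<otimes>\<^bsub>\<F>\<^esub> free_indet R S s \<ominus>\<^bsub>\<F>\<^esub> \<one>\<^bsub>\<F>\<^esub> \<in> inverting_ideal R S"
    "free_indet R S s \<otimes>\<^bsub>\<F>\<^esub> free_coeff R S s \<ominus>\<^bsub>\<F>\<^esub> \<one>\<^bsub>\<F>\<^esub> \<in> inverting_ideal R S"
    using inverting_relations_subset s unfolding inverting_relations_def by blast+
  show "localization_hom R S s \<otimes>\<^bsub>\<L>\<^esub> localization_inverse R S s = \<one>\<^bsub>\<L>\<^esub>"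
    unfolding localization_hom_def localization_inverse_def q.hom_mult[OF c(1)[OF sR] c(2), symmetric] q.hom_one[symmetric]
    using I.coset_eq_iff[OF I.m_closed[OF c(1)[OF sR] c(2)] I.one_closed] rel(1) by simp
  show "localization_inverse R S s \<otimes>\<^bsub>\<L>\<^esub> localization_hom R S s = \<one>\<^bsub>\<L>\<^esub>"
    unfolding localization_hom_def localization_inverse_def q.hom_mult[OF c(2) c(1)[OF sR], symmetric] q.hom_one[symmetric]
    using I.coset_eq_iff[OF I.m_closed[OF c(2) c(1)[OF sR]] I.one_closed] rel(2) by simp
qed

text \<open>The localization is an image of the free ring on the letters, so its elements are
  reached from \<open>\<zero>\<close> and \<open>\<one>\<close> by left multiplication with images
  of letters and by differences.\<close>

lemma localization_induct [consumes 1, case_names zero one coeff inverse diff]: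
  assumes x: "x \<in> carrier \<L>"
    and "P \<zero>\<^bsub>\<L>\<^esub>" "P \<one>\<^bsub>\<L>\<^esub>"
    and coeff: "\<And>r x. r \<in> carrier R \<Longrightarrow> x \<in> carrier \<L> \<Longrightarrow> P x \<Longrightarrow>
      P (localization_hom R S r \<otimes>\<^bsub>\<L>\<^esub> x)"
    and inverse: "\<And>s x. s \<in> S \<Longrightarrow> x \<in> carrier \<L> \<Longrightarrow> P x \<Longrightarrow>
      P (localization_inverse R S s \<otimes>\<^bsub>\<L>\<^esub> x)"
    and diff: "\<And>x y. x \<in> carrier \<L> \<Longrightarrow> y \<in> carrier \<L> \<Longrightarrow> P x \<Longrightarrow> P y \<Longrightarrow>
      P (x \<ominus>\<^bsub>\<L>\<^esub> y)"
  shows "P x"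
proof -
  define e where "e = (+>\<^bsub>\<F>\<^esub>) (inverting_ideal R S) \<circ> (+>\<^bsub>\<A>\<^esub>) (relation_ideal R S)"
  interpret e: ring_epi \<A> \<L> e
    unfolding e_def by (rule ring_epi_compose[OF ring_epi_free_extension ring_epi_localization])
  have gens: "e (free_gen (Inl r)) = localization_hom R S r" "e (free_gen (Inr r)) = localization_inverse R S r" for r
    by (simp_all add: e_def localization_hom_def localization_inverse_def free_coeff_def free_indet_def)
  have "P (e f)" if "f \<in> carrier \<A>" for f
    using that[unfolded letter_ring_def]
  proof (induction f rule: free_ring_induct)
    case zero
    show ?case using e.hom_zero assms(2) by simp
  next
    case one
    show ?case using e.hom_one assms(3) by simp
  next
    case (mult y f)
    then have f: "f \<in> carrier \<A>" by (simp add: letter_ring_def)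
    consider r where "r \<in> carrier R" "y = Inl r" | s where "s \<in> S" "y = Inr s" using mult(1) by blast
    then show ?case
    proof cases
      case 1
      then show ?thesis
        using coeff[OF 1(1) e.hom_closed[OF f] mult(3)] e.hom_mult[OF letter_closed(1)[OF 1(1)] f] gens by simp
    next
      case 2
      then show ?thesis
        using inverse[OF 2(1) e.hom_closed[OF f] mult(3)] e.hom_mult[OF letter_closed(2)[OF 2(1)] f] gens by simp
    qed
  next
    case (diff f g)
    then have fg: "f \<in> carrier \<A>" "g \<in> carrier \<A>" by (simp_all add: letter_ring_def)
    have "e (f - g) = e f \<ominus>\<^bsub>\<L>\<^esub> e g"
      using fg letter_ring_minus[OF fg, symmetric] by (simp add: e.R.minus_eq e.S.minus_eq del: letter_ring_simps)
    then show ?case using assms(6)[OF e.hom_closed[OF fg(1)] e.hom_closed[OF fg(2)] diff(3,4)] by simp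
  qed
  moreover obtain f where "f \<in> carrier \<A>" "x = e f" using x e.surj by (metis imageE)
  ultimately show ?thesis by simp
qed

text \<open>Three extensions in turn: values on letters extend to the free ring, the relations of
  \<open>R\<close> die because \<open>g\<close> is a homomorphism, and the inverting relations die
  because \<open>i s\<close> is a two-sided inverse of \<open>g s\<close>.\<close>

lemma localization_universal:
  assumes g: "ring_hom_ring R B g"
    and i: "\<And>s. s \<in> S \<Longrightarrow> i s \<in> carrier B" "\<And>s. s \<in> S \<Longrightarrow> g s \<otimes>\<^bsub>B\<^esub> i s = \<one>\<^bsub>B\<^esub>"
      "\<And>s. s \<in> S \<Longrightarrow> i s \<otimes>\<^bsub>B\<^esub> g s = \<one>\<^bsub>B\<^esub>"
  obtains h where "ring_hom_ring \<L> B h"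
    "\<And>r. r \<in> carrier R \<Longrightarrow> h (localization_hom R S r) = g r"
    "\<And>s. s \<in> S \<Longrightarrow> h (localization_inverse R S s) = i s"
proof -
  interpret g: ring_hom_ring R B g by fact
    define v where "v = case_sum g i"
  have "v x \<in> carrier B" if "x \<in> Inl ` carrier R \<union> Inr ` S" for x
    using that i(1) by (auto simp: v_def)
  then obtain k where k: "ring_hom_ring \<A> B k" "\<And>x. x \<in> Inl ` carrier R \<union> Inr ` S \<Longrightarrow> k (free_gen x) = v x"
    using g.S.free_ring_universal[of "Inl ` carrier R \<union> Inr ` S" v] unfolding letter_ring_def by metis
  then have kg: "\<And>r. r \<in> carrier R \<Longrightarrow> k (free_gen (Inl r)) = g r" and ki: "\<And>s. s \<in> S \<Longrightarrow> k (free_gen (Inr s)) = i s"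
    by (auto simp: v_def)
  interpret k: ring_hom_ring \<A> B k by (rule k(1))
  interpret q: ring_epi \<A> \<F> "(+>\<^bsub>\<A>\<^esub>) (relation_ideal R S)" by (rule ring_epi_free_extension)
  interpret I: ideal "relation_ideal R S" \<A> by (rule ideal_relation_ideal)
  have eq0: "k (x \<ominus>\<^bsub>\<A>\<^esub> y) = \<zero>\<^bsub>B\<^esub>" if "x \<in> carrier \<A>" "y \<in> carrier \<A>" "k x = k y" for x y
    using k.hom_minus_eq_iff[OF that(1,2)] that(3) by simp
  have "x \<in> a_kernel \<A> B k" if x: "x \<in> ring_relations R" for x
  proof -
    have "x \<in> carrier \<A>" using x ring_relations_subset I.a_subset by auto
    moreover have "k x = \<zero>\<^bsub>B\<^esub>"
    proof -
      from x consider r r' where "r \<in> carrier R" "r' \<in> carrier R"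
          "x = free_gen (Inl (r \<oplus> r')) \<ominus>\<^bsub>\<A>\<^esub> (free_gen (Inl r) \<oplus>\<^bsub>\<A>\<^esub> free_gen (Inl r'))"
        | r r' where "r \<in> carrier R" "r' \<in> carrier R"
          "x = free_gen (Inl (r \<otimes> r')) \<ominus>\<^bsub>\<A>\<^esub> (free_gen (Inl r) \<otimes>\<^bsub>\<A>\<^esub> free_gen (Inl r'))"
        | "x = free_gen (Inl \<one>) \<ominus>\<^bsub>\<A>\<^esub> \<one>\<^bsub>\<A>\<^esub>"
        unfolding ring_relations_iff by blast
      then show ?thesis
      proof cases
        case (1 r r')
        have "k (free_gen (Inl (r \<oplus> r'))) = k (free_gen (Inl r) \<oplus>\<^bsub>\<A>\<^esub> free_gen (Inl r'))"
          using k.hom_add[OF letter_closed(1)[OF 1(1)] letter_closed(1)[OF 1(2)]] kg 1(1,2) by simp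
        then show ?thesis unfolding 1(3) by (intro eq0 ring.ring_simprules(1)[OF ring_letter_ring] letter_closed(1) a_closed 1)
      next
        case (2 r r')
        have "k (free_gen (Inl (r \<otimes> r'))) = k (free_gen (Inl r) \<otimes>\<^bsub>\<A>\<^esub> free_gen (Inl r'))"
          using k.hom_mult[OF letter_closed(1)[OF 2(1)] letter_closed(1)[OF 2(2)]] kg 2(1,2) by simp
        then show ?thesis unfolding 2(3) by (intro eq0 ring.ring_simprules(5)[OF ring_letter_ring] letter_closed(1) m_closed 2)
      next
        case 3
        have "k (free_gen (Inl \<one>)) = k \<one>\<^bsub>\<A>\<^esub>" using k.hom_one kg by simp
        then show ?thesis unfolding 3 by (intro eq0 ring.ring_simprules(6)[OF ring_letter_ring] letter_closed(1) one_closed)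
      qed
    qed
    ultimately show ?thesis unfolding a_kernel_def' by blast
  qed
  then have "relation_ideal R S \<subseteq> a_kernel \<A> B k"
    unfolding relation_ideal_def using ring.genideal_minimal[OF ring_letter_ring k.kernel_is_ideal] by blast
  then have ker: "k x = \<zero>\<^bsub>B\<^esub>" if "x \<in> carrier \<A>" "relation_ideal R S +>\<^bsub>\<A>\<^esub> x = \<zero>\<^bsub>\<F>\<^esub>" for x
    using I.coset_eq_zero_iff[OF that(1)] that(2) unfolding a_kernel_def' free_extension_def by blast
  interpret m: induced_hom \<A> \<F> "(+>\<^bsub>\<A>\<^esub>) (relation_ideal R S)" B k
    by unfold_locales (rule ker)
  define m where "m = induced (carrier \<A>) ((+>\<^bsub>\<A>\<^esub>) (relation_ideal R S)) k"
  interpret m': ring_hom_ring \<F> B m unfolding m_def by (rule m.induced_ring_hom)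
  have mg: "m (free_coeff R S r) = g r" if "r \<in> carrier R" for r
    using m.induced_apply[OF letter_closed(1)[OF that]] kg[OF that] by (simp add: m_def free_coeff_def)
  have mi: "m (free_indet R S s) = i s" if "s \<in> S" for s
    using m.induced_apply[OF letter_closed(2)[OF that]] ki[OF that] by (simp add: m_def free_indet_def)
  interpret p: ring_epi \<F> \<L> "(+>\<^bsub>\<F>\<^esub>) (inverting_ideal R S)" by (rule ring_epi_localization)
  interpret J: ideal "inverting_ideal R S" \<F> by (rule ideal_inverting_ideal)
  have "x \<in> a_kernel \<F> B m" if x: "x \<in> inverting_relations" for x
  proof -
    have "x \<in> carrier \<F>" using x inverting_relations_subset J.a_subset by auto
    moreover obtain s where s: "s \<in> S" and "x = free_coeff R S s \<otimes>\<^bsub>\<F>\<^esub> free_indet R S s \<ominus>\<^bsub>\<F>\<^esub> \<one>\<^bsub>\<F>\<^esub> \<or>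
      x = free_indet R S s \<otimes>\<^bsub>\<F>\<^esub> free_coeff R S s \<ominus>\<^bsub>\<F>\<^esub> \<one>\<^bsub>\<F>\<^esub>"
      using x unfolding inverting_relations_def by blast
    moreover have sR: "s \<in> carrier R" using s S_subset by auto
    moreover note c = free_coeff_closed[OF sR] free_indet_closed[OF s]
    moreover have "m (free_coeff R S s \<otimes>\<^bsub>\<F>\<^esub> free_indet R S s) = m \<one>\<^bsub>\<F>\<^esub>"
      "m (free_indet R S s \<otimes>\<^bsub>\<F>\<^esub> free_coeff R S s) = m \<one>\<^bsub>\<F>\<^esub>"
      using mg[OF sR] mi[OF s] c i(2,3)[OF s] by simp_all
    ultimately have "m x = \<zero>\<^bsub>B\<^esub>"
      using m'.hom_minus_eq_iff[OF ring.ring_simprules(5)[OF ring_free_extension c] ring.ring_simprules(6)[OF ring_free_extension]]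
        m'.hom_minus_eq_iff[OF ring.ring_simprules(5)[OF ring_free_extension c(2,1)] ring.ring_simprules(6)[OF ring_free_extension]] by metis
    then show ?thesis unfolding a_kernel_def' using \<open>x \<in> carrier \<F>\<close> by blast
  qed
  then have "inverting_ideal R S \<subseteq> a_kernel \<F> B m"
    unfolding inverting_ideal_eq using ring.genideal_minimal[OF ring_free_extension m'.kernel_is_ideal] by blast
  then have ker': "m x = \<zero>\<^bsub>B\<^esub>" if "x \<in> carrier \<F>" "inverting_ideal R S +>\<^bsub>\<F>\<^esub> x = \<zero>\<^bsub>\<L>\<^esub>" for x
    using J.coset_eq_zero_iff[OF that(1)] that(2) unfolding a_kernel_def' localization_def by blast
  interpret n: induced_hom \<F> \<L> "(+>\<^bsub>\<F>\<^esub>) (inverting_ideal R S)" B m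
    by unfold_locales (rule ker')
  show thesis
  proof (rule that[OF n.induced_ring_hom])
    show "induced (carrier \<F>) ((+>\<^bsub>\<F>\<^esub>) (inverting_ideal R S)) m (localization_hom R S r) = g r" if "r \<in> carrier R" for r
      using n.induced_apply[OF free_coeff_closed[OF that]] mg[OF that] by (simp add: localization_hom_def)
    show "induced (carrier \<F>) ((+>\<^bsub>\<F>\<^esub>) (inverting_ideal R S)) m (localization_inverse R S s) = i s" if "s \<in> S" for s
      using n.induced_apply[OF free_indet_closed[OF that]] mi[OF that] by (simp add: localization_inverse_def)
  qed
qed

end

section \<open>The localization as a ring of fractions\<close>

sublocale normal_submonoid \<subseteq> ring_with_subset
  by unfold_locales auto

context normal_submonoid
begin

text \<open>The rule \<open>(a s)^-1 a = s^-1\<close>, obtained by inserting \<open>s s^-1\<close>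
  on the right. It enlarges denominators for multipliers \<open>a\<close> that are mere elements of
  \<open>R\<close>.\<close>

lemma localization_inverse_mult:
  assumes s: "s \<in> S" and a: "a \<in> carrier R" and as: "a \<otimes> s \<in> S"
  shows "localization_inverse R S (a \<otimes> s) \<otimes>\<^bsub>\<L>\<^esub> localization_hom R S a = localization_inverse R S s"
proof -
  interpret g: ring_hom_ring R \<L> "localization_hom R S" by (rule ring_hom_localization_hom)
  note i = localization_inverse_closed[OF s] localization_inverse_closed[OF as]
  have "localization_inverse R S (a \<otimes> s) \<otimes>\<^bsub>\<L>\<^esub> localization_hom R S a
      = localization_inverse R S (a \<otimes> s) \<otimes>\<^bsub>\<L>\<^esub> localization_hom R S a \<otimes>\<^bsub>\<L>\<^esub>
        (localization_hom R S s \<otimes>\<^bsub>\<L>\<^esub> localization_inverse R S s)"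
    using i a by (simp add: localization_inverse_right[OF s])
  also have "\<dots> = localization_inverse R S (a \<otimes> s) \<otimes>\<^bsub>\<L>\<^esub> localization_hom R S (a \<otimes> s)
      \<otimes>\<^bsub>\<L>\<^esub> localization_inverse R S s"
    using i a s by (simp add: g.S.m_assoc)
  finally show ?thesis using i by (simp add: localization_inverse_left[OF as])
qed

text \<open>The products of an inverse with a coefficient are closed under the steps of
  \<open>localization_induct\<close>: a coefficient moves past an inverse by normality, inverses
  multiply, and differences are taken over a common denominator.\<close>

lemma localization_carrierE:
  assumes "x \<in> carrier \<L>"
  obtains s r where "s \<in> S" "r \<in> carrier R"
    "x = localization_inverse R S s \<otimes>\<^bsub>\<L>\<^esub> localization_hom R S r"
proof -
  let ?g = "localization_hom R S" and ?i = "localization_inverse R S"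
  interpret g: ring_hom_ring R \<L> ?g by (rule ring_hom_localization_hom)
  note ic = localization_inverse_closed
  have "\<exists>s\<in>S. \<exists>r\<in>carrier R. x = ?i s \<otimes>\<^bsub>\<L>\<^esub> ?g r"
    using assms
  proof (induction x rule: localization_induct)
    case zero
    have "\<zero>\<^bsub>\<L>\<^esub> = ?i \<one> \<otimes>\<^bsub>\<L>\<^esub> ?g \<zero>" using ic[OF one_in_S] by simp
    then show ?case using one_in_S by blast
  next
    case one
    have "\<one>\<^bsub>\<L>\<^esub> = ?i \<one> \<otimes>\<^bsub>\<L>\<^esub> ?g \<one>" using localization_inverse_left[OF one_in_S] by simp
    then show ?case using one_in_S by blast
  next
    case (coeff r x)
    then obtain t q where t: "t \<in> S" "q \<in> carrier R" "x = ?i t \<otimes>\<^bsub>\<L>\<^esub> ?g q" by blast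
    obtain y where y: "y \<in> carrier R" "t \<otimes> r = y \<otimes> t" using normal_leftE[OF t(1) coeff(1)] .
    \<comment> \<open>From \<open>t \<otimes> r = y \<otimes> t\<close> follows
      \<open>r t^-1 = t^-1 y\<close>, which brings the inverse to the front.\<close>
    have "?g r \<otimes>\<^bsub>\<L>\<^esub> ?i t = ?i t \<otimes>\<^bsub>\<L>\<^esub> ?g (t \<otimes> r) \<otimes>\<^bsub>\<L>\<^esub> ?i t"
    proof -
      have "?i t \<otimes>\<^bsub>\<L>\<^esub> ?g (t \<otimes> r) \<otimes>\<^bsub>\<L>\<^esub> ?i t = (?i t \<otimes>\<^bsub>\<L>\<^esub> ?g t) \<otimes>\<^bsub>\<L>\<^esub> ?g r \<otimes>\<^bsub>\<L>\<^esub> ?i t"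
        using t coeff(1) ic[OF t(1)] by (simp add: g.S.m_assoc)
      then show ?thesis using localization_inverse_left[OF t(1)] ic[OF t(1)] coeff(1) by simp
    qed
    also have "\<dots> = ?i t \<otimes>\<^bsub>\<L>\<^esub> ?g y \<otimes>\<^bsub>\<L>\<^esub> (?g t \<otimes>\<^bsub>\<L>\<^esub> ?i t)"
      unfolding y(2) using t y(1) ic[OF t(1)] by (simp add: g.S.m_assoc)
    also have "\<dots> = ?i t \<otimes>\<^bsub>\<L>\<^esub> ?g y"
      using localization_inverse_right[OF t(1)] ic[OF t(1)] y(1) by simp
    finally have "?g r \<otimes>\<^bsub>\<L>\<^esub> ?i t = ?i t \<otimes>\<^bsub>\<L>\<^esub> ?g y" .
    moreover have "?g r \<otimes>\<^bsub>\<L>\<^esub> x = (?g r \<otimes>\<^bsub>\<L>\<^esub> ?i t) \<otimes>\<^bsub>\<L>\<^esub> ?g q"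
      using t coeff(1) ic[OF t(1)] by (simp add: g.S.m_assoc)
    ultimately have "?g r \<otimes>\<^bsub>\<L>\<^esub> x = ?i t \<otimes>\<^bsub>\<L>\<^esub> ?g (y \<otimes> q)"
      using t(2) y(1) ic[OF t(1)] by (simp add: g.S.m_assoc)
    then show ?case using t(1,2) y(1) m_closed by blast
  next
    case (inverse s x)
    then obtain t q where t: "t \<in> S" "q \<in> carrier R" "x = ?i t \<otimes>\<^bsub>\<L>\<^esub> ?g q" by blast
    have ts: "t \<otimes> s \<in> S" using t inverse(1) by simp
    have "?i s \<otimes>\<^bsub>\<L>\<^esub> ?i t = ?i (t \<otimes> s) \<otimes>\<^bsub>\<L>\<^esub> ?g t \<otimes>\<^bsub>\<L>\<^esub> ?i t"
      using localization_inverse_mult[OF inverse(1) S_closed[OF t(1)] ts] by simp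
    also have "\<dots> = ?i (t \<otimes> s) \<otimes>\<^bsub>\<L>\<^esub> (?g t \<otimes>\<^bsub>\<L>\<^esub> ?i t)"
      using t(1) ic[OF t(1)] ic[OF ts] by (simp add: g.S.m_assoc)
    also have "\<dots> = ?i (t \<otimes> s)" using localization_inverse_right[OF t(1)] ic[OF ts] by simp
    finally have "?i s \<otimes>\<^bsub>\<L>\<^esub> x = ?i (t \<otimes> s) \<otimes>\<^bsub>\<L>\<^esub> ?g q"
      using t ic[OF t(1)] ic[OF inverse(1)] by (simp add: g.S.m_assoc[symmetric])
    then show ?case using ts t(2) by blast
  next
    case (diff x y)
    then obtain s r t q where s: "s \<in> S" "r \<in> carrier R" "x = ?i s \<otimes>\<^bsub>\<L>\<^esub> ?g r"
      and t: "t \<in> S" "q \<in> carrier R" "y = ?i t \<otimes>\<^bsub>\<L>\<^esub> ?g q" by blast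
    obtain b where b: "b \<in> carrier R" "t \<otimes> s = b \<otimes> t" using normal_leftE[OF t(1) S_closed[OF s(1)]] .
    have ts: "t \<otimes> s \<in> S" "b \<otimes> t \<in> S" using s(1) t(1) b(2)[symmetric] by simp_all
    have "?i s = ?i (t \<otimes> s) \<otimes>\<^bsub>\<L>\<^esub> ?g t"
      using localization_inverse_mult[OF s(1) S_closed[OF t(1)] ts(1)] by simp
    then have x: "x = ?i (t \<otimes> s) \<otimes>\<^bsub>\<L>\<^esub> ?g (t \<otimes> r)"
      unfolding s(3) using ic[OF ts(1)] s(2) t(1) by (simp add: g.S.m_assoc)
    have "?i t = ?i (t \<otimes> s) \<otimes>\<^bsub>\<L>\<^esub> ?g b"
      using localization_inverse_mult[OF t(1) b(1) ts(2)] b(2) by simp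
    then have "y = ?i (t \<otimes> s) \<otimes>\<^bsub>\<L>\<^esub> ?g (b \<otimes> q)"
      unfolding t(3) using ic[OF ts(1)] t(2) b(1) by (simp add: g.S.m_assoc)
    then have "x \<ominus>\<^bsub>\<L>\<^esub> y = ?i (t \<otimes> s) \<otimes>\<^bsub>\<L>\<^esub> ?g (t \<otimes> r \<ominus> b \<otimes> q)"
      using x ic[OF ts(1)] s(2) t(1,2) b(1)
      by (simp add: minus_eq g.S.minus_eq g.S.r_distr g.S.r_minus)
    then show ?case using ts(1) s(2) t(1,2) b(1) S_closed minus_closed m_closed by blast
  qed
  then show thesis using that by blast
qed

text \<open>The image of \<open>r\<close> is recovered from that of
  \<open>s \<otimes> r \<otimes> t = \<zero>\<close> by multiplying with inverses on both
  sides.\<close>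

lemma localization_hom_torsion:
  assumes "r \<in> two_sided_torsion R S"
  shows "localization_hom R S r = \<zero>\<^bsub>\<L>\<^esub>"
proof -
  let ?g = "localization_hom R S" and ?i = "localization_inverse R S"
  interpret g: ring_hom_ring R \<L> ?g by (rule ring_hom_localization_hom)
  obtain s t where r: "r \<in> carrier R" "s \<in> S" "t \<in> S" "s \<otimes> r \<otimes> t = \<zero>"
    using assms by (auto simp: two_sided_torsion_def)
  note ic = localization_inverse_closed[OF r(2)] localization_inverse_closed[OF r(3)]
  have "?g r = (?i s \<otimes>\<^bsub>\<L>\<^esub> ?g s) \<otimes>\<^bsub>\<L>\<^esub> ?g r \<otimes>\<^bsub>\<L>\<^esub> (?g t \<otimes>\<^bsub>\<L>\<^esub> ?i t)"
    using r localization_inverse_left[OF r(2)] localization_inverse_right[OF r(3)] by simp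
  also have "\<dots> = ?i s \<otimes>\<^bsub>\<L>\<^esub> ?g (s \<otimes> r \<otimes> t) \<otimes>\<^bsub>\<L>\<^esub> ?i t"
    using r(1-3) ic by (simp add: g.S.m_assoc)
  finally show ?thesis unfolding r(4) using ic by simp
qed

end

text \<open>The kernel of \<open>h\<close> consists of torsion, which the localization kills;
  together with regularity of the image of \<open>S\<close> this makes the two rings agree.\<close>

locale fractions_localization = normal_submonoid R S + h: ring_epi R T h + T: normal_regular_set T "h ` S"
  for R S T h +
  assumes ker_torsion: "r \<in> carrier R \<Longrightarrow> h r = \<zero>\<^bsub>T\<^esub> \<Longrightarrow> r \<in> two_sided_torsion R S"
begin

text \<open>A map \<open>\<rho>\<close> in the opposite direction comes from the universal property.
  It is bijective, and \<open>fractions_to_localization\<close> is its inverse; injectivity of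
  \<open>\<rho>\<close> is also what makes the latter well defined.\<close>

lemma
  shows fractions_to_localization_iso:
      "fractions_to_localization R S T h \<in> ring_iso (frac_ring T (h ` S)) \<L>"
    and fractions_to_localization_frac_hom: "r \<in> carrier R \<Longrightarrow>
      fractions_to_localization R S T h (frac_hom T (h ` S) (h r)) = localization_hom R S r"
proof -
  let ?g = "localization_hom R S" and ?i = "localization_inverse R S"
  let ?Q = "frac_ring T (h ` S)" and ?s = "fractions_to_localization R S T h"
  interpret g: ring_hom_ring R \<L> ?g by (rule ring_hom_localization_hom)
  interpret f: ring_hom_ring T ?Q "frac_hom T (h ` S)" by (rule T.ring_hom_frac_hom)
  interpret fh: ring_hom_ring R ?Q "frac_hom T (h ` S) \<circ> h"
    by (rule ring_hom_ring_compose[OF h.ring_hom_ring_axioms T.ring_hom_frac_hom])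
  have inv: "frac T (h ` S) \<one>\<^bsub>T\<^esub> (h s) \<otimes>\<^bsub>?Q\<^esub> frac T (h ` S) (h s) \<one>\<^bsub>T\<^esub> = \<one>\<^bsub>?Q\<^esub>"
    "frac T (h ` S) (h s) \<one>\<^bsub>T\<^esub> \<otimes>\<^bsub>?Q\<^esub> frac T (h ` S) \<one>\<^bsub>T\<^esub> (h s) = \<one>\<^bsub>?Q\<^esub>" if s: "s \<in> S" for s
  proof -
    have hs: "h s \<in> h ` S" "h s \<in> carrier T" using s by simp_all
    have "frac T (h ` S) \<one>\<^bsub>T\<^esub> (h s) \<otimes>\<^bsub>?Q\<^esub> frac T (h ` S) (h s) \<one>\<^bsub>T\<^esub> = frac T (h ` S) (\<one>\<^bsub>T\<^esub> \<otimes>\<^bsub>T\<^esub> \<one>\<^bsub>T\<^esub>) (\<one>\<^bsub>T\<^esub> \<otimes>\<^bsub>T\<^esub> \<one>\<^bsub>T\<^esub>)"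
      using hs by (intro T.frac_mult) (auto simp del: h.hom_one)
    then show "frac T (h ` S) \<one>\<^bsub>T\<^esub> (h s) \<otimes>\<^bsub>?Q\<^esub> frac T (h ` S) (h s) \<one>\<^bsub>T\<^esub> = \<one>\<^bsub>?Q\<^esub>"
      using T.frac_ring_one[OF T.one_in_S] by simp
    have "frac T (h ` S) (h s) \<one>\<^bsub>T\<^esub> \<otimes>\<^bsub>?Q\<^esub> frac T (h ` S) \<one>\<^bsub>T\<^esub> (h s) = frac T (h ` S) (\<one>\<^bsub>T\<^esub> \<otimes>\<^bsub>T\<^esub> h s) (\<one>\<^bsub>T\<^esub> \<otimes>\<^bsub>T\<^esub> h s)"
      using hs by (intro T.frac_mult) auto
    then show "frac T (h ` S) (h s) \<one>\<^bsub>T\<^esub> \<otimes>\<^bsub>?Q\<^esub> frac T (h ` S) \<one>\<^bsub>T\<^esub> (h s) = \<one>\<^bsub>?Q\<^esub>"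
      using T.frac_ring_one[OF hs(1)] hs by simp
  qed
  have gen: "frac T (h ` S) (h s) \<one>\<^bsub>T\<^esub> \<in> carrier ?Q"
    "(frac_hom T (h ` S) \<circ> h) s \<otimes>\<^bsub>?Q\<^esub> frac T (h ` S) (h s) \<one>\<^bsub>T\<^esub> = \<one>\<^bsub>?Q\<^esub>"
    "frac T (h ` S) (h s) \<one>\<^bsub>T\<^esub> \<otimes>\<^bsub>?Q\<^esub> (frac_hom T (h ` S) \<circ> h) s = \<one>\<^bsub>?Q\<^esub>" if "s \<in> S" for s
    using that inv[OF that] by (simp_all add: frac_hom_def)
  obtain \<rho> where \<rho>: "ring_hom_ring \<L> ?Q \<rho>"
    and \<rho>g: "\<And>r. r \<in> carrier R \<Longrightarrow> \<rho> (?g r) = (frac_hom T (h ` S) \<circ> h) r"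
    and \<rho>i: "\<And>s. s \<in> S \<Longrightarrow> \<rho> (?i s) = frac T (h ` S) (h s) \<one>\<^bsub>T\<^esub>"
    by (rule localization_universal[OF fh.ring_hom_ring_axioms gen]) auto
  interpret \<rho>: ring_hom_ring \<L> ?Q \<rho> by (rule \<rho>)
  have \<rho>_frac: "\<rho> (?i s \<otimes>\<^bsub>\<L>\<^esub> ?g r) = frac T (h ` S) (h s) (h r)" if sr: "s \<in> S" "r \<in> carrier R" for s r
  proof -
    have "frac T (h ` S) (h s) \<one>\<^bsub>T\<^esub> \<otimes>\<^bsub>?Q\<^esub> frac T (h ` S) \<one>\<^bsub>T\<^esub> (h r) = frac T (h ` S) (\<one>\<^bsub>T\<^esub> \<otimes>\<^bsub>T\<^esub> h s) (\<one>\<^bsub>T\<^esub> \<otimes>\<^bsub>T\<^esub> h r)"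
      using sr by (intro T.frac_mult) auto
    then show ?thesis using sr localization_inverse_closed[OF sr(1)] by (simp add: \<rho>g \<rho>i frac_hom_def)
  qed
  \<comment> \<open>In the ring of fractions only a zero numerator gives zero, and
    \<open>h r = \<zero>\<close> makes \<open>r\<close> torsion, so it already vanishes in the
    localization.\<close>
  have zero: "x = \<zero>\<^bsub>\<L>\<^esub>" if x: "x \<in> carrier \<L>" "\<rho> x = \<zero>\<^bsub>?Q\<^esub>" for x
  proof -
    obtain s r where sr: "s \<in> S" "r \<in> carrier R" "x = ?i s \<otimes>\<^bsub>\<L>\<^esub> ?g r" using localization_carrierE[OF x(1)] .
    have "h r = \<zero>\<^bsub>T\<^esub>" using T.frac_eq_zero_iff[of "h s" "h r"] x(2) sr \<rho>_frac by simp
    then have "?g r = \<zero>\<^bsub>\<L>\<^esub>" using localization_hom_torsion[OF ker_torsion[OF sr(2)]] by simp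
    then show ?thesis using sr localization_inverse_closed[OF sr(1)] by simp
  qed
  have inj: "x = y" if xy: "x \<in> carrier \<L>" "y \<in> carrier \<L>" "\<rho> x = \<rho> y" for x y
    using zero[of "x \<ominus>\<^bsub>\<L>\<^esub> y"] \<rho>.hom_minus_eq_iff[OF xy(1,2)] xy by simp
  have inverse: "?s (\<rho> x) = x" if x: "x \<in> carrier \<L>" for x
  proof -
    obtain s r where sr: "s \<in> S" "r \<in> carrier R" "x = ?i s \<otimes>\<^bsub>\<L>\<^esub> ?g r" using localization_carrierE[OF x] .
    let ?f = "\<lambda>(s, r). frac T (h ` S) (h s) (h r)" and ?k = "\<lambda>(s, r). ?i s \<otimes>\<^bsub>\<L>\<^esub> ?g r"
    have "induced (S \<times> carrier R) ?f ?k (?f (s, r)) = ?k (s, r)"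
    proof (rule induced_eqI)
      fix z assume z: "z \<in> S \<times> carrier R" "?f z = ?f (s, r)"
      obtain s' r' where z': "z = (s', r')" "s' \<in> S" "r' \<in> carrier R" using z(1) by auto
      have "\<rho> (?i s' \<otimes>\<^bsub>\<L>\<^esub> ?g r') = \<rho> (?i s \<otimes>\<^bsub>\<L>\<^esub> ?g r)"
        using \<rho>_frac[OF z'(2,3)] \<rho>_frac[OF sr(1,2)] z(2) z'(1) by simp
      then show "?k z = ?k (s, r)"
        using inj[OF g.S.m_closed[OF localization_inverse_closed[OF z'(2)] g.hom_closed[OF z'(3)]]
            g.S.m_closed[OF localization_inverse_closed[OF sr(1)] g.hom_closed[OF sr(2)]]] z'(1) by simp
    qed (use sr in simp)
    then show ?thesis unfolding fractions_to_localization_def using sr \<rho>_frac[OF sr(1,2)] by simp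
  qed
  have surj: "\<exists>x\<in>carrier \<L>. y = \<rho> x" if y: "y \<in> carrier ?Q" for y
  proof -
    obtain t q where y: "t \<in> h ` S" "q \<in> carrier T" "y = frac T (h ` S) t q" using T.frac_ring_carrierE[OF y] .
    obtain s where s: "s \<in> S" "t = h s" using y(1) by auto
    obtain r where r: "r \<in> carrier R" "q = h r" using y(2) h.surj by (metis imageE)
    have "y = \<rho> (?i s \<otimes>\<^bsub>\<L>\<^esub> ?g r)" using \<rho>_frac[OF s(1) r(1)] y s r by simp
    then show ?thesis using g.S.m_closed[OF localization_inverse_closed[OF s(1)] g.hom_closed[OF r(1)]] by blast
  qed
  show "?s \<in> ring_iso ?Q \<L>"
  proof (rule ring_iso_memI)
    fix y assume "y \<in> carrier ?Q"
    then obtain x where x: "x \<in> carrier \<L>" "y = \<rho> x" using surj by blast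
    then show "?s y \<in> carrier \<L>" by (simp add: inverse)
    fix y' assume "y' \<in> carrier ?Q"
    then obtain x' where x': "x' \<in> carrier \<L>" "y' = \<rho> x'" using surj by blast
    show "?s (y \<otimes>\<^bsub>?Q\<^esub> y') = ?s y \<otimes>\<^bsub>\<L>\<^esub> ?s y'"
      using x x' inverse[of "x \<otimes>\<^bsub>\<L>\<^esub> x'"] by (simp add: inverse)
    show "?s (y \<oplus>\<^bsub>?Q\<^esub> y') = ?s y \<oplus>\<^bsub>\<L>\<^esub> ?s y'"
      using x x' inverse[of "x \<oplus>\<^bsub>\<L>\<^esub> x'"] by (simp add: inverse)
  next
    show "?s \<one>\<^bsub>?Q\<^esub> = \<one>\<^bsub>\<L>\<^esub>" using inverse[of "\<one>\<^bsub>\<L>\<^esub>"] by simp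
    show "bij_betw ?s (carrier ?Q) (carrier \<L>)"
    proof (rule bij_betw_byWitness[where f' = \<rho>])
      show "\<forall>y\<in>carrier ?Q. \<rho> (?s y) = y" using surj inverse by metis
      show "?s ` carrier ?Q \<subseteq> carrier \<L>" using surj inverse by (metis image_subsetI)
    qed (use inverse in auto)
  qed
  show "?s (frac_hom T (h ` S) (h r)) = ?g r" if "r \<in> carrier R"
    using inverse[OF g.hom_closed[OF that]] \<rho>g[OF that] by simp
qed

end

section \<open>The tower of quotients of a localization\<close>

locale normal_submonoid_finite = normal_submonoid +
  assumes finite_minimal_primes_over: "finite (minimal_primes_over R (two_sided_torsion R S))"
begin

text \<open>\<open>R1\<close> and \<open>R2\<close> are \<open>R/\<aa>\<close> and its quotient by the prime radical, \<open>Q1\<close> and \<open>Q2\<close> their rings of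
  fractions, and \<open>Tp p\<close> is the image of \<open>S\<close> in \<open>R/p\<close>.\<close>

abbreviation (input) "\<aa> \<equiv> two_sided_torsion R S"
abbreviation (input) "\<mm> \<equiv> minimal_primes_over R \<aa>"
abbreviation (input) "R1 \<equiv> R Quot \<aa>"
abbreviation (input) "\<pi>1 \<equiv> (+>) \<aa>"
abbreviation (input) "S1 \<equiv> \<pi>1 ` S"
abbreviation (input) "n1 \<equiv> prime_radical R1"
abbreviation (input) "Q1 \<equiv> frac_ring R1 S1"
abbreviation (input) "R2 \<equiv> R1 Quot n1"
abbreviation (input) "\<pi>2 \<equiv> (+>\<^bsub>R1\<^esub>) n1"
abbreviation (input) "S2 \<equiv> \<pi>2 ` S1"
abbreviation (input) "Q2 \<equiv> frac_ring R2 S2"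
abbreviation (input) "Sn1 \<equiv> frac_ideal R1 S1 n1"
abbreviation (input) "Sp1 p \<equiv> frac_ideal R1 S1 (\<pi>1 ` p)"
abbreviation (input) "Sp2 p \<equiv> frac_ideal R2 S2 (\<pi>2 ` \<pi>1 ` p)"
abbreviation (input) "nQ1 \<equiv> prime_radical Q1"
abbreviation (input) "F12 \<equiv> frac_map R1 S1 R2 S2 \<pi>2"
abbreviation (input) "Rp p \<equiv> R Quot p"
abbreviation (input) "Tp p \<equiv> (+>) p ` S"
abbreviation (input) "Qp p \<equiv> frac_ring (Rp p) (Tp p)"
abbreviation (input) "\<pi>2p p \<equiv> induced (carrier R) (\<pi>2 \<circ> \<pi>1) ((+>) p)"
abbreviation (input) "F2p p \<equiv> frac_map R2 S2 (Rp p) (Tp p) (\<pi>2p p)"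
abbreviation (input) "qn \<equiv> (+>\<^bsub>Q1\<^esub>) Sn1"
abbreviation (input) "qr \<equiv> (+>\<^bsub>Q1\<^esub>) nQ1"
abbreviation (input) "qp1 p \<equiv> (+>\<^bsub>Q1\<^esub>) (Sp1 p)"
abbreviation (input) "qp2 p \<equiv> (+>\<^bsub>Q2\<^esub>) (Sp2 p)"
abbreviation (input) "\<sigma> \<equiv> fractions_to_localization R S R1 \<pi>1"

sublocale a: ideal \<aa> R
  by (rule saturatedD(1)[OF saturated_two_sided_torsion])

sublocale h1: ring_epi R R1 \<pi>1
  by (rule a.ring_epi_coset)

lemma ring_R1: "ring R1"
  by (rule a.quotient_is_ring)

lemma normal_regular_set_R1: "normal_regular_set R1 S1"
  by (rule normal_regular_set_quotient[OF saturated_two_sided_torsion two_sided_torsion_disjoint])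

lemma bij_min1: "bij_betw ((`) \<pi>1) \<mm> (minimal_primes R1)"
  by (rule a.bij_betw_minimal_primes_quotient)

lemma normal_regular_set_finite_R1: "normal_regular_set_finite R1 S1"
  using normal_regular_set_R1 bij_betw_finite[OF bij_min1] finite_minimal_primes_over
  by (simp add: normal_regular_set_finite_def normal_regular_set_finite_axioms_def)

sublocale N1: normal_regular_set_finite R1 S1
  by (rule normal_regular_set_finite_R1)

sublocale n: ideal n1 R1
  by (rule ring.prime_radical_ideal[OF ring_R1])

sublocale h2: ring_epi R1 R2 \<pi>2
  by (rule n.ring_epi_coset)

lemma bij_min2: "bij_betw ((`) \<pi>2) (minimal_primes R1) (minimal_primes R2)"
  using n.bij_betw_minimal_primes_quotient unfolding ring.minimal_primes_over_prime_radical[OF ring_R1] .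

lemma normal_regular_set_finite_R2: "normal_regular_set_finite R2 S2"
  using N1.normal_regular_set_quotient[OF N1.saturated_prime_radical N1.prime_radical_disjoint]
    bij_betw_finite[OF bij_min2] N1.finite_minimal_primes
  by (simp add: normal_regular_set_finite_def normal_regular_set_finite_axioms_def)

sublocale N2: normal_regular_set_finite R2 S2
  by (rule normal_regular_set_finite_R2)

sublocale e12: frac_epi R1 S1 R2 S2 \<pi>2
  by unfold_locales simp

lemma ring_epi_F12: "ring_epi Q1 Q2 F12"
  by (rule e12.ring_epi_frac_map)

lemma F12_eq_zero_iff: "x \<in> carrier Q1 \<Longrightarrow> F12 x = \<zero>\<^bsub>Q2\<^esub> \<longleftrightarrow> x \<in> Sn1"
  by (rule e12.frac_map_eq_zero_iff[OF N1.saturated_prime_radical n.coset_eq_zero_iff])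

lemma ideal_Sn1: "ideal Sn1 Q1"
  by (rule N1.ideal_frac_ideal[OF N1.saturated_prime_radical])

lemma ring_Q1: "ring Q1" and ring_Q2: "ring Q2"
  by (rule N1.ring_frac_ring, rule N2.ring_frac_ring)

text \<open>\<open>R2\<close> is semiprime, so the nilpotent case applies to it.\<close>

lemma bij_min_Q2: "bij_betw Sp2 \<mm> (minimal_primes Q2)"
proof -
  have "ideal_power R2 (prime_radical R2) (Suc 0) = {\<zero>\<^bsub>R2\<^esub>}"
    unfolding ring.prime_radical_quotient[OF ring_R1] by (rule ring.ideal_power_zero[OF n.quotient_is_ring])
  then have "minimal_primes Q2 = frac_ideal R2 S2 ` minimal_primes R2"
    by (rule N2.minimal_primes_frac_ring)
  then have "bij_betw (frac_ideal R2 S2) (minimal_primes R2) (minimal_primes Q2)"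
    using N2.inj_on_frac_ideal by (simp add: bij_betw_def)
  from bij_betw_trans[OF bij_betw_trans[OF bij_min1 bij_min2] this] show ?thesis
    by (simp add: comp_def)
qed

text \<open>The kernel of \<open>F12\<close> is exactly the localized radical: one inclusion makes
  the induced map well defined, the other makes it injective.\<close>

lemma induced_phi: "induced_hom Q1 (Q1 Quot Sn1) qn Q2 F12"
  by (rule induced_hom.intro[OF ideal.ring_epi_coset[OF ideal_Sn1] ring_epi.axioms(1)[OF ring_epi_F12]], unfold_locales)
     (simp add: F12_eq_zero_iff ideal.coset_eq_zero_iff[OF ideal_Sn1])

lemma phi_iso: "induced (carrier Q1) qn F12 \<in> ring_iso (Q1 Quot Sn1) Q2"
  by (rule induced_hom.induced_ring_iso[OF induced_phi])
     (auto simp: ring_epi.surj[OF ring_epi_F12] F12_eq_zero_iff ideal.coset_eq_zero_iff[OF ideal_Sn1])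

lemmas phi_apply = induced_hom.induced_apply[OF induced_phi]

lemma fractions_localization: "fractions_localization R S R1 \<pi>1"
  by unfold_locales (simp add: a.coset_eq_zero_iff)

lemmas sigma_iso = fractions_localization.fractions_to_localization_iso[OF fractions_localization]
lemmas sigma_frac_hom = fractions_localization.fractions_to_localization_frac_hom[OF fractions_localization]

lemma ring_epi_sigma: "ring_epi Q1 \<L> \<sigma>"
  by (rule ring_iso_imp_ring_epi[OF ring_Q1 ring_localization sigma_iso])

lemma sigma_eq_zero_iff: "z \<in> carrier Q1 \<Longrightarrow> \<sigma> z = \<zero>\<^bsub>\<L>\<^esub> \<longleftrightarrow> z \<in> {\<zero>\<^bsub>Q1\<^esub>}"
  by (rule ring_iso_eq_zero_iff[OF ring_Q1 ring_localization sigma_iso])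

lemma Sp1_prime:
  assumes "p \<in> \<mm>"
  shows "Sp1 p \<in> prime_spectrum Q1" "\<sigma> ` Sp1 p \<in> prime_spectrum \<L>"
proof -
  have p: "\<pi>1 ` p \<in> minimal_primes R1" using bij_betw_apply[OF bij_min1 assms] .
  show *: "Sp1 p \<in> prime_spectrum Q1"
    by (rule N1.prime_frac_ideal[OF N1.saturated_minimal_prime[OF p] minimal_primes_prime[OF p]])
  have id: "ideal (Sp1 p) Q1" using * by (rule prime_spectrumD)
  have "z \<in> Sp1 p" if "z \<in> carrier Q1" "\<sigma> z = \<zero>\<^bsub>\<L>\<^esub>" for z
    using sigma_eq_zero_iff[OF that(1)] that(2) ideal.zero_mem[OF id] by simp
  then show "\<sigma> ` Sp1 p \<in> prime_spectrum \<L>"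
    using ring_epi.prime_image_iff[OF ring_epi_sigma id] * by blast
qed

lemma inj_Sp1: "inj_on Sp1 \<mm>"
  using comp_inj_on[OF bij_betw_imp_inj_on[OF bij_min1]] N1.inj_on_frac_ideal
  unfolding bij_betw_imp_surj_on[OF bij_min1, symmetric] by (auto simp: comp_def)

lemma inj_sigma_Sp1: "inj_on (\<lambda>p. \<sigma> ` Sp1 p) \<mm>"
proof (rule inj_onI)
  fix p q assume pq: "p \<in> \<mm>" "q \<in> \<mm>" "\<sigma> ` Sp1 p = \<sigma> ` Sp1 q"
  have sub: "Sp1 p \<subseteq> carrier Q1" if "p \<in> \<mm>" for p
    by (rule subsetI) (rule ideal.Icarr[OF prime_spectrumD(1)[OF Sp1_prime(1)[OF that]]])
  have "inj_on \<sigma> (carrier Q1)" using sigma_iso by (simp add: ring_iso_def bij_betw_def)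
  then have "Sp1 p = Sp1 q" using inj_on_image_eq_iff[of \<sigma> "carrier Q1" "Sp1 p" "Sp1 q"] sub[OF pq(1)] sub[OF pq(2)] pq(3) by simp
  then show "p = q" using inj_onD[OF inj_Sp1 _ pq(1,2)] by simp
qed

lemma
  assumes "nilpotent_ideal R1 n1"
  shows bij_min_Q1: "bij_betw Sp1 \<mm> (minimal_primes Q1)"
    and bij_min_L: "bij_betw (\<lambda>p. \<sigma> ` Sp1 p) \<mm> (minimal_primes \<L>)"
    and nQ1_eq: "nQ1 = Sn1"
proof -
  obtain n where n: "ideal_power R1 n1 n = {\<zero>\<^bsub>R1\<^esub>}" using assms by (auto simp: nilpotent_ideal_def)
  show "nQ1 = Sn1" by (rule N1.prime_radical_frac_ring[OF n])
  have "bij_betw (frac_ideal R1 S1) (minimal_primes R1) (minimal_primes Q1)"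
    using N1.inj_on_frac_ideal N1.minimal_primes_frac_ring[OF n] by (simp add: bij_betw_def)
  from bij_betw_trans[OF bij_min1 this] show *: "bij_betw Sp1 \<mm> (minimal_primes Q1)"
    by (simp add: comp_def)
  have "bij_betw ((`) \<sigma>) (minimal_primes Q1) (minimal_primes \<L>)"
    using ring_epi.bij_betw_minimal_primes[OF ring_epi_sigma ring.zeroideal[OF ring_Q1] sigma_eq_zero_iff]
    unfolding ring.minimal_primes_eq_over_zero[OF ring_Q1] .
  from bij_betw_trans[OF * this] show "bij_betw (\<lambda>p. \<sigma> ` Sp1 p) \<mm> (minimal_primes \<L>)"
    by (simp add: comp_def)
qed

end

section \<open>The diagram at a fixed minimal prime\<close>

locale minimal_prime_over_torsion = normal_submonoid_finite +
  fixes p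
  assumes p_min: "p \<in> \<mm>"
begin

lemma p_prime: "p \<in> prime_spectrum R"
  using p_min by (rule minimal_primes_over_prime)

sublocale p: ideal p R
  using p_prime by (rule prime_spectrumD)

sublocale hp: ring_epi R "Rp p" "(+>) p"
  by (rule p.ring_epi_coset)

lemma p1_min: "\<pi>1 ` p \<in> minimal_primes R1"
  using bij_betw_apply[OF bij_min1 p_min] .

lemma p2_min: "\<pi>2 ` \<pi>1 ` p \<in> minimal_primes R2"
  using bij_betw_apply[OF bij_min2 p1_min] .

lemmas saturated_p1 = N1.saturated_minimal_prime[OF p1_min]
lemmas saturated_p2 = N2.saturated_minimal_prime[OF p2_min]

lemma n1_subset: "n1 \<subseteq> \<pi>1 ` p"
  using minimal_primes_prime[OF p1_min] by (auto simp: prime_radical_def)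

lemma mem_p1_iff: "r \<in> carrier R \<Longrightarrow> \<pi>1 r \<in> \<pi>1 ` p \<longleftrightarrow> r \<in> p"
proof (rule h1.mem_image_iff[OF p.is_ideal])
  have "\<aa> \<subseteq> p" using p_min by (simp add: minimal_primes_over_def)
  then show "z \<in> p" if "z \<in> carrier R" "\<pi>1 z = \<zero>\<^bsub>R1\<^esub>" for z
    using a.coset_eq_zero_iff[OF that(1)] that(2) by auto
qed

lemma mem_p2_iff: "x \<in> carrier R1 \<Longrightarrow> \<pi>2 x \<in> \<pi>2 ` \<pi>1 ` p \<longleftrightarrow> x \<in> \<pi>1 ` p"
proof (rule h2.mem_image_iff[OF N1.saturatedD(1)[OF saturated_p1]])
  show "z \<in> \<pi>1 ` p" if "z \<in> carrier R1" "\<pi>2 z = \<zero>\<^bsub>R2\<^esub>" for z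
    using n.coset_eq_zero_iff[OF that(1)] that(2) n1_subset by auto
qed

text \<open>A common element would map into the image of \<open>p\<close> and into
  \<open>S1\<close>, which are disjoint because \<open>S1\<close> is regular.\<close>

lemma p_disjoint: "p \<inter> S = {}"
  using N1.minimal_prime_disjoint[OF N1.finite_minimal_primes p1_min] by blast

sublocale Np: normal_regular_set "Rp p" "Tp p"
  by (rule normal_regular_set_quotient[OF saturated_prime[OF p_prime p_disjoint] p_disjoint])

lemma induced_pi2p: "induced_hom R R2 (\<pi>2 \<circ> \<pi>1) (Rp p) ((+>) p)"
proof (rule induced_hom.intro[OF ring_epi_compose[OF h1.ring_epi_axioms h2.ring_epi_axioms] hp.ring_hom_ring_axioms],
    unfold_locales)
  fix x assume x: "x \<in> carrier R" "(\<pi>2 \<circ> \<pi>1) x = \<zero>\<^bsub>R2\<^esub>"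
  have "\<pi>1 x \<in> n1" using n.coset_eq_zero_iff[OF h1.hom_closed[OF x(1)]] x(2) by simp
  then have "x \<in> p" using n1_subset mem_p1_iff[OF x(1)] by auto
  then show "p +> x = \<zero>\<^bsub>Rp p\<^esub>" using p.coset_eq_zero_iff[OF x(1)] by simp
qed

lemmas pi2p_apply = induced_hom.induced_apply[OF induced_pi2p, simplified comp_apply]

sublocale h2p: ring_epi R2 "Rp p" "\<pi>2p p"
  by (rule induced_hom.ring_epi_induced[OF induced_pi2p hp.surj])

sublocale e2p: frac_epi R2 S2 "Rp p" "Tp p" "\<pi>2p p"
proof unfold_locales
  have "\<pi>2p p (\<pi>2 (\<pi>1 s)) = p +> s" if "s \<in> S" for s using pi2p_apply[of s] that by simp
  then show "\<pi>2p p ` S2 = Tp p" by (simp add: image_image)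
qed

lemma pi2p_eq_zero_iff:
  assumes "x \<in> carrier R2"
  shows "\<pi>2p p x = \<zero>\<^bsub>Rp p\<^esub> \<longleftrightarrow> x \<in> \<pi>2 ` \<pi>1 ` p"
proof -
  obtain y where y: "y \<in> carrier R1" "x = \<pi>2 y" using assms h2.surj by (metis imageE)
  obtain r where r: "r \<in> carrier R" "y = \<pi>1 r" using y(1) h1.surj by (metis imageE)
  show ?thesis
    unfolding y(2) r(2) using pi2p_apply[OF r(1)] p.coset_eq_zero_iff[OF r(1)] mem_p1_iff[OF r(1)] mem_p2_iff[OF y(1)] r(2)
    by simp
qed

lemma ideal_Sp1: "ideal (Sp1 p) Q1"
  by (rule N1.ideal_frac_ideal[OF saturated_p1])

lemma ideal_Sp2: "ideal (Sp2 p) Q2"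
  by (rule N2.ideal_frac_ideal[OF saturated_p2])

sublocale qSn: ring_epi Q1 "Q1 Quot Sn1" qn
  by (rule ideal.ring_epi_coset[OF ideal_Sn1])

sublocale qnQ: ring_epi Q1 "Q1 Quot nQ1" qr
  by (rule ideal.ring_epi_coset[OF ring.prime_radical_ideal[OF ring_Q1]])

sublocale qSp1: ring_epi Q1 "Q1 Quot Sp1 p" "qp1 p"
  by (rule ideal.ring_epi_coset[OF ideal_Sp1])

sublocale qSp2: ring_epi Q2 "Q2 Quot Sp2 p" "qp2 p"
  by (rule ideal.ring_epi_coset[OF ideal_Sp2])

lemma ring_epi_F2p: "ring_epi Q2 (Qp p) (F2p p)"
  by (rule e2p.ring_epi_frac_map)

lemma F2p_eq_zero_iff: "x \<in> carrier Q2 \<Longrightarrow> F2p p x = \<zero>\<^bsub>Qp p\<^esub> \<longleftrightarrow> x \<in> Sp2 p"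
  by (rule e2p.frac_map_eq_zero_iff[OF saturated_p2 pi2p_eq_zero_iff])

lemma F12_mem_Sp2_iff: "x \<in> carrier Q1 \<Longrightarrow> F12 x \<in> Sp2 p \<longleftrightarrow> x \<in> Sp1 p"
  by (rule e12.frac_map_mem_frac_ideal_iff[OF saturated_p1 saturated_p2 mem_p2_iff])

lemmas coset_zero_iffs = ideal.coset_eq_zero_iff[OF ideal_Sn1] ideal.coset_eq_zero_iff[OF ideal_Sp1]
  ideal.coset_eq_zero_iff[OF ideal_Sp2] ideal.coset_eq_zero_iff[OF ring.prime_radical_ideal[OF ring_Q1]]

lemma ring_epi_qF: "ring_epi Q1 (Q2 Quot Sp2 p) (qp2 p \<circ> F12)"
  by (rule ring_epi_compose[OF ring_epi_F12 qSp2.ring_epi_axioms])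

lemma F12_closed: "x \<in> carrier Q1 \<Longrightarrow> F12 x \<in> carrier Q2"
  using ring_hom_closed[OF ring_hom_ring.homh[OF ring_epi.axioms(1)[OF ring_epi_F12]]] .

lemma induced_psi: "induced_hom Q2 (Q2 Quot Sp2 p) (qp2 p) (Qp p) (F2p p)"
  by (rule induced_hom.intro[OF qSp2.ring_epi_axioms ring_epi.axioms(1)[OF ring_epi_F2p]], unfold_locales)
     (simp add: F2p_eq_zero_iff coset_zero_iffs)

lemma induced_alpha: "induced_hom Q1 (Q1 Quot nQ1) qr (Q1 Quot Sn1) qn"
  by (rule induced_hom.intro[OF qnQ.ring_epi_axioms qSn.ring_hom_ring_axioms], unfold_locales)
     (use N1.prime_radical_frac_ring_subset in \<open>auto simp: coset_zero_iffs\<close>)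

lemma induced_beta: "induced_hom Q1 (Q1 Quot Sn1) qn (Q2 Quot Sp2 p) (qp2 p \<circ> F12)"
proof (rule induced_hom.intro[OF qSn.ring_epi_axioms ring_epi.axioms(1)[OF ring_epi_qF]], unfold_locales)
  fix x assume x: "x \<in> carrier Q1" "Sn1 +>\<^bsub>Q1\<^esub> x = \<zero>\<^bsub>Q1 Quot Sn1\<^esub>"
  then have "F12 x = \<zero>\<^bsub>Q2\<^esub>" using coset_zero_iffs(1)[OF x(1)] F12_eq_zero_iff[OF x(1)] by simp
  then show "(qp2 p \<circ> F12) x = \<zero>\<^bsub>Q2 Quot Sp2 p\<^esub>" using qSp2.hom_zero by simp
qed

lemma induced_gamma: "induced_hom Q1 (Q1 Quot Sn1) qn (Q1 Quot Sp1 p) (qp1 p)"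
proof (rule induced_hom.intro[OF qSn.ring_epi_axioms qSp1.ring_hom_ring_axioms], unfold_locales)
  have "Sn1 \<subseteq> Sp1 p"
    using N1.frac_ideal_subset_iff[OF N1.saturated_prime_radical saturated_p1] n1_subset by simp
  then show "Sp1 p +>\<^bsub>Q1\<^esub> x = \<zero>\<^bsub>Q1 Quot Sp1 p\<^esub>" if "x \<in> carrier Q1" "Sn1 +>\<^bsub>Q1\<^esub> x = \<zero>\<^bsub>Q1 Quot Sn1\<^esub>" for x
    using that(2) coset_zero_iffs(1,2)[OF that(1)] by auto
qed

text \<open>\<open>Sp1 p\<close> is the full preimage of \<open>Sp2 p\<close> under
  \<open>F12\<close>. One direction makes \<open>\<epsilon>\<close> well defined, the other makes it
  injective.\<close>

lemma qF_eq_zero_iff: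
  "x \<in> carrier Q1 \<Longrightarrow> (qp2 p \<circ> F12) x = \<zero>\<^bsub>Q2 Quot Sp2 p\<^esub> \<longleftrightarrow> Sp1 p +>\<^bsub>Q1\<^esub> x = \<zero>\<^bsub>Q1 Quot Sp1 p\<^esub>"
  using coset_zero_iffs(2)[of x] coset_zero_iffs(3)[OF F12_closed[of x]] F12_mem_Sp2_iff[of x] by simp

lemma induced_epsilon:
  "induced_hom Q1 (Q1 Quot Sp1 p) (qp1 p) (Q2 Quot Sp2 p) (qp2 p \<circ> F12)"
  by (rule induced_hom.intro[OF qSp1.ring_epi_axioms ring_epi.axioms(1)[OF ring_epi_qF]], unfold_locales)
     (simp only: qF_eq_zero_iff)

lemma psi_iso: "induced (carrier Q2) (qp2 p) (F2p p) \<in> ring_iso (Q2 Quot Sp2 p) (Qp p)"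
  by (rule induced_hom.induced_ring_iso[OF induced_psi ring_epi.surj[OF ring_epi_F2p]])
     (simp add: F2p_eq_zero_iff coset_zero_iffs)

lemma epsilon_iso:
  "induced (carrier Q1) (qp1 p) (qp2 p \<circ> F12) \<in> ring_iso (Q1 Quot Sp1 p) (Q2 Quot Sp2 p)"
  by (rule induced_hom.induced_ring_iso[OF induced_epsilon ring_epi.surj[OF ring_epi_qF]])
     (simp only: qF_eq_zero_iff)

text \<open>\<open>\<beta>\<close> is induced directly from \<open>Q1\<close>, so its factorization
  through \<open>\<phi>\<close> is checked on representatives in \<open>Q1\<close>.\<close>

lemma beta_eq:
  assumes "y \<in> carrier (Q1 Quot Sn1)"
  shows "induced (carrier Q1) qn (qp2 p \<circ> F12) y
    = Sp2 p +>\<^bsub>Q2\<^esub> induced (carrier Q1) qn F12 y"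
proof -
  obtain x where x: "x \<in> carrier Q1" "y = Sn1 +>\<^bsub>Q1\<^esub> x"
    using assms unfolding qSn.surj[symmetric] by (rule imageE)
  show ?thesis
    unfolding x(2) phi_apply[OF x(1)] induced_hom.induced_apply[OF induced_beta x(1)] by (rule comp_apply)
qed

lemma epsilon_gamma:
  assumes "y \<in> carrier (Q1 Quot Sn1)"
  shows "induced (carrier Q1) (qp1 p) (qp2 p \<circ> F12)
      (induced (carrier Q1) qn (qp1 p) y)
    = induced (carrier Q1) qn (qp2 p \<circ> F12) y"
proof -
  obtain x where x: "x \<in> carrier Q1" "y = Sn1 +>\<^bsub>Q1\<^esub> x"
    using assms unfolding qSn.surj[symmetric] by (rule imageE)
  show ?thesis
    unfolding x(2) induced_hom.induced_apply[OF induced_gamma x(1)] induced_hom.induced_apply[OF induced_beta x(1)]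
    by (rule induced_hom.induced_apply[OF induced_epsilon x(1)])
qed

text \<open>Bundled so that all claims about one minimal prime can be instantiated at once in the
  final proof.\<close>

lemmas diagram = Np.S_in_Den ideal_Sp1 ideal_Sp2 psi_iso epsilon_iso
  h1.ring_hom_ring_axioms h2.ring_hom_ring_axioms h2p.ring_hom_ring_axioms hp.ring_hom_ring_axioms
  N1.ring_hom_frac_hom N2.ring_hom_frac_hom Np.ring_hom_frac_hom
  ring_epi.axioms(1)[OF ring_epi_F12] ring_epi.axioms(1)[OF ring_epi_F2p]
  qnQ.ring_hom_ring_axioms qSn.ring_hom_ring_axioms qSp1.ring_hom_ring_axioms qSp2.ring_hom_ring_axioms
  induced_hom.induced_ring_hom[OF induced_alpha] induced_hom.induced_ring_hom[OF induced_beta]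
  induced_hom.induced_ring_hom[OF induced_gamma]
  pi2p_apply[symmetric] e12.frac_map_frac_hom e2p.frac_map_frac_hom phi_apply
  induced_hom.induced_apply[OF induced_psi] induced_hom.induced_apply[OF induced_alpha] beta_eq
  induced_hom.induced_apply[OF induced_gamma] epsilon_gamma

end

theorem theorem1p7:
  fixes R :: "('a, 'b) ring_scheme" and S :: "'a set"
  assumes "ring R"
    and "multiplicative_subset R S"
    and "generated_by_normal_elements R S"
    and "finite (minimal_primes_over R (two_sided_torsion R S))"
  shows
    "let \<aa> = two_sided_torsion R S;
         min\<aa> = minimal_primes_over R \<aa>;
         \<comment> \<open>\<open>R1\<close>, \<open>S1\<close>, \<open>n1\<close>, \<open>Q1\<close> are the ring \<open>R/\<aa>\<close>, the image of \<open>S\<close> in it,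
             its prime radical and its ring of fractions at \<open>S1\<close>\<close>
         R1 = R Quot \<aa>;
         \<pi> = (\<lambda>r. \<aa> +>\<^bsub>R\<^esub> r);
         S1 = \<pi> ` S;
         n1 = prime_radical R1;
         Q1 = frac_ring R1 S1;
         \<comment> \<open>\<open>R2\<close>, \<open>S2\<close>, \<open>Q2\<close> are the ring \<open>R1/n1\<close>, the image of \<open>S\<close> in it
             and its ring of fractions at \<open>S2\<close>\<close>
         R2 = R1 Quot n1;
         \<pi>2 = (\<lambda>x. n1 +>\<^bsub>R1\<^esub> x);
         S2 = \<pi>2 ` S1;
         Q2 = frac_ring R2 S2;
         \<comment> \<open>the localized ideals\<close>
         Sn1 = frac_ideal R1 S1 n1;
         Sp1 = (\<lambda>p. frac_ideal R1 S1 (\<pi> ` p));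
         Sp2 = (\<lambda>p. frac_ideal R2 S2 (\<pi>2 ` \<pi> ` p));
         nQ1 = prime_radical Q1;
         \<comment> \<open>the localization of \<open>R\<close> at \<open>S\<close> and its identification with \<open>Q1\<close>\<close>
         L = localization R S;
         \<sigma> = fractions_to_localization R S R1 \<pi>;
         \<comment> \<open>\<open>R/p\<close>, the image of \<open>S\<close> in it, and its ring of fractions\<close>
         Rp = (\<lambda>p. R Quot p);
         \<pi>p = (\<lambda>p r. p +>\<^bsub>R\<^esub> r);
         Qp = (\<lambda>p. frac_ring (Rp p) (\<pi>p p ` S));
         \<pi>2p = (\<lambda>p. induced (carrier R) (\<pi>2 \<circ> \<pi>) (\<pi>p p));
         \<comment> \<open>localization maps, and maps between rings of fractions\<close>
         loc1 = frac_hom R1 S1;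
         loc2 = frac_hom R2 S2;
         locp = (\<lambda>p. frac_hom (Rp p) (\<pi>p p ` S));
         F12 = frac_map R1 S1 R2 S2 \<pi>2;
         F2p = (\<lambda>p. frac_map R2 S2 (Rp p) (\<pi>p p ` S) (\<pi>2p p));
         \<comment> \<open>quotient maps of \<open>Q1\<close> and \<open>Q2\<close>\<close>
         q_nQ = (\<lambda>x. nQ1 +>\<^bsub>Q1\<^esub> x);
         q_Sn = (\<lambda>x. Sn1 +>\<^bsub>Q1\<^esub> x);
         q_Sp1 = (\<lambda>p x. Sp1 p +>\<^bsub>Q1\<^esub> x);
         q_Sp2 = (\<lambda>p x. Sp2 p +>\<^bsub>Q2\<^esub> x);
         \<comment> \<open>natural maps between factor rings\<close>
         \<phi> = induced (carrier Q1) q_Sn F12;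
         \<psi> = (\<lambda>p. induced (carrier Q2) (q_Sp2 p) (F2p p));
         \<alpha> = induced (carrier Q1) q_nQ q_Sn;
         \<beta> = (\<lambda>p. induced (carrier Q1) q_Sn (q_Sp2 p \<circ> F12));
         \<gamma> = (\<lambda>p. induced (carrier Q1) q_Sn (q_Sp1 p));
         \<epsilon> = (\<lambda>p. induced (carrier Q1) (q_Sp1 p) (q_Sp2 p \<circ> F12))
     in
       \<comment> \<open>identification of \<open>Q1\<close> and \<open>L\<close> as rings under \<open>R\<close>\<close>
       (ring Q1 \<and> ring L \<and> \<sigma> \<in> ring_iso Q1 L \<and>
        (\<forall>r\<in>carrier R. \<sigma> (loc1 (\<pi> r)) = localization_hom R S r)) \<and>

       \<comment> \<open>1\<close>
       (Sp1 ` min\<aa> \<subseteq> prime_spectrum Q1 \<and> inj_on Sp1 min\<aa> \<and>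
        (\<lambda>p. \<sigma> ` Sp1 p) ` min\<aa> \<subseteq> prime_spectrum L \<and> inj_on (\<lambda>p. \<sigma> ` Sp1 p) min\<aa> \<and>
        nQ1 \<subseteq> Sn1) \<and>

       \<comment> \<open>2\<close>
       (S2 \<in> Den R2 {\<zero>\<^bsub>R2\<^esub>} \<and>
        ideal Sn1 Q1 \<and> ring Q2 \<and> \<phi> \<in> ring_iso (Q1 Quot Sn1) Q2 \<and>
        bij_betw Sp2 min\<aa> (minimal_primes Q2)) \<and>

       \<comment> \<open>3\<close>
       (\<forall>p\<in>min\<aa>.
          \<pi>p p ` S \<in> Den (Rp p) {\<zero>\<^bsub>Rp p\<^esub>} \<and>
          ideal (Sp1 p) Q1 \<and> ideal (Sp2 p) Q2 \<and>
          \<psi> p \<in> ring_iso (Q2 Quot Sp2 p) (Qp p) \<and>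
          \<epsilon> p \<in> ring_iso (Q1 Quot Sp1 p) (Q2 Quot Sp2 p) \<and>
          \<comment> \<open>the natural maps are ring homomorphisms\<close>
          ring_hom_ring R R1 \<pi> \<and>
          ring_hom_ring R1 R2 \<pi>2 \<and>
          ring_hom_ring R2 (Rp p) (\<pi>2p p) \<and>
          ring_hom_ring R (Rp p) (\<pi>p p) \<and>
          ring_hom_ring R1 Q1 loc1 \<and>
          ring_hom_ring R2 Q2 loc2 \<and>
          ring_hom_ring (Rp p) (Qp p) (locp p) \<and>
          ring_hom_ring Q1 Q2 F12 \<and>
          ring_hom_ring Q2 (Qp p) (F2p p) \<and>
          ring_hom_ring Q1 (Q1 Quot nQ1) q_nQ \<and>
          ring_hom_ring Q1 (Q1 Quot Sn1) q_Sn \<and>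
          ring_hom_ring Q1 (Q1 Quot Sp1 p) (q_Sp1 p) \<and>
          ring_hom_ring Q2 (Q2 Quot Sp2 p) (q_Sp2 p) \<and>
          ring_hom_ring (Q1 Quot nQ1) (Q1 Quot Sn1) \<alpha> \<and>
          ring_hom_ring (Q1 Quot Sn1) (Q2 Quot Sp2 p) (\<beta> p) \<and>
          ring_hom_ring (Q1 Quot Sn1) (Q1 Quot Sp1 p) (\<gamma> p) \<and>
          \<comment> \<open>the diagram commutes\<close>
          (\<forall>r\<in>carrier R. \<pi>p p r = \<pi>2p p (\<pi>2 (\<pi> r))) \<and>
          (\<forall>x\<in>carrier R1. F12 (loc1 x) = loc2 (\<pi>2 x)) \<and>
          (\<forall>x\<in>carrier R2. F2p p (loc2 x) = locp p (\<pi>2p p x)) \<and>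
          (\<forall>x\<in>carrier Q1. \<phi> (q_Sn x) = F12 x) \<and>
          (\<forall>x\<in>carrier Q2. \<psi> p (q_Sp2 p x) = F2p p x) \<and>
          (\<forall>x\<in>carrier Q1. \<alpha> (q_nQ x) = q_Sn x) \<and>
          (\<forall>y\<in>carrier (Q1 Quot Sn1). \<beta> p y = q_Sp2 p (\<phi> y)) \<and>
          (\<forall>x\<in>carrier Q1. \<gamma> p (q_Sn x) = q_Sp1 p x) \<and>
          (\<forall>y\<in>carrier (Q1 Quot Sn1). \<epsilon> p (\<gamma> p y) = \<beta> p y)) \<and>

       \<comment> \<open>4\<close>
       (nilpotent_ideal R1 n1 \<longrightarrow>
          \<comment> \<open>(a)\<close>
          (bij_betw Sp1 min\<aa> (minimal_primes Q1) \<and>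
           bij_betw (\<lambda>p. \<sigma> ` Sp1 p) min\<aa> (minimal_primes L) \<and>
           minimal_primes L = {\<sigma> ` Sp1 p | p. p \<in> min\<aa>}) \<and>
          \<comment> \<open>(b)\<close>
          (S2 \<in> Den R2 {\<zero>\<^bsub>R2\<^esub>} \<and>
           Sn1 = nQ1 \<and>
           induced (carrier Q1) q_Sn q_nQ \<in> ring_iso (Q1 Quot Sn1) (Q1 Quot nQ1) \<and>
           induced (carrier Q1) q_nQ F12 \<in> ring_iso (Q1 Quot nQ1) Q2))"
proof -
  interpret normal_submonoid_finite R S
    using normal_submonoidI[OF assms(1-3)] assms(4)
    by (simp add: normal_submonoid_finite_def normal_submonoid_finite_axioms_def)
  have part1: "Sp1 ` \<mm> \<subseteq> prime_spectrum Q1" "(\<lambda>p. \<sigma> ` Sp1 p) ` \<mm> \<subseteq> prime_spectrum \<L>"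
    using Sp1_prime by blast+
  have part3: "minimal_prime_over_torsion R S p" if "p \<in> \<mm>" for p
    using that normal_submonoid_finite_axioms
    by (simp add: minimal_prime_over_torsion_def minimal_prime_over_torsion_axioms_def)
  have minL: "minimal_primes \<L> = {\<sigma> ` Sp1 p |p. p \<in> \<mm>}" if "nilpotent_ideal R1 n1"
    using bij_betw_imp_surj_on[OF bij_min_L[OF that], symmetric] by blast
  have iso: "induced (carrier Q1) qn qr \<in> ring_iso (Q1 Quot Sn1) (Q1 Quot nQ1)"
    "induced (carrier Q1) qr F12 \<in> ring_iso (Q1 Quot nQ1) Q2" if nil: "nilpotent_ideal R1 n1"
  proof -
    \<comment> \<open>Once the two ideals coincide, the first map is the quotient map factored
      through itself, and the second is the isomorphism already obtained for
      \<open>Sn1\<close>.\<close>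
    interpret q: ring_epi Q1 "Q1 Quot Sn1" qn by (rule ideal.ring_epi_coset[OF ideal_Sn1])
    have "induced_hom Q1 (Q1 Quot Sn1) qn (Q1 Quot Sn1) qn"
      by (rule induced_hom.intro[OF q.ring_epi_axioms q.ring_hom_ring_axioms], unfold_locales)
    from induced_hom.induced_ring_iso[OF this q.surj]
    show "induced (carrier Q1) qn qr \<in> ring_iso (Q1 Quot Sn1) (Q1 Quot nQ1)"
      unfolding nQ1_eq[OF nil] .
    show "induced (carrier Q1) qr F12 \<in> ring_iso (Q1 Quot nQ1) Q2"
      unfolding nQ1_eq[OF nil] by (rule phi_iso)
  qed
  show ?thesis
    unfolding Let_def
    by (intro conjI ballI impI ring_Q1 ring_Q2 ring_localization sigma_iso sigma_frac_hom part1 inj_Sp1 inj_sigma_Sp1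
        N1.prime_radical_frac_ring_subset N2.S_in_Den ideal_Sn1 phi_iso bij_min_Q2
        minimal_prime_over_torsion.diagram[OF part3] bij_min_Q1 bij_min_L minL nQ1_eq[symmetric] iso; assumption)
qed

end
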